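(* Let $\mathbb X$ be a virtual equipment and let $j\colon A\to E$ be a tight-cell. Suppose that $\mathbb X$ admits left extensions of tight-cells $A\to E$ along $j$. Then the category $\mathbb X[j]_1$ is equipped with left-skew-monoidal structure for which there is an isomorphism of categories $\mathbf{Mon}(\mathbb X[j]_1)\cong\mathbf{Mon}(\mathbb X[j])$ which, together with the isomorphism $\mathbf{Mon}(\mathbb X[j])\cong\mathbf{RMnd}(j)$ described in the context, forms a chain $$\mathbf{Mon}(\mathbb X[j]_1)\cong\mathbf{Mon}(\mathbb X[j])\cong\mathbf{RMnd}(j)$$ commuting with the forgetful functors to $\mathbb X[A,E]$. Here $\mathbf{Mon}(\mathbb X[j]_1)$ is the category of monoids in this left-skew-monoidal category, $\mathbf{Mon}(\mathbb X[j])$ is the category of monoids in the associative-normal left-skew-multicategory $\mathbb X[j]$, and $\mathbf{RMnd}(j)$ is the category of $j$-relative monads. Furthermore, $\mathbb X[j]_1$ is (1) associative-normal (the associator is invertible) if every such left extension $j\rhd f\colon E\to E$ is $j$-absolute; (2) left-normal (the left unitor is invertible) if $j$ is dense; (3) right-normal (the right unitor is invertible) if $j$ is fully faithful.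
   Context: Virtual equipments. A virtual double category has objects; a category of tight-cells $f\colon A\to B$ (the composite of $f\colon A\to B$ and $g\colon B\to C$ is $gf$); loose-cells $p\colon A\nrightarrow B$; and 2-cells, each having as frame a chain of loose-cells $p_1\colon A_1\nrightarrow A_0,\dots,p_n\colon A_n\nrightarrow A_{n-1}$ ($n\ge 0$; chains are always listed in this order), a loose-cell $q\colon B_n\nrightarrow B_0$, and tight-cells $f_0\colon A_0\to B_0$ (left) and $f_n\colon A_n\to B_n$ (right); 2-cells have identities and associative unital multicategory-style composition. $\phi\colon p_1,\dots,p_n\Rightarrow q$ denotes a 2-cell whose tight-cells are identities; $(\phi_1,\dots,\phi_n)$ denotes juxtaposition. A 2-cell $q_1,\dots,q_m\Rightarrow q$ is opcartesian if every 2-cell (with any tight-cells) with domain $p_1,\dots,p_l,q_1,\dots,q_m,r_1,\dots,r_n$ factors uniquely through it; then $q$ is the loose-composite $q_1\odot\cdots\odot q_m$ (the loose-identity $A(1,1)\colon A\nrightarrow A$ if $m=0$). It is left-opcartesian if this is only required when $l=0$ and the left tight-cell is an identity. A unary 2-cell from $p$ to $q$ with left $f$ and right $g$ is cartesian if every 2-cell into $q$ with left $ff'$ and right $gg'$ factors uniquely through it via a 2-cell with left $f'$ and right $g'$; then $p$ is the restriction $q(f,g)$. A virtual equipment is a virtual double category having all loose-identities and restrictions. Write $E(f,g):=E(1,1)(f,g)$; for $f\colon D\to E$, $g\colon A\to E$ it is a loose-cell $A\nrightarrow D$. The canonical isomorphisms $q(f,g)\cong C(f,1)\odot q\odot B(1,g)$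 are used implicitly. A 2-cell $f\Rightarrow g$ between tight-cells $A\to B$ is equivalently a 2-cell $B(1,f)\Rightarrow B(1,g)$, or $B(g,1)\Rightarrow B(f,1)$, or $()\Rightarrow B(f,g)$; these form a 2-category of objects, tight-cells and 2-cells, with hom-categories $\mathbb X[A,B]$. Restriction is functorial in 2-cells (contravariantly in the first argument, covariantly in the second). For $f\colon A\to B$, $\frown_f\colon ()\Rightarrow B(f,f)$ (corresponding to $1_f$) and $\smile_f\colon B(1,f),B(f,1)\Rightarrow B(1,1)$ are the canonical 2-cells (unit and counit of the adjunction $B(1,f)\dashv B(f,1)$). $\phi(f,g)$ denotes the 2-cell obtained from $\phi$ by restricting along $f$ on the left and $g$ on the right; e.g. $\smile_t(x,y)\colon E(x,t),E(t,y)\Rightarrow E(x,y)$ is composition. Left extensions, density, absoluteness, full faithfulness. A right lift of $q\colon X\nrightarrow Z$ through $p\colon Y\nrightarrow Z$ is a loose-cell $s\colon X\nrightarrow Y$ with a 2-cell $\varpi\colon p,s\Rightarrow q$ such that every 2-cell $p,r_1,\dots,r_n\Rightarrow q$ ($n\ge0$) factors uniquely as $\varpi\circ(1_p,\psi)$ with $\psi\colon r_1,\dots,r_n\Rightarrow s$. For $p\colon Y\nrightarrow Z$ and $f\colon Z\to X$, a $p$-colimit of $f$ is a tight-cell $c\colon Y\to X$ with $\lambda\colon p\Rightarrow X(f,c)$ such that $(\lambda,1)$ followed by $\smile_c(f,1)$, a 2-cell $p,X(c,1)\Rightarrow X(f,1)$, exhibits $X(c,1)$ as the right lift of $X(f,1)$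 through $p$. The left extension of $f\colon A\to X$ along $j\colon A\to E$ is a tight-cell $j\rhd f\colon E\to X$ with a 2-cell $\pi_f\colon f\Rightarrow(j\rhd f)j$ such that $E(j,1)\Rightarrow X((j\rhd f)j,j\rhd f)\Rightarrow X(f,j\rhd f)$ (the action of $j\rhd f$, i.e. $\frown_{j\rhd f}(j,1)$, followed by restriction along $\pi_f$) exhibits $j\rhd f$ as the $E(j,1)$-colimit of $f$. $j$ is dense if $1_j$ exhibits $1_E$ as the left extension of $j$ along $j$. A $p$-colimit $(c,\lambda)$ of $f\colon Z\to E$ is $j$-absolute if the 2-cell $E(j,f),p\Rightarrow E(j,c)$, given by $(1,\lambda)$ followed by $\smile_f(j,c)$, is left-opcartesian; a left extension $j\rhd f$ is $j$-absolute if it is so as an $E(j,1)$-colimit. $j$ is fully faithful if $\frown_j\colon()\Rightarrow E(j,j)$ is opcartesian. Relative monads. A $j$-relative monad $(t,\dagger,\eta)$ comprises a tight-cell $t\colon A\to E$, a 2-cell $\dagger\colon E(j,t)\Rightarrow E(t,t)$ and a 2-cell $\eta\colon j\Rightarrow t$ such that: (i) $E(\eta,t)\circ\dagger=1_{E(j,t)}$; (ii) $\dagger\circ E(j,\eta)\circ\frown_j=\frown_t$; (iii) the following 2-cells $E(j,t),E(j,t)\Rightarrow E(t,t)$ are equal: $(\dagger,\dagger)$ followed by $\smile_t(t,t)$; and $(1,\dagger)$ followed by $\smile_t(j,t)$ followed by $\dagger$. A morphism is a 2-cell $\tau\colon t\Rightarrow t'$ with $\tau\circ\eta=\eta'$ and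 $E(t,\tau)\circ\dagger=E(\tau,t')\circ\dagger'\circ E(j,\tau)$. Forgetful functor: $(t,\dagger,\eta)\mapsto t$. The skew-multicategory $\mathbb X[j]$ and its monoids. $\mathbb X[j]$ has as objects the tight-cells $A\to E$; a multimorphism $x_1,\dots,x_n\to s$ ($n>0$, each $x_i$ a tight-cell or a formal marker $\bullet$) is a 2-cell $p_1,E(j,1),p_2,\dots,E(j,1),p_n\Rightarrow E(1,s)$ where $p_i=E(1,t_i)$ if $x_i=t_i$ and $p_i=E(1,j)$ if $x_i=\bullet$; identities and composition are those of 2-cells; left-unitors (inserting a $\bullet$ before an entry) are given by pasting $\smile_j$, right-unitors (deleting a $\bullet$ after an entry) by pasting $\frown_j\colon()\Rightarrow E(j,1)\odot E(1,j)$. $\mathbb X[j]_1$ is its category of unary multimorphisms (between objects), i.e. $\mathbb X[A,E]$. A monoid in $\mathbb X[j]$ comprises an object $M$ and multimorphisms $m\colon M,M\to M$ and $u\colon\bullet\to M$ such that $m\circ(u,1)$ is the left-unitor applied to $1_M$ (inserting $\bullet$ first), the right-unitor applied to $m\circ(1,u)$ is $1_M$, and $m\circ(m,1)=m\circ(1,m)$; homomorphisms are unary multimorphisms preserving $m$ and $u$; the forgetful functor sends $(M,m,u)$ to $M$. The isomorphism $\mathbf{RMnd}(j)\cong\mathbf{Mon}(\mathbb X[j])$ sends $(t,\dagger,\eta)$ to the monoid with carrier $t$, unit $E(1,\eta)\colon E(1,j)\Rightarrow E(1,t)$, and multiplication $E(1,t),E(j,1),E(1,t)\Rightarrow E(1,t)$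 corresponding to the 2-cell $E(1,t),E(j,t)\Rightarrow E(1,t)$ given by $(1,\dagger)$ followed by $\smile_t(1,t)$. Left-skew-monoidal categories. A left-skew-monoidal category is a category with a functor $\otimes'$ of two variables, a unit object $J$, and natural (not necessarily invertible) transformations, the associator $\alpha\colon(X\otimes' Y)\otimes' Z\to X\otimes'(Y\otimes' Z)$, the left unitor $\lambda_X\colon J\otimes' X\to X$ and the right unitor $\rho_X\colon X\to X\otimes' J$, satisfying Szlachányi's five coherence axioms. A monoid therein is $(M,m\colon M\otimes' M\to M,u\colon J\to M)$ with $m\circ(u\otimes' M)=\lambda_M$, $m\circ(M\otimes' u)\circ\rho_M=1_M$ and $m\circ(M\otimes' m)\circ\alpha=m\circ(m\otimes' M)$; homomorphisms are morphisms preserving $m$ and $u$; the forgetful functor sends $(M,m,u)$ to $M$. *)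

theory Defs
  imports Main
begin

section \<open>Virtual double categories and virtual equipments\<close>

text \<open>
  All structures are relativised to carriers. A loose-cell \<open>p\<close> goes from \<open>ldom p\<close> to \<open>lcod p\<close>;
  a chain \<open>p\<^sub>1, \<dots>, p\<^sub>n\<close> with \<open>p\<^sub>i\<close> from \<open>A\<^sub>i\<close> to \<open>A\<^sub>i\<^sub>-\<^sub>1\<close> is the list \<open>[p\<^sub>1, \<dots>, p\<^sub>n]\<close>, so that
  consecutive entries satisfy \<open>ldom p\<^sub>i = lcod p\<^sub>i\<^sub>+\<^sub>1\<close>. \<open>tcomp g f\<close> is the composite \<open>g f\<close>.
  \<open>ccomp \<psi> f [\<phi>\<^sub>1, \<dots>, \<phi>\<^sub>n]\<close> is the composite \<open>\<psi> \<circ> (\<phi>\<^sub>1, \<dots>, \<phi>\<^sub>n)\<close>, where \<open>f\<close> is the left tight-cell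
  of the composable list of 2-cells. For \<open>n > 0\<close> it is the left tight-cell of \<open>\<phi>\<^sub>1\<close>; for \<open>n = 0\<close> it is
  a genuine argument, namely the tight-cell with which the nullary 2-cell \<open>\<psi>\<close> is precomposed.
\<close>

record ('o, 't, 'l, 'c) vdc =
  Obj :: "'o set"
  Tight :: "'t set"
  tdom :: "'t \<Rightarrow> 'o"
  tcod :: "'t \<Rightarrow> 'o"
  tid :: "'o \<Rightarrow> 't"
  tcomp :: "'t \<Rightarrow> 't \<Rightarrow> 't"
  Loose :: "'l set"
  ldom :: "'l \<Rightarrow> 'o"
  lcod :: "'l \<Rightarrow> 'o"
  Cell :: "'c set"
  cdom :: "'c \<Rightarrow> 'l list"
  ccod :: "'c \<Rightarrow> 'l"
  cleft :: "'c \<Rightarrow> 't"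
  cright :: "'c \<Rightarrow> 't"
  cid :: "'l \<Rightarrow> 'c"
  ccomp :: "'c \<Rightarrow> 't \<Rightarrow> 'c list \<Rightarrow> 'c"

definition tights :: "('o, 't, 'l, 'c, 'm) vdc_scheme \<Rightarrow> 'o \<Rightarrow> 'o \<Rightarrow> 't set" where
  "tights X A B = {f \<in> Tight X. tdom X f = A \<and> tcod X f = B}"

text \<open>\<open>lchain X a ps b\<close>: \<open>ps\<close> is a chain with \<open>A\<^sub>0 = a\<close> and \<open>A\<^sub>n = b\<close>.\<close>

fun lchain :: "('o, 't, 'l, 'c, 'm) vdc_scheme \<Rightarrow> 'o \<Rightarrow> 'l list \<Rightarrow> 'o \<Rightarrow> bool" where
  "lchain X a [] b \<longleftrightarrow> a \<in> Obj X \<and> a = b"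
| "lchain X a (p # ps) b \<longleftrightarrow> p \<in> Loose X \<and> lcod X p = a \<and> lchain X (ldom X p) ps b"

text \<open>\<open>cchain X f \<phi>s g\<close>: the 2-cells \<open>\<phi>s\<close> can be juxtaposed, with leftmost tight-cell \<open>f\<close> and
  rightmost tight-cell \<open>g\<close>.\<close>

fun cchain :: "('o, 't, 'l, 'c, 'm) vdc_scheme \<Rightarrow> 't \<Rightarrow> 'c list \<Rightarrow> 't \<Rightarrow> bool" where
  "cchain X f [] g \<longleftrightarrow> f \<in> Tight X \<and> f = g"
| "cchain X f (\<phi> # \<phi>s) g \<longleftrightarrow> \<phi> \<in> Cell X \<and> cleft X \<phi> = f \<and> cchain X (cright X \<phi>) \<phi>s g"

definition composable ::
  "('o, 't, 'l, 'c, 'm) vdc_scheme \<Rightarrow> 'c \<Rightarrow> 't \<Rightarrow> 'c list \<Rightarrow> 't \<Rightarrow> bool" where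
  "composable X \<psi> f \<phi>s g \<longleftrightarrow>
     \<psi> \<in> Cell X \<and> cchain X f \<phi>s g \<and> map (ccod X) \<phi>s = cdom X \<psi> \<and> tcod X f = tdom X (cleft X \<psi>)"

locale vdc =
  fixes X :: "('o, 't, 'l, 'c, 'm) vdc_scheme"
  assumes tdom_Obj: "f \<in> Tight X \<Longrightarrow> tdom X f \<in> Obj X"
    and tcod_Obj: "f \<in> Tight X \<Longrightarrow> tcod X f \<in> Obj X"
    and tid_tights: "a \<in> Obj X \<Longrightarrow> tid X a \<in> tights X a a"
    and tcomp_tights:
      "\<lbrakk>f \<in> Tight X; g \<in> Tight X; tcod X f = tdom X g\<rbrakk>
        \<Longrightarrow> tcomp X g f \<in> tights X (tdom X f) (tcod X g)"
    and tcomp_assoc: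
      "\<lbrakk>f \<in> Tight X; g \<in> Tight X; h \<in> Tight X; tcod X f = tdom X g; tcod X g = tdom X h\<rbrakk>
        \<Longrightarrow> tcomp X h (tcomp X g f) = tcomp X (tcomp X h g) f"
    and tcomp_tid_left: "f \<in> Tight X \<Longrightarrow> tcomp X (tid X (tcod X f)) f = f"
    and tcomp_tid_right: "f \<in> Tight X \<Longrightarrow> tcomp X f (tid X (tdom X f)) = f"
    and ldom_Obj: "p \<in> Loose X \<Longrightarrow> ldom X p \<in> Obj X"
    and lcod_Obj: "p \<in> Loose X \<Longrightarrow> lcod X p \<in> Obj X"
    and ccod_Loose: "\<phi> \<in> Cell X \<Longrightarrow> ccod X \<phi> \<in> Loose X"
    and cleft_Tight: "\<phi> \<in> Cell X \<Longrightarrow> cleft X \<phi> \<in> Tight X"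
    and cright_Tight: "\<phi> \<in> Cell X \<Longrightarrow> cright X \<phi> \<in> Tight X"
    and tcod_cleft: "\<phi> \<in> Cell X \<Longrightarrow> tcod X (cleft X \<phi>) = lcod X (ccod X \<phi>)"
    and tcod_cright: "\<phi> \<in> Cell X \<Longrightarrow> tcod X (cright X \<phi>) = ldom X (ccod X \<phi>)"
    and lchain_cdom:
      "\<phi> \<in> Cell X \<Longrightarrow> lchain X (tdom X (cleft X \<phi>)) (cdom X \<phi>) (tdom X (cright X \<phi>))"
    and cid_Cell:
      "p \<in> Loose X \<Longrightarrow> cid X p \<in> Cell X \<and> cdom X (cid X p) = [p] \<and> ccod X (cid X p) = p
        \<and> cleft X (cid X p) = tid X (lcod X p) \<and> cright X (cid X p) = tid X (ldom X p)"
    and ccomp_Cell: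
      "composable X \<psi> f \<phi>s g \<Longrightarrow>
        ccomp X \<psi> f \<phi>s \<in> Cell X
        \<and> cdom X (ccomp X \<psi> f \<phi>s) = concat (map (cdom X) \<phi>s)
        \<and> ccod X (ccomp X \<psi> f \<phi>s) = ccod X \<psi>
        \<and> cleft X (ccomp X \<psi> f \<phi>s) = tcomp X (cleft X \<psi>) f
        \<and> cright X (ccomp X \<psi> f \<phi>s) = tcomp X (cright X \<psi>) g"
    and ccomp_cid_left:
      "\<phi> \<in> Cell X \<Longrightarrow> ccomp X (cid X (ccod X \<phi>)) (cleft X \<phi>) [\<phi>] = \<phi>"
    and ccomp_cid_right:
      "\<phi> \<in> Cell X \<Longrightarrow> ccomp X \<phi> (tid X (tdom X (cleft X \<phi>))) (map (cid X) (cdom X \<phi>)) = \<phi>"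
    and ccomp_assoc:
      "\<lbrakk>composable X \<psi> f \<phi>s g; length \<chi>ss = length \<phi>s; length hs = Suc (length \<phi>s);
        hs ! 0 \<in> Tight X; tcod X (hs ! 0) = tdom X f;
        \<And>i. i < length \<phi>s \<Longrightarrow> composable X (\<phi>s ! i) (hs ! i) (\<chi>ss ! i) (hs ! Suc i)\<rbrakk>
        \<Longrightarrow> ccomp X (ccomp X \<psi> f \<phi>s) (hs ! 0) (concat \<chi>ss) =
            ccomp X \<psi> (tcomp X f (hs ! 0))
              (map (\<lambda>i. ccomp X (\<phi>s ! i) (hs ! i) (\<chi>ss ! i)) [0..<length \<phi>s])"

text \<open>\<open>glob X ps q\<close>: the 2-cells from \<open>ps\<close> to \<open>q\<close> whose tight-cells are identities.\<close>

definition glob :: "('o, 't, 'l, 'c, 'm) vdc_scheme \<Rightarrow> 'l list \<Rightarrow> 'l \<Rightarrow> 'c set" where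
  "glob X ps q = {\<phi> \<in> Cell X. cdom X \<phi> = ps \<and> ccod X \<phi> = q
     \<and> cleft X \<phi> = tid X (lcod X q) \<and> cright X \<phi> = tid X (ldom X q)}"

definition vcomp :: "('o, 't, 'l, 'c, 'm) vdc_scheme \<Rightarrow> 'c \<Rightarrow> 'c \<Rightarrow> 'c" where
  "vcomp X \<psi> \<phi> = ccomp X \<psi> (cleft X \<phi>) [\<phi>]"

text \<open>\<open>plug X \<chi> ps \<phi> rs\<close> is \<open>\<chi> \<circ> (1, \<dots>, 1, \<phi>, 1, \<dots>, 1)\<close>, for \<open>\<phi>\<close> with identity tight-cells.\<close>

definition plug ::
  "('o, 't, 'l, 'c, 'm) vdc_scheme \<Rightarrow> 'c \<Rightarrow> 'l list \<Rightarrow> 'c \<Rightarrow> 'l list \<Rightarrow> 'c" where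
  "plug X \<chi> ps \<phi> rs =
     ccomp X \<chi> (tid X (tdom X (cleft X \<chi>))) (map (cid X) ps @ [\<phi>] @ map (cid X) rs)"

text \<open>The conditions involving \<open>lchain\<close> and \<open>cleft\<close> fix the position of the domain of \<open>\<phi>\<close> in the
  chain, which the lists alone do not determine when \<open>\<phi>\<close> is nullary and \<open>ps\<close>, \<open>rs\<close> are empty.\<close>

definition opcartesian :: "('o, 't, 'l, 'c, 'm) vdc_scheme \<Rightarrow> 'c \<Rightarrow> bool" where
  "opcartesian X \<phi> \<longleftrightarrow> \<phi> \<in> glob X (cdom X \<phi>) (ccod X \<phi>) \<and>
     (\<forall>ps rs \<psi>. \<psi> \<in> Cell X \<and> cdom X \<psi> = ps @ cdom X \<phi> @ rs
          \<and> lchain X (tdom X (cleft X \<psi>)) ps (lcod X (ccod X \<phi>)) \<longrightarrow>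
        (\<exists>!\<chi>. \<chi> \<in> Cell X \<and> cdom X \<chi> = ps @ [ccod X \<phi>] @ rs \<and> plug X \<chi> ps \<phi> rs = \<psi>))"

definition left_opcartesian :: "('o, 't, 'l, 'c, 'm) vdc_scheme \<Rightarrow> 'c \<Rightarrow> bool" where
  "left_opcartesian X \<phi> \<longleftrightarrow> \<phi> \<in> glob X (cdom X \<phi>) (ccod X \<phi>) \<and>
     (\<forall>rs \<psi>. \<psi> \<in> Cell X \<and> cdom X \<psi> = cdom X \<phi> @ rs
          \<and> cleft X \<psi> = tid X (lcod X (ccod X \<phi>)) \<longrightarrow>
        (\<exists>!\<chi>. \<chi> \<in> Cell X \<and> cdom X \<chi> = [ccod X \<phi>] @ rs \<and> plug X \<chi> [] \<phi> rs = \<psi>))"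

definition cart_factors ::
  "('o, 't, 'l, 'c, 'm) vdc_scheme \<Rightarrow> 'c \<Rightarrow> 'l \<Rightarrow> 't \<Rightarrow> 't \<Rightarrow> 'c \<Rightarrow> 'c \<Rightarrow> bool" where
  "cart_factors X \<kappa> p f' g' \<psi> \<chi> \<longleftrightarrow> \<chi> \<in> Cell X \<and> ccod X \<chi> = p
     \<and> cleft X \<chi> = f' \<and> cright X \<chi> = g' \<and> vcomp X \<kappa> \<chi> = \<psi>"

definition cartesian :: "('o, 't, 'l, 'c, 'm) vdc_scheme \<Rightarrow> 'c \<Rightarrow> bool" where
  "cartesian X \<kappa> \<longleftrightarrow> \<kappa> \<in> Cell X \<and> (\<exists>p. cdom X \<kappa> = [p] \<and>
     (\<forall>f' g' \<psi>. f' \<in> Tight X \<and> tcod X f' = tdom X (cleft X \<kappa>)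
          \<and> g' \<in> Tight X \<and> tcod X g' = tdom X (cright X \<kappa>)
          \<and> \<psi> \<in> Cell X \<and> ccod X \<psi> = ccod X \<kappa>
          \<and> cleft X \<psi> = tcomp X (cleft X \<kappa>) f' \<and> cright X \<psi> = tcomp X (cright X \<kappa>) g' \<longrightarrow>
        (\<exists>!\<chi>. cart_factors X \<kappa> p f' g' \<psi> \<chi>)))"

text \<open>
  A virtual equipment comes with a choice of loose-identities \<open>lid A\<close> (with opcartesian 2-cell
  \<open>lunit A\<close>) and of restrictions \<open>restr q f g\<close> (with cartesian 2-cell \<open>rcell q f g\<close>). The choice is
  arbitrary, so a statement about all such structures is a statement about all virtual double
  categories having loose-identities and restrictions, for any way of choosing them.
\<close>

record ('o, 't, 'l, 'c) vequip = "('o, 't, 'l, 'c) vdc" +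
  lid :: "'o \<Rightarrow> 'l"
  lunit :: "'o \<Rightarrow> 'c"
  restr :: "'l \<Rightarrow> 't \<Rightarrow> 't \<Rightarrow> 'l"
  rcell :: "'l \<Rightarrow> 't \<Rightarrow> 't \<Rightarrow> 'c"

locale virtual_equipment = vdc X for X :: "('o, 't, 'l, 'c, 'm) vequip_scheme" +
  assumes lid_Loose:
      "a \<in> Obj X \<Longrightarrow> lid X a \<in> Loose X \<and> ldom X (lid X a) = a \<and> lcod X (lid X a) = a"
    and lunit_opcartesian:
      "a \<in> Obj X \<Longrightarrow> lunit X a \<in> glob X [] (lid X a) \<and> opcartesian X (lunit X a)"
    and restr_Loose:
      "\<lbrakk>q \<in> Loose X; f \<in> Tight X; g \<in> Tight X; tcod X f = lcod X q; tcod X g = ldom X q\<rbrakk>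
        \<Longrightarrow> restr X q f g \<in> Loose X
            \<and> ldom X (restr X q f g) = tdom X g \<and> lcod X (restr X q f g) = tdom X f"
    and rcell_cartesian:
      "\<lbrakk>q \<in> Loose X; f \<in> Tight X; g \<in> Tight X; tcod X f = lcod X q; tcod X g = ldom X q\<rbrakk>
        \<Longrightarrow> cartesian X (rcell X q f g) \<and> cdom X (rcell X q f g) = [restr X q f g]
            \<and> ccod X (rcell X q f g) = q
            \<and> cleft X (rcell X q f g) = f \<and> cright X (rcell X q f g) = g"

section \<open>Canonical 2-cells\<close>

text \<open>
  \<open>hm X f g\<close> is the loose-cell \<open>E(f,g)\<close>. A 2-cell into it is given by \<open>hlift\<close>: \<open>hlift X f g a b \<psi>\<close> has
  left tight-cell \<open>a\<close>, right tight-cell \<open>b\<close>, and corresponds under the cartesian 2-cell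
  \<open>hcell X f g\<close> from \<open>E(f,g)\<close> to \<open>E(1,1)\<close> to the 2-cell \<open>\<psi>\<close> into the loose-identity, with tight-cells
  \<open>f a\<close> and \<open>g b\<close>. All canonical 2-cells below are defined in this way, so that no canonical
  isomorphism between restrictions has to be chosen.
\<close>

definition hm :: "('o, 't, 'l, 'c, 'm) vequip_scheme \<Rightarrow> 't \<Rightarrow> 't \<Rightarrow> 'l" where
  "hm X f g = restr X (lid X (tcod X f)) f g"

definition hcell :: "('o, 't, 'l, 'c, 'm) vequip_scheme \<Rightarrow> 't \<Rightarrow> 't \<Rightarrow> 'c" where
  "hcell X f g = rcell X (lid X (tcod X f)) f g"

definition hlift :: "('o, 't, 'l, 'c, 'm) vequip_scheme \<Rightarrow> 't \<Rightarrow> 't \<Rightarrow> 't \<Rightarrow> 't \<Rightarrow> 'c \<Rightarrow> 'c" where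
  "hlift X f g a b \<psi> = (THE \<chi>. cart_factors X (hcell X f g) (hm X f g) a b \<psi> \<chi>)"

definition hglob :: "('o, 't, 'l, 'c, 'm) vequip_scheme \<Rightarrow> 't \<Rightarrow> 't \<Rightarrow> 'c \<Rightarrow> 'c" where
  "hglob X f g \<psi> = hlift X f g (tid X (tdom X f)) (tid X (tdom X g)) \<psi>"

text \<open>\<open>B(1,f)\<close> and \<open>B(f,1)\<close>, for \<open>f\<close> with codomain \<open>B\<close>.\<close>

definition companion :: "('o, 't, 'l, 'c, 'm) vequip_scheme \<Rightarrow> 't \<Rightarrow> 'l" where
  "companion X f = hm X (tid X (tcod X f)) f"

definition conjoint :: "('o, 't, 'l, 'c, 'm) vequip_scheme \<Rightarrow> 't \<Rightarrow> 'l" where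
  "conjoint X f = hm X f (tid X (tcod X f))"

text \<open>The canonical 2-cell from \<open>B(1,1), B(1,1)\<close> to \<open>B(1,1)\<close>.\<close>

definition lmult :: "('o, 't, 'l, 'c, 'm) vequip_scheme \<Rightarrow> 'o \<Rightarrow> 'c" where
  "lmult X B = (THE \<mu>. \<mu> \<in> glob X [lid X B, lid X B] (lid X B)
     \<and> plug X \<mu> [lid X B] (lunit X B) [] = cid X (lid X B))"

text \<open>\<open>smile X x t y\<close> is \<open>\<smile>\<^sub>t(x,y)\<close>, from \<open>E(x,t), E(t,y)\<close> to \<open>E(x,y)\<close>; \<open>frown X f\<close> is \<open>\<frown>\<^sub>f\<close>.\<close>

definition smile :: "('o, 't, 'l, 'c, 'm) vequip_scheme \<Rightarrow> 't \<Rightarrow> 't \<Rightarrow> 't \<Rightarrow> 'c" where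
  "smile X x t y = hglob X x y (ccomp X (lmult X (tcod X t)) x [hcell X x t, hcell X t y])"

definition frown :: "('o, 't, 'l, 'c, 'm) vequip_scheme \<Rightarrow> 't \<Rightarrow> 'c" where
  "frown X f = hglob X f f (ccomp X (lunit X (tcod X f)) f [])"

text \<open>\<open>laction X g\<close> is the 2-cell from \<open>B(1,1)\<close> to \<open>C(1,1)\<close> with both tight-cells equal to
  \<open>g\<close> from \<open>B\<close> to \<open>C\<close>, and \<open>action X g x y\<close> is \<open>\<frown>\<^sub>g(x,y)\<close>, from \<open>B(x,y)\<close> to \<open>C(gx,gy)\<close>.\<close>

definition laction :: "('o, 't, 'l, 'c, 'm) vequip_scheme \<Rightarrow> 't \<Rightarrow> 'c" where
  "laction X g = (THE \<chi>. \<chi> \<in> Cell X \<and> cdom X \<chi> = [lid X (tdom X g)]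
     \<and> ccod X \<chi> = lid X (tcod X g) \<and> cleft X \<chi> = g \<and> cright X \<chi> = g
     \<and> vcomp X \<chi> (lunit X (tdom X g)) = ccomp X (lunit X (tcod X g)) g [])"

definition action :: "('o, 't, 'l, 'c, 'm) vequip_scheme \<Rightarrow> 't \<Rightarrow> 't \<Rightarrow> 't \<Rightarrow> 'c" where
  "action X g x y = hglob X (tcomp X g x) (tcomp X g y) (vcomp X (laction X g) (hcell X x y))"

text \<open>
  A 2-cell \<open>\<phi>\<close> from \<open>f\<close> to \<open>g\<close> between tight-cells is represented by a 2-cell from \<open>B(1,f)\<close> to
  \<open>B(1,g)\<close>. \<open>nullary X f g \<phi>\<close> is the corresponding 2-cell from \<open>()\<close> to \<open>B(1,1)\<close> with left tight-cell
  \<open>f\<close> and right tight-cell \<open>g\<close> (that is, from \<open>()\<close> to \<open>B(f,g)\<close>), obtained by precomposing \<open>\<phi>\<close> with the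
  canonical 2-cell from \<open>()\<close> to \<open>B(1,f)\<close> with left tight-cell \<open>f\<close> and right tight-cell the identity.
  \<open>restr_post X h f g \<phi>\<close> is \<open>B(h,\<phi>)\<close>, from \<open>B(h,f)\<close> to \<open>B(h,g)\<close>, and \<open>restr_pre X f g h \<phi>\<close> is
  \<open>B(\<phi>,h)\<close>, from \<open>B(g,h)\<close> to \<open>B(f,h)\<close>.
\<close>

definition two_cells :: "('o, 't, 'l, 'c, 'm) vequip_scheme \<Rightarrow> 't \<Rightarrow> 't \<Rightarrow> 'c set" where
  "two_cells X f g = glob X [companion X f] (companion X g)"

definition nullary :: "('o, 't, 'l, 'c, 'm) vequip_scheme \<Rightarrow> 't \<Rightarrow> 't \<Rightarrow> 'c \<Rightarrow> 'c" where
  "nullary X f g \<phi> = vcomp X (hcell X (tid X (tcod X g)) g)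
     (vcomp X \<phi> (hlift X (tid X (tcod X f)) f f (tid X (tdom X f))
                   (ccomp X (lunit X (tcod X f)) f [])))"

definition restr_post :: "('o, 't, 'l, 'c, 'm) vequip_scheme \<Rightarrow> 't \<Rightarrow> 't \<Rightarrow> 't \<Rightarrow> 'c \<Rightarrow> 'c" where
  "restr_post X h f g \<phi> =
     hglob X h g (ccomp X (lmult X (tcod X h)) h [hcell X h f, nullary X f g \<phi>])"

definition restr_pre :: "('o, 't, 'l, 'c, 'm) vequip_scheme \<Rightarrow> 't \<Rightarrow> 't \<Rightarrow> 't \<Rightarrow> 'c \<Rightarrow> 'c" where
  "restr_pre X f g h \<phi> =
     hglob X f h (ccomp X (lmult X (tcod X h)) f [nullary X f g \<phi>, hcell X g h])"

section \<open>Left extensions, density, absoluteness, full faithfulness\<close>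

definition right_lift :: "('o, 't, 'l, 'c, 'm) vdc_scheme \<Rightarrow> 'l \<Rightarrow> 'l \<Rightarrow> 'l \<Rightarrow> 'c \<Rightarrow> bool" where
  "right_lift X q p s \<omega> \<longleftrightarrow> q \<in> Loose X \<and> p \<in> Loose X \<and> s \<in> Loose X \<and> \<omega> \<in> glob X [p, s] q \<and>
     (\<forall>rs. \<forall>\<chi> \<in> glob X (p # rs) q.
        \<exists>!\<psi>. \<psi> \<in> glob X rs s \<and> ccomp X \<omega> (tid X (lcod X p)) [cid X p, \<psi>] = \<chi>)"

definition colimit :: "('o, 't, 'l, 'c, 'm) vequip_scheme \<Rightarrow> 'l \<Rightarrow> 't \<Rightarrow> 't \<Rightarrow> 'c \<Rightarrow> bool" where
  "colimit X p f c \<theta> \<longleftrightarrow> p \<in> Loose X \<and> f \<in> Tight X \<and> tdom X f = lcod X p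
     \<and> c \<in> tights X (ldom X p) (tcod X f) \<and> \<theta> \<in> glob X [p] (hm X f c)
     \<and> right_lift X (conjoint X f) p (conjoint X c)
         (ccomp X (smile X f c (tid X (tcod X f))) (tid X (lcod X p)) [\<theta>, cid X (conjoint X c)])"

definition absolute_colimit ::
  "('o, 't, 'l, 'c, 'm) vequip_scheme \<Rightarrow> 't \<Rightarrow> 'l \<Rightarrow> 't \<Rightarrow> 't \<Rightarrow> 'c \<Rightarrow> bool" where
  "absolute_colimit X j p f c \<theta> \<longleftrightarrow> colimit X p f c \<theta> \<and>
     left_opcartesian X
       (ccomp X (smile X j f c) (tid X (tdom X j)) [cid X (hm X j f), \<theta>])"

text \<open>The 2-cell \<open>E(j,1) \<Rightarrow> X(ej,e) \<Rightarrow> X(f,e)\<close> induced by a 2-cell \<open>\<pi>\<close> from \<open>f\<close> to \<open>ej\<close>.\<close>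

definition ext_cell :: "('o, 't, 'l, 'c, 'm) vequip_scheme \<Rightarrow> 't \<Rightarrow> 't \<Rightarrow> 't \<Rightarrow> 'c \<Rightarrow> 'c" where
  "ext_cell X j f e \<pi> =
     vcomp X (restr_pre X f (tcomp X e j) e \<pi>) (action X e j (tid X (tcod X j)))"

definition left_extension ::
  "('o, 't, 'l, 'c, 'm) vequip_scheme \<Rightarrow> 't \<Rightarrow> 't \<Rightarrow> 't \<Rightarrow> 'c \<Rightarrow> bool" where
  "left_extension X j f e \<pi> \<longleftrightarrow> j \<in> Tight X \<and> f \<in> Tight X \<and> tdom X f = tdom X j
     \<and> e \<in> tights X (tcod X j) (tcod X f) \<and> \<pi> \<in> two_cells X f (tcomp X e j)
     \<and> colimit X (conjoint X j) f e (ext_cell X j f e \<pi>)"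

definition absolute_left_extension ::
  "('o, 't, 'l, 'c, 'm) vequip_scheme \<Rightarrow> 't \<Rightarrow> 't \<Rightarrow> 't \<Rightarrow> 'c \<Rightarrow> bool" where
  "absolute_left_extension X j f e \<pi> \<longleftrightarrow> left_extension X j f e \<pi>
     \<and> absolute_colimit X j (conjoint X j) f e (ext_cell X j f e \<pi>)"

definition dense :: "('o, 't, 'l, 'c, 'm) vequip_scheme \<Rightarrow> 't \<Rightarrow> bool" where
  "dense X j \<longleftrightarrow> left_extension X j j (tid X (tcod X j)) (cid X (companion X j))"

definition fully_faithful :: "('o, 't, 'l, 'c, 'm) vequip_scheme \<Rightarrow> 't \<Rightarrow> bool" where
  "fully_faithful X j \<longleftrightarrow> j \<in> Tight X \<and> opcartesian X (frown X j)"

section \<open>Categories and functors\<close>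

text \<open>The hom-sets of a category need not be disjoint; composition must not depend on the objects
  (in all categories below it is composition of underlying 2-cells), but the action of a functor
  on a morphism may depend on the source and target under consideration.\<close>

record ('x, 'a) cat =
  ob :: "'x set"
  hom :: "'x \<Rightarrow> 'x \<Rightarrow> 'a set"
  idt :: "'x \<Rightarrow> 'a"
  cmp :: "'a \<Rightarrow> 'a \<Rightarrow> 'a"

definition category :: "('x, 'a) cat \<Rightarrow> bool" where
  "category C \<longleftrightarrow>
     (\<forall>x \<in> ob C. idt C x \<in> hom C x x) \<and>
     (\<forall>x \<in> ob C. \<forall>y \<in> ob C. \<forall>z \<in> ob C. \<forall>f \<in> hom C x y. \<forall>g \<in> hom C y z. cmp C g f \<in> hom C x z) \<and>
     (\<forall>x \<in> ob C. \<forall>y \<in> ob C. \<forall>f \<in> hom C x y. cmp C f (idt C x) = f \<and> cmp C (idt C y) f = f) \<and>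
     (\<forall>w \<in> ob C. \<forall>x \<in> ob C. \<forall>y \<in> ob C. \<forall>z \<in> ob C.
        \<forall>f \<in> hom C w x. \<forall>g \<in> hom C x y. \<forall>h \<in> hom C y z. cmp C h (cmp C g f) = cmp C (cmp C h g) f)"

definition iso_in :: "('x, 'a) cat \<Rightarrow> 'x \<Rightarrow> 'x \<Rightarrow> 'a \<Rightarrow> bool" where
  "iso_in C x y f \<longleftrightarrow> f \<in> hom C x y \<and>
     (\<exists>g \<in> hom C y x. cmp C g f = idt C x \<and> cmp C f g = idt C y)"

definition prod_cat :: "('x, 'a) cat \<Rightarrow> ('y, 'b) cat \<Rightarrow> ('x \<times> 'y, 'a \<times> 'b) cat" where
  "prod_cat C D =
     \<lparr>ob = ob C \<times> ob D,
      hom = (\<lambda>x y. hom C (fst x) (fst y) \<times> hom D (snd x) (snd y)),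
      idt = (\<lambda>x. (idt C (fst x), idt D (snd x))),
      cmp = (\<lambda>g f. (cmp C (fst g) (fst f), cmp D (snd g) (snd f)))\<rparr>"

record ('x, 'a, 'y, 'b) ftor =
  fob :: "'x \<Rightarrow> 'y"
  far :: "'x \<Rightarrow> 'x \<Rightarrow> 'a \<Rightarrow> 'b"

definition is_functor :: "('x, 'a) cat \<Rightarrow> ('y, 'b) cat \<Rightarrow> ('x, 'a, 'y, 'b) ftor \<Rightarrow> bool" where
  "is_functor C D F \<longleftrightarrow> category C \<and> category D \<and>
     (\<forall>x \<in> ob C. fob F x \<in> ob D) \<and>
     (\<forall>x \<in> ob C. \<forall>y \<in> ob C. \<forall>f \<in> hom C x y. far F x y f \<in> hom D (fob F x) (fob F y)) \<and>
     (\<forall>x \<in> ob C. far F x x (idt C x) = idt D (fob F x)) \<and>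
     (\<forall>x \<in> ob C. \<forall>y \<in> ob C. \<forall>z \<in> ob C. \<forall>f \<in> hom C x y. \<forall>g \<in> hom C y z.
        far F x z (cmp C g f) = cmp D (far F y z g) (far F x y f))"

definition fid :: "('x, 'a, 'x, 'a) ftor" where
  "fid = \<lparr>fob = (\<lambda>x. x), far = (\<lambda>x y f. f)\<rparr>"

definition fcomp :: "('y, 'b, 'z, 'd) ftor \<Rightarrow> ('x, 'a, 'y, 'b) ftor \<Rightarrow> ('x, 'a, 'z, 'd) ftor" where
  "fcomp G F = \<lparr>fob = (\<lambda>x. fob G (fob F x)),
                far = (\<lambda>x y f. far G (fob F x) (fob F y) (far F x y f))\<rparr>"

definition feq :: "('x, 'a) cat \<Rightarrow> ('x, 'a, 'y, 'b) ftor \<Rightarrow> ('x, 'a, 'y, 'b) ftor \<Rightarrow> bool" where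
  "feq C F G \<longleftrightarrow> (\<forall>x \<in> ob C. fob F x = fob G x) \<and>
     (\<forall>x \<in> ob C. \<forall>y \<in> ob C. \<forall>f \<in> hom C x y. far F x y f = far G x y f)"

definition iso_functor :: "('x, 'a) cat \<Rightarrow> ('y, 'b) cat \<Rightarrow> ('x, 'a, 'y, 'b) ftor \<Rightarrow> bool" where
  "iso_functor C D F \<longleftrightarrow> is_functor C D F \<and>
     (\<exists>G. is_functor D C G \<and> feq C (fcomp G F) fid \<and> feq D (fcomp F G) fid)"

text \<open>\<open>F\<close> is an isomorphism from \<open>C\<close> to \<open>D\<close> commuting with functors \<open>U\<close>, \<open>V\<close> to \<open>B\<close>.\<close>

definition iso_over ::
  "('z, 'd) cat \<Rightarrow> ('x, 'a) cat \<Rightarrow> ('x, 'a, 'z, 'd) ftor \<Rightarrow>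
   ('y, 'b) cat \<Rightarrow> ('y, 'b, 'z, 'd) ftor \<Rightarrow> ('x, 'a, 'y, 'b) ftor \<Rightarrow> bool" where
  "iso_over B C U D V F \<longleftrightarrow> is_functor C B U \<and> is_functor D B V
     \<and> iso_functor C D F \<and> feq C (fcomp V F) U"

text \<open>The forgetful functors below send a triple to its carrier and are the identity on morphisms.\<close>

definition forget :: "('x \<times> 'y \<times> 'z, 'a, 'x, 'a) ftor" where
  "forget = \<lparr>fob = fst, far = (\<lambda>x y f. f)\<rparr>"

section \<open>Left-skew-monoidal categories\<close>

record ('x, 'a) skew_monoidal =
  tens :: "('x \<times> 'x, 'a \<times> 'a, 'x, 'a) ftor"
  unt :: 'x
  asc :: "'x \<Rightarrow> 'x \<Rightarrow> 'x \<Rightarrow> 'a"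
  lun :: "'x \<Rightarrow> 'a"
  run :: "'x \<Rightarrow> 'a"

abbreviation tob :: "('x, 'a) skew_monoidal \<Rightarrow> 'x \<Rightarrow> 'x \<Rightarrow> 'x" where
  "tob S x y \<equiv> fob (tens S) (x, y)"

abbreviation tar ::
  "('x, 'a) skew_monoidal \<Rightarrow> 'x \<Rightarrow> 'x \<Rightarrow> 'x \<Rightarrow> 'x \<Rightarrow> 'a \<Rightarrow> 'a \<Rightarrow> 'a" where
  "tar S x y x' y' f g \<equiv> far (tens S) (x, y) (x', y') (f, g)"

definition left_skew_monoidal :: "('x, 'a) cat \<Rightarrow> ('x, 'a) skew_monoidal \<Rightarrow> bool" where
  "left_skew_monoidal C S \<longleftrightarrow>
     is_functor (prod_cat C C) C (tens S) \<and> unt S \<in> ob C \<and>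
     (\<forall>x \<in> ob C. \<forall>y \<in> ob C. \<forall>z \<in> ob C.
        asc S x y z \<in> hom C (tob S (tob S x y) z) (tob S x (tob S y z))) \<and>
     (\<forall>x \<in> ob C. lun S x \<in> hom C (tob S (unt S) x) x) \<and>
     (\<forall>x \<in> ob C. run S x \<in> hom C x (tob S x (unt S))) \<and>
     (\<forall>x \<in> ob C. \<forall>y \<in> ob C. \<forall>z \<in> ob C. \<forall>x' \<in> ob C. \<forall>y' \<in> ob C. \<forall>z' \<in> ob C.
        \<forall>f \<in> hom C x x'. \<forall>g \<in> hom C y y'. \<forall>h \<in> hom C z z'.
          cmp C (asc S x' y' z')
            (tar S (tob S x y) z (tob S x' y') z' (tar S x y x' y' f g) h) =
          cmp C (tar S x (tob S y z) x' (tob S y' z') f (tar S y z y' z' g h))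
            (asc S x y z)) \<and>
     (\<forall>x \<in> ob C. \<forall>y \<in> ob C. \<forall>f \<in> hom C x y.
        cmp C (lun S y) (tar S (unt S) x (unt S) y (idt C (unt S)) f) = cmp C f (lun S x)) \<and>
     (\<forall>x \<in> ob C. \<forall>y \<in> ob C. \<forall>f \<in> hom C x y.
        cmp C (run S y) f = cmp C (tar S x (unt S) y (unt S) f (idt C (unt S))) (run S x)) \<and>
     (\<forall>w \<in> ob C. \<forall>x \<in> ob C. \<forall>y \<in> ob C. \<forall>z \<in> ob C.
        cmp C (asc S w x (tob S y z)) (asc S (tob S w x) y z) =
        cmp C (tar S w (tob S (tob S x y) z) w (tob S x (tob S y z)) (idt C w) (asc S x y z))
          (cmp C (asc S w (tob S x y) z)
            (tar S (tob S (tob S w x) y) z (tob S w (tob S x y)) z (asc S w x y) (idt C z)))) \<and>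
     (\<forall>x \<in> ob C. \<forall>y \<in> ob C.
        cmp C (lun S (tob S x y)) (asc S (unt S) x y) =
        tar S (tob S (unt S) x) y x y (lun S x) (idt C y)) \<and>
     (\<forall>x \<in> ob C. \<forall>y \<in> ob C.
        cmp C (asc S x y (unt S)) (run S (tob S x y)) =
        tar S x y x (tob S y (unt S)) (idt C x) (run S y)) \<and>
     (\<forall>x \<in> ob C. \<forall>y \<in> ob C.
        cmp C (tar S x (tob S (unt S) y) x y (idt C x) (lun S y))
          (cmp C (asc S x (unt S) y) (tar S x y (tob S x (unt S)) y (run S x) (idt C y))) =
        idt C (tob S x y)) \<and>
     cmp C (lun S (unt S)) (run S (unt S)) = idt C (unt S)"

definition associative_normal :: "('x, 'a) cat \<Rightarrow> ('x, 'a) skew_monoidal \<Rightarrow> bool" where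
  "associative_normal C S \<longleftrightarrow> (\<forall>x \<in> ob C. \<forall>y \<in> ob C. \<forall>z \<in> ob C.
     iso_in C (tob S (tob S x y) z) (tob S x (tob S y z)) (asc S x y z))"

definition left_normal :: "('x, 'a) cat \<Rightarrow> ('x, 'a) skew_monoidal \<Rightarrow> bool" where
  "left_normal C S \<longleftrightarrow> (\<forall>x \<in> ob C. iso_in C (tob S (unt S) x) x (lun S x))"

definition right_normal :: "('x, 'a) cat \<Rightarrow> ('x, 'a) skew_monoidal \<Rightarrow> bool" where
  "right_normal C S \<longleftrightarrow> (\<forall>x \<in> ob C. iso_in C x (tob S x (unt S)) (run S x))"

definition skew_monoids :: "('x, 'a) cat \<Rightarrow> ('x, 'a) skew_monoidal \<Rightarrow> ('x \<times> 'a \<times> 'a) set" where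
  "skew_monoids C S = {(M, m, u). M \<in> ob C \<and> m \<in> hom C (tob S M M) M \<and> u \<in> hom C (unt S) M \<and>
     cmp C m (tar S (unt S) M M M u (idt C M)) = lun S M \<and>
     cmp C m (cmp C (tar S M (unt S) M M (idt C M) u) (run S M)) = idt C M \<and>
     cmp C m (cmp C (tar S M (tob S M M) M M (idt C M) m) (asc S M M M)) =
     cmp C m (tar S (tob S M M) M M M m (idt C M))}"

definition Mon_skew :: "('x, 'a) cat \<Rightarrow> ('x, 'a) skew_monoidal \<Rightarrow> ('x \<times> 'a \<times> 'a, 'a) cat" where
  "Mon_skew C S =
     \<lparr>ob = skew_monoids C S,
      hom = (\<lambda>(M, m, u) (N, n, v). {\<tau> \<in> hom C M N.
               cmp C \<tau> m = cmp C n (tar S M M N N \<tau> \<tau>) \<and> cmp C \<tau> u = v}),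
      idt = (\<lambda>(M, m, u). idt C M),
      cmp = cmp C\<rparr>"

section \<open>The hom-categories, relative monads, and the skew-multicategory of a tight-cell\<close>

definition hom_cat :: "('o, 't, 'l, 'c, 'm) vequip_scheme \<Rightarrow> 'o \<Rightarrow> 'o \<Rightarrow> ('t, 'c) cat" where
  "hom_cat X A B =
     \<lparr>ob = tights X A B, hom = two_cells X, idt = (\<lambda>f. cid X (companion X f)), cmp = vcomp X\<rparr>"

definition rel_monads :: "('o, 't, 'l, 'c, 'm) vequip_scheme \<Rightarrow> 't \<Rightarrow> ('t \<times> 'c \<times> 'c) set" where
  "rel_monads X j = {(t, d, \<eta>). t \<in> tights X (tdom X j) (tcod X j)
     \<and> d \<in> glob X [hm X j t] (hm X t t) \<and> \<eta> \<in> two_cells X j t \<and>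
     vcomp X (restr_pre X j t t \<eta>) d = cid X (hm X j t) \<and>
     vcomp X d (vcomp X (restr_post X j j t \<eta>) (frown X j)) = frown X t \<and>
     ccomp X (smile X t t t) (tid X (tdom X j)) [d, d] =
     vcomp X d (ccomp X (smile X j t t) (tid X (tdom X j)) [cid X (hm X j t), d])}"

definition RMnd :: "('o, 't, 'l, 'c, 'm) vequip_scheme \<Rightarrow> 't \<Rightarrow> ('t \<times> 'c \<times> 'c, 'c) cat" where
  "RMnd X j =
     \<lparr>ob = rel_monads X j,
      hom = (\<lambda>(t, d, \<eta>) (t', d', \<eta>'). {\<tau> \<in> two_cells X t t'.
               vcomp X \<tau> \<eta> = \<eta>' \<and>
               vcomp X (restr_post X t t t' \<tau>) d =
               vcomp X (restr_pre X t t' t' \<tau>) (vcomp X d' (restr_post X j t t' \<tau>))}),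
      idt = (\<lambda>(t, d, \<eta>). cid X (companion X t)),
      cmp = vcomp X\<rparr>"

text \<open>An entry of the domain of a multimorphism is \<open>Some t\<close> for a tight-cell \<open>t\<close>, or \<open>None\<close> for the
  marker \<open>\<bullet>\<close>, which contributes the loose-cell \<open>E(1,j)\<close>.\<close>

fun interleave :: "'a \<Rightarrow> 'a list \<Rightarrow> 'a list" where
  "interleave s [] = []"
| "interleave s [x] = [x]"
| "interleave s (x # y # zs) = x # s # interleave s (y # zs)"

definition entry :: "('o, 't, 'l, 'c, 'm) vequip_scheme \<Rightarrow> 't \<Rightarrow> 't option \<Rightarrow> 'l" where
  "entry X j x = companion X (case x of Some t \<Rightarrow> t | None \<Rightarrow> j)"

definition mdom :: "('o, 't, 'l, 'c, 'm) vequip_scheme \<Rightarrow> 't \<Rightarrow> 't option list \<Rightarrow> 'l list" where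
  "mdom X j xs = interleave (conjoint X j) (map (entry X j) xs)"

definition multimor ::
  "('o, 't, 'l, 'c, 'm) vequip_scheme \<Rightarrow> 't \<Rightarrow> 't option list \<Rightarrow> 't \<Rightarrow> 'c set" where
  "multimor X j xs s = (if xs = [] then {} else glob X (mdom X j xs) (companion X s))"

text \<open>The composite \<open>g \<circ> (f\<^sub>1, \<dots>, f\<^sub>n)\<close> of multimorphisms. At an entry \<open>\<bullet>\<close> of \<open>g\<close>, the 2-cell \<open>f\<^sub>i\<close> is
  the identity of \<open>E(1,j)\<close>.\<close>

definition mcomp :: "('o, 't, 'l, 'c, 'm) vequip_scheme \<Rightarrow> 't \<Rightarrow> 'c \<Rightarrow> 'c list \<Rightarrow> 'c" where
  "mcomp X j g fs = ccomp X g (tid X (tcod X j)) (interleave (cid X (conjoint X j)) fs)"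

text \<open>The parts of \<open>mdom X j (ys @ [x] @ zs)\<close> before and after the entry \<open>x\<close>.\<close>

definition mpre :: "('o, 't, 'l, 'c, 'm) vequip_scheme \<Rightarrow> 't \<Rightarrow> 't option list \<Rightarrow> 'l list" where
  "mpre X j ys = concat (map (\<lambda>y. [entry X j y, conjoint X j]) ys)"

definition msuf :: "('o, 't, 'l, 'c, 'm) vequip_scheme \<Rightarrow> 't \<Rightarrow> 't option list \<Rightarrow> 'l list" where
  "msuf X j zs = concat (map (\<lambda>z. [conjoint X j, entry X j z]) zs)"

text \<open>The left-unitor takes a multimorphism \<open>ys, x, zs \<rightarrow> s\<close> to one \<open>ys, \<bullet>, x, zs \<rightarrow> s\<close>, by pasting
  \<open>E(1,j), E(j,1), E(1,x) \<Rightarrow> E(1,1), E(1,x) \<Rightarrow> E(1,x)\<close>.\<close>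

definition left_unitor ::
  "('o, 't, 'l, 'c, 'm) vequip_scheme \<Rightarrow> 't \<Rightarrow> 't option list \<Rightarrow> 't option \<Rightarrow> 't option list
    \<Rightarrow> 'c \<Rightarrow> 'c" where
  "left_unitor X j ys x zs \<phi> =
     (let i = tid X (tcod X j); t = (case x of Some t \<Rightarrow> t | None \<Rightarrow> j)
      in plug X \<phi> (mpre X j ys)
           (ccomp X (smile X i i t) i [smile X i j i, cid X (companion X t)])
           (msuf X j zs))"

text \<open>The right-unitor takes a multimorphism \<open>ys, x, \<bullet>, zs \<rightarrow> s\<close> to one \<open>ys, x, zs \<rightarrow> s\<close>: its domain
  contains \<open>E(j,1), E(1,j)\<close>, so it factors uniquely through the opcartesian 2-cell to the
  loose-composite \<open>E(j,j)\<close>, and \<open>\<frown>\<^sub>j\<close> is pasted onto this factorisation.\<close>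

definition right_unitor ::
  "('o, 't, 'l, 'c, 'm) vequip_scheme \<Rightarrow> 't \<Rightarrow> 't option list \<Rightarrow> 't option \<Rightarrow> 't option list
    \<Rightarrow> 'c \<Rightarrow> 'c" where
  "right_unitor X j ys x zs \<phi> =
     (let ps = mpre X j ys @ [entry X j x]; rs = msuf X j zs
      in plug X (THE \<phi>'. \<phi>' \<in> Cell X \<and> cdom X \<phi>' = ps @ [hm X j j] @ rs
                    \<and> plug X \<phi>' ps (smile X j (tid X (tcod X j)) j) rs = \<phi>)
           ps (frown X j) rs)"

definition unary_cat :: "('o, 't, 'l, 'c, 'm) vequip_scheme \<Rightarrow> 't \<Rightarrow> ('t, 'c) cat" where
  "unary_cat X j =
     \<lparr>ob = tights X (tdom X j) (tcod X j),
      hom = (\<lambda>t s. multimor X j [Some t] s),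
      idt = (\<lambda>t. cid X (companion X t)),
      cmp = (\<lambda>g f. mcomp X j g [f])\<rparr>"

definition multi_monoids :: "('o, 't, 'l, 'c, 'm) vequip_scheme \<Rightarrow> 't \<Rightarrow> ('t \<times> 'c \<times> 'c) set" where
  "multi_monoids X j = {(M, m, u). M \<in> tights X (tdom X j) (tcod X j)
     \<and> m \<in> multimor X j [Some M, Some M] M \<and> u \<in> multimor X j [None] M \<and>
     mcomp X j m [u, cid X (companion X M)] = left_unitor X j [] (Some M) [] (cid X (companion X M)) \<and>
     right_unitor X j [] (Some M) [] (mcomp X j m [cid X (companion X M), u]) = cid X (companion X M) \<and>
     mcomp X j m [m, cid X (companion X M)] = mcomp X j m [cid X (companion X M), m]}"

definition Mon_multi :: "('o, 't, 'l, 'c, 'm) vequip_scheme \<Rightarrow> 't \<Rightarrow> ('t \<times> 'c \<times> 'c, 'c) cat" where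
  "Mon_multi X j =
     \<lparr>ob = multi_monoids X j,
      hom = (\<lambda>(M, m, u) (N, n, v). {\<tau> \<in> multimor X j [Some M] N.
               mcomp X j \<tau> [m] = mcomp X j n [\<tau>, \<tau>] \<and> mcomp X j \<tau> [u] = v}),
      idt = (\<lambda>(M, m, u). cid X (companion X M)),
      cmp = (\<lambda>g f. mcomp X j g [f])\<rparr>"

text \<open>The multiplication \<open>E(1,t), E(j,1), E(1,t) \<Rightarrow> E(1,t), E(j,t) \<Rightarrow> E(1,t), E(t,t) \<Rightarrow> E(1,t)\<close>
  of the monoid associated to a relative monad. A 2-cell from \<open>j\<close> to \<open>t\<close> is already represented by a
  2-cell from \<open>E(1,j)\<close> to \<open>E(1,t)\<close>, so the unit is unchanged.\<close>

definition rmnd_mult :: "('o, 't, 'l, 'c, 'm) vequip_scheme \<Rightarrow> 't \<Rightarrow> 't \<Rightarrow> 'c \<Rightarrow> 'c" where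
  "rmnd_mult X j t d =
     (let i = tid X (tcod X j)
      in ccomp X (ccomp X (smile X i t t) i [cid X (companion X t), d])
           i [cid X (companion X t), smile X j i t])"

definition rmnd_to_mon ::
  "('o, 't, 'l, 'c, 'm) vequip_scheme \<Rightarrow> 't \<Rightarrow> ('t \<times> 'c \<times> 'c, 'c, 't \<times> 'c \<times> 'c, 'c) ftor" where
  "rmnd_to_mon X j =
     \<lparr>fob = (\<lambda>(t, d, \<eta>). (t, rmnd_mult X j t d, \<eta>)), far = (\<lambda>x y \<tau>. \<tau>)\<rparr>"

end

theory Submission
  imports Defs
begin

text \<open>
  Every 2-cell into a restriction \<open>E(f,g)\<close> is transposed along the cartesian 2-cell to a 2-cell into
  a loose-identity; juxtaposition \<open>\<odot>\<close> of such 2-cells is associative and unital. Write \<open>L t\<close> for the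
  left extension of \<open>t\<close> along \<open>j\<close>. Its universal property gives a universal 2-cell
  \<open>E(j,s) \<Rightarrow> E(t, (L t) s)\<close>, along which the 2-cells \<open>(L t) s \<Rightarrow> u\<close> correspond to the 2-cells
  \<open>E(j,s) \<Rightarrow> E(t,u)\<close>. The tensor product is \<open>x \<otimes> y = (L x) y\<close> with unit \<open>j\<close>, and each
  coherence axiom is checked after precomposition with a universal 2-cell, where the induced
  structure 2-cells become explicit.

  A multiplication \<open>(L t) t \<Rightarrow> t\<close>, an extension operator \<open>E(j,t) \<Rightarrow> E(t,t)\<close> and a binary
  multimorphism \<open>t, t \<rightarrow> t\<close> are transposes of one and the same 2-cell, and the three sets of monoid
  axioms all become the same three equations between transposes; this gives both isomorphisms.

  If \<open>j\<close> is dense, then \<open>1\<close> and \<open>L j\<close> have the same universal property. If \<open>j\<close> is fully faithful,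
  then 2-cells out of \<open>E(j,j)\<close> are the same as nullary ones. If \<open>L y\<close> is absolute, then 2-cells out of
  \<open>E(j, L y)\<close> are the same as 2-cells out of \<open>E(j,y), E(j,1)\<close>. In each case the inverse of the
  structure 2-cell is obtained from this identification.
\<close>

text \<open>Restrictions are chosen arbitrarily, so \<open>E(x,y)(f,g)\<close> and
  \<open>E(xf,yg)\<close> are only isomorphic, and equations between 2-cells into restrictions would
  be cluttered by such isomorphisms. Transposes into loose-identities compose strictly with
  tight-cells, which is why all computations are carried out on them. The product
  \<open>\<odot>\<close> is written in diagrammatic order, against the order of vertical
  composition.

  The obstacle is the weak form of the hypothesis. A left extension is given by a right lift, which
  only speaks of 2-cells whose domain starts with \<open>E(j,1)\<close> and whose right tight-cell
  is an identity, whereas the tensor product needs a universal 2-cell out of \<open>E(j,s)\<close>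
  for every \<open>s\<close> and with any right tight-cell \<open>u\<close>. The gap is closed by
  padding: \<open>E(j,s)\<close> is opened into \<open>E(j,1), E(1,s)\<close> and
  \<open>E(u,1)\<close> is appended; afterwards the companion and the conjoint are removed by
  filling them with their units.

  A morphism of relative monads or of either kind of monoid is literally a 2-cell between the
  carriers, so the isomorphisms only have to rename objects.\<close>

lemma ex1_eqI: "\<lbrakk>\<exists>!x. P x; P x; P y\<rbrakk> \<Longrightarrow> x = y"
  by blast

section \<open>Composition in virtual double categories\<close>

context vdc
begin

lemma tid_simps [simp]:
  assumes "a \<in> Obj X"
  shows "tid X a \<in> Tight X" "tdom X (tid X a) = a" "tcod X (tid X a) = a"
  using tid_tights[OF assms] by (auto simp: tights_def)

lemma tcomp_simps [simp]:
  assumes "f \<in> Tight X" "g \<in> Tight X" "tcod X f = tdom X g"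
  shows "tcomp X g f \<in> Tight X" "tdom X (tcomp X g f) = tdom X f" "tcod X (tcomp X g f) = tcod X g"
  using tcomp_tights[OF assms] by (auto simp: tights_def)

lemma tcomp_unit_simps [simp]:
  "\<lbrakk>f \<in> Tight X; tcod X f = b\<rbrakk> \<Longrightarrow> tcomp X (tid X b) f = f"
  "\<lbrakk>f \<in> Tight X; tdom X f = b\<rbrakk> \<Longrightarrow> tcomp X f (tid X b) = f"
  using tcomp_tid_left tcomp_tid_right by blast+

lemma tcomp_assoc_simp [simp]:
  "\<lbrakk>f \<in> Tight X; g \<in> Tight X; h \<in> Tight X; tcod X f = tdom X g; tcod X g = tdom X h\<rbrakk>
    \<Longrightarrow> tcomp X (tcomp X h g) f = tcomp X h (tcomp X g f)"
  by (simp add: tcomp_assoc)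

declare tdom_Obj [simp] tcod_Obj [simp] ldom_Obj [simp] lcod_Obj [simp]
  ccod_Loose [simp] cleft_Tight [simp] cright_Tight [simp]

lemma cid_simps [simp]:
  assumes "p \<in> Loose X"
  shows "cid X p \<in> Cell X" "cdom X (cid X p) = [p]" "ccod X (cid X p) = p"
    "cleft X (cid X p) = tid X (lcod X p)" "cright X (cid X p) = tid X (ldom X p)"
  using cid_Cell[OF assms] by auto

lemma cchain_append:
  "cchain X f \<phi>s g \<Longrightarrow> cchain X g \<psi>s h \<Longrightarrow> cchain X f (\<phi>s @ \<psi>s) h"
  by (induction \<phi>s arbitrary: f) auto

lemma cchain_Tight: "cchain X f \<phi>s g \<Longrightarrow> f \<in> Tight X \<and> g \<in> Tight X"
  by (induction \<phi>s arbitrary: f) auto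

lemma lchain_append:
  "lchain X a (ps @ qs) b \<longleftrightarrow> (\<exists>c. lchain X a ps c \<and> lchain X c qs b)"
proof (induction ps arbitrary: a)
  case Nil
  have "lchain X a qs b \<Longrightarrow> a \<in> Obj X" by (cases qs) auto
  then show ?case by auto
qed auto

lemma cchain_cids: "lchain X a ps b \<Longrightarrow> cchain X (tid X a) (map (cid X) ps) (tid X b)"
  by (induction ps arbitrary: a) auto

lemma map_ccod_cids: "lchain X a ps b \<Longrightarrow> map (ccod X) (map (cid X) ps) = ps"
  by (induction ps arbitrary: a) auto

lemma concat_cdom_cids: "lchain X a ps b \<Longrightarrow> concat (map (cdom X) (map (cid X) ps)) = ps"
  by (induction ps arbitrary: a) auto

lemma lchain_rightD: "lchain X a ps b \<Longrightarrow> lchain X a ps c \<Longrightarrow> b = c"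
  by (induction ps arbitrary: a) auto

lemma composable_simps:
  assumes "composable X \<psi> f \<phi>s g"
  shows "ccomp X \<psi> f \<phi>s \<in> Cell X"
    "cdom X (ccomp X \<psi> f \<phi>s) = concat (map (cdom X) \<phi>s)"
    "ccod X (ccomp X \<psi> f \<phi>s) = ccod X \<psi>"
    "cleft X (ccomp X \<psi> f \<phi>s) = tcomp X (cleft X \<psi>) f"
    "cright X (ccomp X \<psi> f \<phi>s) = tcomp X (cright X \<psi>) g"
  using ccomp_Cell[OF assms] by auto

lemma composable_cids:
  assumes "\<phi> \<in> Cell X"
  shows "composable X \<phi> (tid X (tdom X (cleft X \<phi>))) (map (cid X) (cdom X \<phi>))
    (tid X (tdom X (cright X \<phi>)))"
  using lchain_cdom[OF assms] assms cchain_cids map_ccod_cids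
  by (auto simp: composable_def)

lemma composable_plug:
  assumes "\<chi> \<in> Cell X" "cdom X \<chi> = ps @ [ccod X \<phi>] @ rs" "\<phi> \<in> glob X qs (ccod X \<phi>)"
  shows "composable X \<chi> (tid X (tdom X (cleft X \<chi>))) (map (cid X) ps @ [\<phi>] @ map (cid X) rs)
    (tid X (tdom X (cright X \<chi>)))"
proof -
  obtain c where c: "lchain X (tdom X (cleft X \<chi>)) ps c"
      "lchain X c ([ccod X \<phi>] @ rs) (tdom X (cright X \<chi>))"
    using lchain_cdom[OF assms(1)] assms(2) lchain_append by metis
  then have r: "lchain X (ldom X (ccod X \<phi>)) rs (tdom X (cright X \<chi>))" "lcod X (ccod X \<phi>) = c"
    by auto
  show ?thesis
    unfolding composable_def
    using c r assms cchain_cids[OF c(1)] cchain_cids[OF r(1)] map_ccod_cids[OF c(1)]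
      map_ccod_cids[OF r(1)]
    by (auto simp: glob_def intro!: cchain_append)
qed

text \<open>The associativity axiom is indexed over lists of lists. Its cases with zero, one and two
  inner 2-cells are extracted because nearly all composites below have one of these shapes.\<close>

lemma assoc0:
  assumes "composable X \<psi> f [] f" "h \<in> Tight X" "tcod X h = tdom X f"
  shows "ccomp X (ccomp X \<psi> f []) h [] = ccomp X \<psi> (tcomp X f h) []"
  using ccomp_assoc[OF assms(1), of "[]" "[h]"] assms by simp

lemma assoc1:
  assumes "composable X \<psi> f [\<phi>] g" "composable X \<phi> h \<chi>s k" "tcod X h = tdom X f"
  shows "ccomp X (ccomp X \<psi> f [\<phi>]) h \<chi>s = ccomp X \<psi> (tcomp X f h) [ccomp X \<phi> h \<chi>s]"
  using ccomp_assoc[OF assms(1), of "[\<chi>s]" "[h,k]"] assms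
  by (simp add: composable_def cchain_Tight[of h \<chi>s k])

lemma assoc2:
  assumes "composable X \<psi> f [\<phi>1,\<phi>2] g" "composable X \<phi>1 h \<chi>s k" "composable X \<phi>2 k \<xi>s l"
  shows "ccomp X (ccomp X \<psi> f [\<phi>1,\<phi>2]) h (\<chi>s @ \<xi>s) =
    ccomp X \<psi> (tcomp X f h) [ccomp X \<phi>1 h \<chi>s, ccomp X \<phi>2 k \<xi>s]"
proof -
  have "h \<in> Tight X" "tcod X h = tdom X f"
    using assms cchain_Tight by (auto simp: composable_def)
  moreover have "\<And>i. i < 2 \<Longrightarrow> composable X ([\<phi>1,\<phi>2] ! i) ([h,k,l] ! i) ([\<chi>s,\<xi>s] ! i) ([h,k,l] ! Suc i)"
    using assms by (auto simp: less_2_cases_iff)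
  ultimately show ?thesis
    using ccomp_assoc[OF assms(1), of "[\<chi>s,\<xi>s]" "[h,k,l]"]
    by (simp add: upt_rec numeral_2_eq_2)
qed

lemma lchain1:
  assumes "\<psi> \<in> Cell X" "cdom X \<psi> = [p]"
  shows "tdom X (cleft X \<psi>) = lcod X p" "tdom X (cright X \<psi>) = ldom X p" "p \<in> Loose X"
  using lchain_cdom[OF assms(1)] assms(2) by auto

lemma composable1:
  assumes "\<psi> \<in> Cell X" "\<phi> \<in> Cell X" "cdom X \<psi> = [ccod X \<phi>]"
  shows "composable X \<psi> (cleft X \<phi>) [\<phi>] (cright X \<phi>)"
  using assms lchain1[OF assms(1,3)] by (simp add: composable_def tcod_cleft)

lemma tdom_left1:
  assumes "\<psi> \<in> Cell X" "\<phi> \<in> Cell X" "cdom X \<psi> = [ccod X \<phi>]"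
  shows "tcod X (cleft X \<phi>) = tdom X (cleft X \<psi>)" "tcod X (cright X \<phi>) = tdom X (cright X \<psi>)"
  using assms lchain1[OF assms(1,3)] by (simp_all add: tcod_cleft tcod_cright)

lemma vcomp_simps [simp]:
  assumes "\<psi> \<in> Cell X" "\<phi> \<in> Cell X" "cdom X \<psi> = [ccod X \<phi>]"
  shows "vcomp X \<psi> \<phi> \<in> Cell X" "cdom X (vcomp X \<psi> \<phi>) = cdom X \<phi>"
    "ccod X (vcomp X \<psi> \<phi>) = ccod X \<psi>"
    "cleft X (vcomp X \<psi> \<phi>) = tcomp X (cleft X \<psi>) (cleft X \<phi>)"
    "cright X (vcomp X \<psi> \<phi>) = tcomp X (cright X \<psi>) (cright X \<phi>)"
  using ccomp_Cell[OF composable1[OF assms]] by (simp_all add: vcomp_def)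

lemma vcomp_ccomp:
  assumes "\<psi> \<in> Cell X" "cdom X \<psi> = [ccod X \<phi>]" "composable X \<phi> h \<chi>s k"
  shows "vcomp X \<psi> (ccomp X \<phi> h \<chi>s) = ccomp X (vcomp X \<psi> \<phi>) h \<chi>s"
  using assoc1[OF composable1[OF assms(1) _ assms(2)] assms(3)] assms ccomp_Cell[OF assms(3)]
  by (simp add: vcomp_def composable_def)

lemma vcomp_assoc:
  assumes "\<psi> \<in> Cell X" "cdom X \<psi> = [ccod X \<phi>]" "\<phi> \<in> Cell X" "\<chi> \<in> Cell X" "cdom X \<phi> = [ccod X \<chi>]"
  shows "vcomp X \<psi> (vcomp X \<phi> \<chi>) = vcomp X (vcomp X \<psi> \<phi>) \<chi>"
  using vcomp_ccomp[OF assms(1,2) composable1[OF assms(3,4,5)]] by (simp add: vcomp_def)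

lemma vcomp_cid [simp]:
  "\<phi> \<in> Cell X \<Longrightarrow> ccod X \<phi> = p \<Longrightarrow> vcomp X (cid X p) \<phi> = \<phi>"
  "\<phi> \<in> Cell X \<Longrightarrow> cdom X \<phi> = [p] \<Longrightarrow> vcomp X \<phi> (cid X p) = \<phi>"
  using ccomp_cid_left ccomp_cid_right[of \<phi>] lchain1[of \<phi> p] by (auto simp: vcomp_def)

lemma composable0:
  assumes "\<psi> \<in> Cell X" "cdom X \<psi> = []" "f \<in> Tight X" "tcod X f = tdom X (cleft X \<psi>)"
  shows "composable X \<psi> f [] f"
  using assms by (simp add: composable_def)

lemma lchain0:
  assumes "\<psi> \<in> Cell X" "cdom X \<psi> = []"
  shows "tdom X (cright X \<psi>) = tdom X (cleft X \<psi>)"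
  using lchain_cdom[OF assms(1)] assms(2) by auto

lemma ccomp0_simps [simp]:
  assumes "\<psi> \<in> Cell X" "cdom X \<psi> = []" "f \<in> Tight X" "tcod X f = tdom X (cleft X \<psi>)"
  shows "ccomp X \<psi> f [] \<in> Cell X" "cdom X (ccomp X \<psi> f []) = []"
    "ccod X (ccomp X \<psi> f []) = ccod X \<psi>"
    "cleft X (ccomp X \<psi> f []) = tcomp X (cleft X \<psi>) f"
    "cright X (ccomp X \<psi> f []) = tcomp X (cright X \<psi>) f"
  using ccomp_Cell[OF composable0[OF assms]] by simp_all

lemma ccomp0_tid [simp]:
  assumes "\<psi> \<in> Cell X" "cdom X \<psi> = []" "tdom X (cleft X \<psi>) = a"
  shows "ccomp X \<psi> (tid X a) [] = \<psi>"
  using ccomp_cid_right[OF assms(1)] assms by simp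

lemma ccomp0_tcomp [simp]:
  assumes "\<psi> \<in> Cell X" "cdom X \<psi> = []" "f \<in> Tight X" "tcod X f = tdom X (cleft X \<psi>)"
     "h \<in> Tight X" "tcod X h = tdom X f"
  shows "ccomp X (ccomp X \<psi> f []) h [] = ccomp X \<psi> (tcomp X f h) []"
  using assoc0[OF composable0[OF assms(1-4)]] assms by simp

lemma cchain_nth:
  "cchain X f \<phi>s g \<Longrightarrow> i < length \<phi>s \<Longrightarrow>
    \<phi>s ! i \<in> Cell X \<and> cleft X (\<phi>s ! i) = (f # map (cright X) \<phi>s) ! i"
proof (induction \<phi>s arbitrary: f i)
  case (Cons a \<phi>s)
  then show ?case by (cases i) auto
qed simp

lemma lchain_ccod: "cchain X f \<phi>s g \<Longrightarrow> lchain X (tcod X f) (map (ccod X) \<phi>s) (tcod X g)"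
  by (induction \<phi>s arbitrary: f) (auto simp: tcod_cleft tcod_cright[symmetric])

text \<open>\<open>composable\<close> demands a matching codomain only for the left tight-cell. On
  the right it follows, because the codomains of the inner 2-cells form a chain, and a chain with a
  given left end has only one right end.\<close>

lemma composable_right: "composable X \<psi> f \<phi>s g \<Longrightarrow> g \<in> Tight X \<and> tcod X g = tdom X (cright X \<psi>)"
  using lchain_ccod[of f \<phi>s g] lchain_cdom[of \<psi>] cchain_Tight[of f \<phi>s g] lchain_rightD
  by (auto simp: composable_def)

text \<open>Associativity when only the first inner 2-cell is not an identity, so that the other
  composites collapse to the entries of \<open>\<xi>s\<close>. The tail has arbitrary length, which
  the fixed shapes above cannot treat; \<open>companion_expand\<close> needs this.\<close>

lemma assoc_head:
  assumes "composable X \<psi> f (\<phi> # map (cid X) rs) g" "composable X \<phi> h \<chi>s k"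
    "cchain X k \<xi>s l" "map (ccod X) \<xi>s = rs"
  shows "ccomp X (ccomp X \<psi> f (\<phi> # map (cid X) rs)) h (\<chi>s @ \<xi>s) =
    ccomp X \<psi> (tcomp X f h) (ccomp X \<phi> h \<chi>s # \<xi>s)"
proof -
  have h: "h \<in> Tight X" "tcod X h = tdom X f"
    using assms(1,2) cchain_Tight by (auto simp: composable_def)
  have len: "length \<xi>s = length rs" using assms(4) by auto
  \<comment> \<open>The boundary tight-cells: \<open>h\<close> and \<open>k\<close> enclose the
    block \<open>\<chi>s\<close>, after which each entry of \<open>\<xi>s\<close> is a block of its
    own.\<close>
  let ?hs = "h # k # map (cright X) \<xi>s" and ?ps = "\<phi> # map (cid X) rs" and ?css = "\<chi>s # map (\<lambda>\<xi>. [\<xi>]) \<xi>s"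
  have c: "composable X (cid X (rs ! i)) ((k # map (cright X) \<xi>s) ! i) [\<xi>s ! i] (cright X (\<xi>s ! i))"
    and e: "ccomp X (cid X (rs ! i)) ((k # map (cright X) \<xi>s) ! i) [\<xi>s ! i] = \<xi>s ! i"
    if i: "i < length rs" for i
  proof -
    have "\<xi>s ! i \<in> Cell X" "cleft X (\<xi>s ! i) = (k # map (cright X) \<xi>s) ! i" "ccod X (\<xi>s ! i) = rs ! i"
      using cchain_nth[OF assms(3), of i] nth_map[of i \<xi>s "ccod X", unfolded assms(4)] i len by simp_all
    moreover from this have "rs ! i \<in> Loose X"
      using ccod_Loose[of "\<xi>s ! i"] by simp
    ultimately show "composable X (cid X (rs ! i)) ((k # map (cright X) \<xi>s) ! i) [\<xi>s ! i] (cright X (\<xi>s ! i))"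
      "ccomp X (cid X (rs ! i)) ((k # map (cright X) \<xi>s) ! i) [\<xi>s ! i] = \<xi>s ! i"
      using composable1[of "cid X (rs ! i)" "\<xi>s ! i"] ccomp_cid_left[of "\<xi>s ! i"] by auto
  qed
  have comp: "composable X (?ps ! i) (?hs ! i) (?css ! i) (?hs ! Suc i)" if "i < length ?ps" for i
  proof (cases i)
    case 0
    then show ?thesis using assms(2) by simp
  next
    case (Suc n)
    then show ?thesis using that c[of n] len by simp
  qed
  have "concat (map (\<lambda>\<xi>. [\<xi>]) \<xi>s) = \<xi>s" by (induction \<xi>s) auto
  moreover have "map (\<lambda>i. ccomp X (?ps ! i) (?hs ! i) (?css ! i)) [0..<length ?ps] = ccomp X \<phi> h \<chi>s # \<xi>s"
  proof (rule nth_equalityI)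
    fix i assume "i < length (map (\<lambda>i. ccomp X (?ps ! i) (?hs ! i) (?css ! i)) [0..<length ?ps])"
    then show "map (\<lambda>i. ccomp X (?ps ! i) (?hs ! i) (?css ! i)) [0..<length ?ps] ! i = (ccomp X \<phi> h \<chi>s # \<xi>s) ! i"
      using e len by (cases i) (auto simp del: upt_Suc)
  qed (use len in simp)
  ultimately show ?thesis
    using ccomp_assoc[OF assms(1), of ?css ?hs] h comp len by (simp del: upt_Suc)
qed

end

section \<open>2-cells into loose-identities\<close>

context virtual_equipment
begin

lemma lid_simps [simp]:
  assumes "a \<in> Obj X"
  shows "lid X a \<in> Loose X" "ldom X (lid X a) = a" "lcod X (lid X a) = a"
  using lid_Loose[OF assms] by auto

lemma lunit_simps [simp]:
  assumes "a \<in> Obj X"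
  shows "lunit X a \<in> Cell X" "cdom X (lunit X a) = []" "ccod X (lunit X a) = lid X a"
    "cleft X (lunit X a) = tid X a" "cright X (lunit X a) = tid X a"
  using lunit_opcartesian[OF assms] lid_simps[OF assms] by (auto simp: glob_def)

text \<open>The existence half of opcartesianness of the loose-identity. The hypothesis on
  \<open>ps\<close> fixes the place of insertion, since a nullary domain leaves no trace in the list
  \<open>ps @ rs\<close>.\<close>

lemma lunit_extend:
  assumes "a \<in> Obj X" "\<psi> \<in> Cell X" "cdom X \<psi> = ps @ rs" "lchain X (tdom X (cleft X \<psi>)) ps a"
  shows "\<exists>\<chi>. \<chi> \<in> Cell X \<and> cdom X \<chi> = ps @ [lid X a] @ rs \<and> plug X \<chi> ps (lunit X a) rs = \<psi>"
proof -
  have "\<psi> \<in> Cell X \<and> cdom X \<psi> = ps @ cdom X (lunit X a) @ rs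
      \<and> lchain X (tdom X (cleft X \<psi>)) ps (lcod X (ccod X (lunit X a)))"
    using assms by simp
  then have "\<exists>!\<chi>. \<chi> \<in> Cell X \<and> cdom X \<chi> = ps @ [ccod X (lunit X a)] @ rs
      \<and> plug X \<chi> ps (lunit X a) rs = \<psi>"
    using lunit_opcartesian[OF assms(1)] unfolding opcartesian_def by blast
  then show ?thesis
    using assms(1) by auto
qed

lemma lunit_unique:
  assumes "a \<in> Obj X" "\<chi> \<in> Cell X" "\<chi>' \<in> Cell X" "cdom X \<chi> = ps @ [lid X a] @ rs"
    "cdom X \<chi>' = ps @ [lid X a] @ rs" "plug X \<chi> ps (lunit X a) rs = plug X \<chi>' ps (lunit X a) rs"
  shows "\<chi> = \<chi>'"
proof -
  let ?\<psi> = "plug X \<chi> ps (lunit X a) rs"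
  have *: "lunit X a \<in> glob X [] (ccod X (lunit X a))"
    using lunit_opcartesian assms(1) by simp
  have c: "composable X \<chi> (tid X (tdom X (cleft X \<chi>)))
      (map (cid X) ps @ [lunit X a] @ map (cid X) rs) (tid X (tdom X (cright X \<chi>)))"
    using assms * by (intro composable_plug) auto
  obtain c' where c': "lchain X (tdom X (cleft X \<chi>)) ps c'" "lchain X c' ([lid X a] @ rs) (tdom X (cright X \<chi>))"
    using lchain_cdom[OF assms(2)] assms(4) lchain_append by metis
  \<comment> \<open>The entry \<open>lid X a\<close> in the domain forces \<open>ps\<close> to end
    at \<open>a\<close>, so the side condition on the position holds by itself.\<close>
  then have "c' = a" and r: "lchain X a rs (tdom X (cright X \<chi>))" using assms(1) by auto
  have 1: "?\<psi> \<in> Cell X" "cdom X ?\<psi> = ps @ cdom X (lunit X a) @ rs"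
    "lchain X (tdom X (cleft X ?\<psi>)) ps (lcod X (ccod X (lunit X a)))"
    using composable_simps[OF c] concat_cdom_cids[OF c'(1)] concat_cdom_cids[OF r] assms(1,2) c'(1)
      \<open>c' = a\<close>
    by (simp_all add: plug_def)
  show ?thesis
    using lunit_opcartesian[OF assms(1)] 1 assms unfolding opcartesian_def
    by (metis lunit_simps(3))
qed

text \<open>Every 2-cell occurring below is turned into one of this kind, for which juxtaposition is
  an associative operation with units.\<close>

definition idcell :: "'c \<Rightarrow> bool" where
  "idcell \<phi> \<longleftrightarrow> \<phi> \<in> Cell X \<and> ccod X \<phi> = lid X (tcod X (cleft X \<phi>))"

lemma idcell_simps:
  assumes "idcell \<phi>"
  shows "\<phi> \<in> Cell X" "tcod X (cright X \<phi>) = tcod X (cleft X \<phi>)"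
    "ccod X \<phi> = lid X (tcod X (cleft X \<phi>))" "cleft X \<phi> \<in> Tight X" "cright X \<phi> \<in> Tight X"
    "tcod X (cleft X \<phi>) \<in> Obj X"
  using assms by (auto simp: idcell_def tcod_cright)

lemma idcell_Cell [simp]: "idcell \<phi> \<Longrightarrow> \<phi> \<in> Cell X"
  by (simp add: idcell_def)

lemma vcomp_idcell [simp]:
  assumes "idcell \<psi>" "\<phi> \<in> Cell X" "cdom X \<psi> = [ccod X \<phi>]"
  shows "idcell (vcomp X \<psi> \<phi>)"
  using assms idcell_simps[OF assms(1)] tdom_left1[of \<psi> \<phi>] by (simp add: idcell_def del: idcell_Cell)

lemma ccomp_idcell:
  assumes "idcell \<psi>" "composable X \<psi> f \<phi>s g"
  shows "idcell (ccomp X \<psi> f \<phi>s)"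
proof -
  have "f \<in> Tight X" "tcod X f = tdom X (cleft X \<psi>)"
    using assms(2) cchain_Tight by (auto simp: composable_def)
  then show ?thesis
    using assms composable_simps[OF assms(2)] by (simp add: idcell_def del: idcell_Cell)
qed

lemma ccomp0_idcell [simp]:
  assumes "idcell \<psi>" "cdom X \<psi> = []" "f \<in> Tight X" "tcod X f = tdom X (cleft X \<psi>)"
  shows "idcell (ccomp X \<psi> f [])"
  by (rule ccomp_idcell[OF assms(1) composable0[OF idcell_Cell[OF assms(1)] assms(2-4)]])

section \<open>The product of 2-cells into a loose-identity\<close>

lemma lmult_ex1:
  assumes "b \<in> Obj X"
  shows "\<exists>!\<mu>. \<mu> \<in> glob X [lid X b, lid X b] (lid X b)
     \<and> plug X \<mu> [lid X b] (lunit X b) [] = cid X (lid X b)"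
proof -
  \<comment> \<open>A second loose-identity is inserted to the right of the domain of the identity
    2-cell; the resulting factorisation is the multiplication.\<close>
  obtain \<mu> where m: "\<mu> \<in> Cell X" "cdom X \<mu> = [lid X b, lid X b]"
    "plug X \<mu> [lid X b] (lunit X b) [] = cid X (lid X b)"
    using lunit_extend[of b "cid X (lid X b)" "[lid X b]" "[]"] assms by auto
  have l: "tdom X (cleft X \<mu>) = b" "tdom X (cright X \<mu>) = b"
    using lchain_cdom[OF m(1)] m(2) assms by auto
  have c: "composable X \<mu> (tid X b) [cid X (lid X b), lunit X b] (tid X b)"
    using m assms l by (auto simp: composable_def)
  have "\<mu> \<in> glob X [lid X b, lid X b] (lid X b)"
    using composable_simps[OF c] m l assms by (auto simp: glob_def plug_def)
  then show ?thesis
    using m lunit_unique[OF assms, of _ _ "[lid X b]" "[]"]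
    by (intro ex_ex1I) (auto simp: glob_def)
qed

lemma lmult_simps [simp]:
  assumes "b \<in> Obj X"
  shows "lmult X b \<in> Cell X" "cdom X (lmult X b) = [lid X b, lid X b]"
    "ccod X (lmult X b) = lid X b" "cleft X (lmult X b) = tid X b" "cright X (lmult X b) = tid X b"
    "ccomp X (lmult X b) (tid X b) [cid X (lid X b), lunit X b] = cid X (lid X b)"
  using theI'[OF lmult_ex1[OF assms], folded lmult_def] assms by (auto simp: glob_def plug_def)

text \<open>Under transposition this is the composition
  \<open>E(f,g), E(g,h) \<Rightarrow> E(f,h)\<close>; the right tight-cell of \<open>\<phi>\<close>
  has to be the left tight-cell of \<open>\<psi>\<close>.\<close>

definition mul :: "'c \<Rightarrow> 'c \<Rightarrow> 'c" (infixr "\<odot>" 70) where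
  "\<phi> \<odot> \<psi> = ccomp X (lmult X (tcod X (cleft X \<phi>))) (cleft X \<phi>) [\<phi>, \<psi>]"

lemma composable_mul:
  assumes "idcell \<phi>" "idcell \<psi>" "cleft X \<psi> = cright X \<phi>"
  shows "composable X (lmult X (tcod X (cleft X \<phi>))) (cleft X \<phi>) [\<phi>, \<psi>] (cright X \<psi>)"
  using idcell_simps[OF assms(1)] idcell_simps[OF assms(2)] assms(3) by (simp add: composable_def)

lemma mul_simps [simp]:
  assumes "idcell \<phi>" "idcell \<psi>" "cleft X \<psi> = cright X \<phi>"
  shows "idcell (\<phi> \<odot> \<psi>)" "cdom X (\<phi> \<odot> \<psi>) = cdom X \<phi> @ cdom X \<psi>"
    "cleft X (\<phi> \<odot> \<psi>) = cleft X \<phi>" "cright X (\<phi> \<odot> \<psi>) = cright X \<psi>"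
  using composable_simps[OF composable_mul[OF assms]] idcell_simps[OF assms(1)]
    idcell_simps[OF assms(2)] assms
  by (simp_all add: mul_def idcell_def del: idcell_Cell)

text \<open>Substitution acts on the two factors separately. Explicit composites are evaluated with
  this rule throughout; the split \<open>\<chi>s @ \<xi>s\<close> and the middle tight-cell
  \<open>k\<close> usually have to be supplied by hand.\<close>

lemma ccomp_mul:
  assumes "idcell \<phi>" "idcell \<psi>" "cleft X \<psi> = cright X \<phi>"
    "composable X \<phi> h \<chi>s k" "composable X \<psi> k \<xi>s l"
  shows "ccomp X (\<phi> \<odot> \<psi>) h (\<chi>s @ \<xi>s) = ccomp X \<phi> h \<chi>s \<odot> ccomp X \<psi> k \<xi>s"
proof -
  have "h \<in> Tight X" "tcod X h = tdom X (cleft X \<phi>)"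
    using assms(4) cchain_Tight by (auto simp: composable_def)
  then show ?thesis
    using assoc2[OF composable_mul[OF assms(1-3)] assms(4,5)] composable_simps[OF assms(4)]
      idcell_simps[OF assms(1)]
    by (simp add: mul_def)
qed

text \<open>The transpose of \<open>frown X f\<close>, that is, the identity 2-cell of
  \<open>f\<close> in the form \<open>() \<Rightarrow> B(f,f)\<close>. It is the unit of
  \<open>\<odot>\<close>.\<close>

definition idu :: "'t \<Rightarrow> 'c" where
  "idu f = ccomp X (lunit X (tcod X f)) f []"

lemma idu_simps [simp]:
  assumes "f \<in> Tight X"
  shows "idcell (idu f)" "cdom X (idu f) = []" "cleft X (idu f) = f" "cright X (idu f) = f"
  using assms by (simp_all add: idu_def idcell_def del: idcell_Cell)

lemma ccomp0_idu [simp]: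
  assumes "f \<in> Tight X" "g \<in> Tight X" "tcod X g = tdom X f"
  shows "ccomp X (idu f) g [] = idu (tcomp X f g)"
  using assms by (simp add: idu_def)

lemma idu_tid: "b \<in> Obj X \<Longrightarrow> idu (tid X b) = lunit X b"
  by (simp add: idu_def)

lemma cid_lid_mul_lunit: "b \<in> Obj X \<Longrightarrow> cid X (lid X b) \<odot> lunit X b = cid X (lid X b)"
  by (simp add: mul_def)

lemma idcell_cid [simp]: "b \<in> Obj X \<Longrightarrow> idcell (cid X (lid X b))"
  by (simp add: idcell_def del: idcell_Cell)

lemma idcell_lunit [simp]: "b \<in> Obj X \<Longrightarrow> idcell (lunit X b)"
  by (simp add: idcell_def del: idcell_Cell)

lemma lunit_mul_lunit:
  assumes "b \<in> Obj X" shows "lunit X b \<odot> lunit X b = lunit X b"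
proof -
  have "ccomp X (cid X (lid X b) \<odot> lunit X b) (tid X b) ([lunit X b] @ []) =
      ccomp X (cid X (lid X b)) (tid X b) [lunit X b] \<odot> ccomp X (lunit X b) (tid X b) []"
    using assms by (intro ccomp_mul[where k = "tid X b"]) (auto simp: composable_def)
  moreover have "ccomp X (cid X (lid X b)) (tid X b) [lunit X b] = lunit X b"
    using assms ccomp_cid_left[of "lunit X b"] by simp
  ultimately show ?thesis
    using assms by (simp add: cid_lid_mul_lunit)
qed

lemma lid_cell_eqI:
  assumes "a \<in> Obj X" "\<chi> \<in> Cell X" "\<chi>' \<in> Cell X" "cdom X \<chi> = [lid X a]"
    "cdom X \<chi>' = [lid X a]" "vcomp X \<chi> (lunit X a) = vcomp X \<chi>' (lunit X a)"
  shows "\<chi> = \<chi>'"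
  using assms lunit_unique[of a \<chi> \<chi>' "[]" "[]"] lchain1[of \<chi>] lchain1[of \<chi>']
  by (simp add: plug_def vcomp_def)

text \<open>A nullary neighbour takes no part of the domain of \<open>\<chi>\<close>; it is merely
  precomposed with the tight-cell of \<open>\<chi>\<close> at the end where the two meet.\<close>

lemma vcomp_mul_left:
  assumes "idcell \<phi>" "idcell \<psi>" "cleft X \<psi> = cright X \<phi>" "cdom X \<psi> = []"
    "\<chi> \<in> Cell X" "cdom X \<phi> = [ccod X \<chi>]"
  shows "vcomp X (\<phi> \<odot> \<psi>) \<chi> = vcomp X \<phi> \<chi> \<odot> ccomp X \<psi> (cright X \<chi>) []"
  using ccomp_mul[OF assms(1-3) composable1[of \<phi> \<chi>] composable0[of \<psi> "cright X \<chi>"]] assms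
    tdom_left1[of \<phi> \<chi>]
  by (simp add: vcomp_def)

lemma vcomp_mul_right:
  assumes "idcell \<phi>" "idcell \<psi>" "cleft X \<psi> = cright X \<phi>" "cdom X \<phi> = []"
    "\<chi> \<in> Cell X" "cdom X \<psi> = [ccod X \<chi>]"
  shows "vcomp X (\<phi> \<odot> \<psi>) \<chi> = ccomp X \<phi> (cleft X \<chi>) [] \<odot> vcomp X \<psi> \<chi>"
  using ccomp_mul[OF assms(1-3) composable0[of \<phi> "cleft X \<chi>"] composable1[of \<psi> \<chi>]] assms
    tdom_left1[of \<psi> \<chi>] lchain0[of \<phi>]
  by (simp add: vcomp_def)

lemma ccomp0_mul [simp]:
  assumes "idcell \<phi>" "idcell \<psi>" "cleft X \<psi> = cright X \<phi>" "cdom X \<phi> = []" "cdom X \<psi> = []"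
    "h \<in> Tight X" "tcod X h = tdom X (cleft X \<phi>)"
  shows "ccomp X (\<phi> \<odot> \<psi>) h [] = ccomp X \<phi> h [] \<odot> ccomp X \<psi> h []"
  using ccomp_mul[OF assms(1-3) composable0[of \<phi> h] composable0[of \<psi> h]] assms lchain0[of \<phi>]
  by simp

text \<open>\<open>lmult\<close> is specified by its right unit law only. The left one is tested on
  \<open>lunit\<close>, where it turns into \<open>lunit_mul_lunit\<close>.\<close>

lemma lunit_mul_cid_lid:
  assumes "b \<in> Obj X" shows "lunit X b \<odot> cid X (lid X b) = cid X (lid X b)"
proof (rule lid_cell_eqI[OF assms])
  have "vcomp X (lunit X b \<odot> cid X (lid X b)) (lunit X b) = lunit X b \<odot> lunit X b"
    using assms by (subst vcomp_mul_right) auto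
  then show "vcomp X (lunit X b \<odot> cid X (lid X b)) (lunit X b) =
      vcomp X (cid X (lid X b)) (lunit X b)"
    using assms by (simp add: lunit_mul_lunit)
qed (use assms in auto)

text \<open>Associativity of \<open>lmult\<close>. Filling the middle one of the three
  loose-identities with \<open>lunit\<close> reduces both sides to \<open>lmult\<close> by the two
  unit laws, and this test suffices because \<open>lunit\<close> is opcartesian.\<close>

lemma lmult_mul:
  assumes "b \<in> Obj X"
  shows "lmult X b \<odot> cid X (lid X b) = cid X (lid X b) \<odot> lmult X b"
proof -
  let ?i = "cid X (lid X b)" and ?m = "lmult X b" and ?t = "tid X b" and ?l = "lunit X b"
  have il [simp]: "idcell ?m"
    using assms by (simp add: idcell_def del: idcell_Cell)
  have id: "ccomp X ?i ?t [?i] = ?i"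
    using assms ccomp_cid_left[of "?i"] by simp
  have mm: "ccomp X ?m ?t [?i, ?i] = ?m"
    using assms ccomp_cid_right[of "?m"] by simp
  have "ccomp X (?m \<odot> ?i) ?t ([?i, ?l] @ [?i]) = ?m"
    using assms by (subst ccomp_mul[where k = "?t" and l = ?t])
      (auto simp: composable_def id mul_def[of ?i] mm)
  moreover have "ccomp X ?m ?t [?l, ?i] = ?i"
    using lunit_mul_cid_lid[OF assms] assms by (simp add: mul_def)
  then have "ccomp X (?i \<odot> ?m) ?t ([?i] @ [?l, ?i]) = ?m"
    using assms by (subst ccomp_mul[where k = "?t" and l = ?t])
      (auto simp: composable_def id mul_def[of ?i] mm)
  ultimately have e: "plug X (?m \<odot> ?i) [lid X b] ?l [lid X b] = plug X (?i \<odot> ?m) [lid X b] ?l [lid X b]"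
    using assms by (simp add: plug_def)
  show ?thesis
    by (rule lunit_unique[of b _ _ "[lid X b]" "[lid X b]"])
      (use assms e in \<open>simp_all\<close>)
qed

text \<open>The three 2-cells are substituted into \<open>lmult_mul\<close>. As a simplification
  rule this brackets to the right, so a proof that needs a prefix as a single factor regroups
  explicitly with \<open>mul_assoc[symmetric]\<close>.\<close>

lemma mul_assoc [simp]:
  assumes "idcell \<phi>" "idcell \<psi>" "idcell \<chi>" "cleft X \<psi> = cright X \<phi>" "cleft X \<chi> = cright X \<psi>"
  shows "(\<phi> \<odot> \<psi>) \<odot> \<chi> = \<phi> \<odot> \<psi> \<odot> \<chi>"
proof -
  define b where "b = tcod X (cleft X \<phi>)"
  have b: "b \<in> Obj X" "tcod X (cleft X \<psi>) = b" "tcod X (cleft X \<chi>) = b" "tcod X (cright X \<psi>) = b" "tcod X (cright X \<phi>) = b" "tcod X (cright X \<chi>) = b"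
    using assms idcell_simps[OF assms(1)] idcell_simps[OF assms(2)] idcell_simps[OF assms(3)]
    by (auto simp: b_def)
  have k: "ccod X \<phi> = lid X b" "ccod X \<psi> = lid X b" "ccod X \<chi> = lid X b"
    using idcell_simps[OF assms(1)] idcell_simps[OF assms(2)] idcell_simps[OF assms(3)] b
    by (simp_all add: b_def)
  have i: "ccomp X (cid X (lid X b)) (cleft X \<phi>) [\<phi>] = \<phi>"
     "ccomp X (cid X (lid X b)) (cright X \<psi>) [\<chi>] = \<chi>"
    using ccomp_cid_left[of \<phi>] ccomp_cid_left[of \<chi>] assms k by simp_all
  have il [simp]: "idcell (lmult X b)"
    using b by (simp add: idcell_def del: idcell_Cell)
  have "ccomp X (lmult X b \<odot> cid X (lid X b)) (cleft X \<phi>) ([\<phi>, \<psi>] @ [\<chi>]) = (\<phi> \<odot> \<psi>) \<odot> \<chi>"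
    using assms b k i by (subst ccomp_mul[where k = "cright X \<psi>" and l = "cright X \<chi>"])
      (auto simp: composable_def mul_def[of \<phi> \<psi>] b_def[symmetric])
  moreover have "ccomp X (cid X (lid X b) \<odot> lmult X b) (cleft X \<phi>) ([\<phi>] @ [\<psi>, \<chi>]) = \<phi> \<odot> \<psi> \<odot> \<chi>"
    using assms b k i by (subst ccomp_mul[where k = "cleft X \<psi>" and l = "cright X \<chi>"])
      (auto simp: composable_def mul_def[of \<psi> \<chi>] b_def[symmetric])
  ultimately show ?thesis
    using lmult_mul[OF b(1)] by simp
qed

lemma mul_idu [simp]:
  assumes "idcell \<phi>" "cright X \<phi> = f"
  shows "\<phi> \<odot> idu f = \<phi>"
proof -
  note s = idcell_simps[OF assms(1)]
  have "vcomp X (cid X (ccod X \<phi>) \<odot> lunit X (tcod X f)) \<phi> = \<phi> \<odot> idu f"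
    using s assms by (subst vcomp_mul_left) (auto simp: idu_def)
  then show ?thesis
    using s assms by (simp add: cid_lid_mul_lunit)
qed

lemma idu_mul [simp]:
  assumes "idcell \<phi>" "cleft X \<phi> = f"
  shows "idu f \<odot> \<phi> = \<phi>"
proof -
  note s = idcell_simps[OF assms(1)]
  have "vcomp X (lunit X (tcod X f) \<odot> cid X (ccod X \<phi>)) \<phi> = idu f \<odot> \<phi>"
    using s assms by (subst vcomp_mul_right) (auto simp: idu_def)
  then show ?thesis
    using s assms by (simp add: lunit_mul_cid_lid)
qed

section \<open>Whiskering with tight-cells, and interchange\<close>

lemma laction_ex1:
  assumes "g \<in> Tight X"
  shows "\<exists>!\<chi>. \<chi> \<in> Cell X \<and> cdom X \<chi> = [lid X (tdom X g)]
     \<and> ccod X \<chi> = lid X (tcod X g) \<and> cleft X \<chi> = g \<and> cright X \<chi> = g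
     \<and> vcomp X \<chi> (lunit X (tdom X g)) = idu g"
proof -
  obtain \<chi> where c: "\<chi> \<in> Cell X" "cdom X \<chi> = [lid X (tdom X g)]"
    "plug X \<chi> [] (lunit X (tdom X g)) [] = idu g"
    using lunit_extend[of "tdom X g" "idu g" "[]" "[]"] assms by auto
  have v: "vcomp X \<chi> (lunit X (tdom X g)) = idu g"
    using c lchain1[OF c(1,2)] assms by (simp add: plug_def vcomp_def)
  have "cleft X \<chi> = cleft X (vcomp X \<chi> (lunit X (tdom X g)))"
    "cright X \<chi> = cright X (vcomp X \<chi> (lunit X (tdom X g)))"
    "ccod X \<chi> = ccod X (vcomp X \<chi> (lunit X (tdom X g)))"
    using c(1,2) lchain1[OF c(1,2)] assms by simp_all
  then have "ccod X \<chi> = lid X (tcod X g)" "cleft X \<chi> = g" "cright X \<chi> = g"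
    unfolding v using assms idcell_simps(3)[of "idu g"] by simp_all
  then show ?thesis
    using c v lid_cell_eqI[of "tdom X g"] assms by (intro ex_ex1I) auto
qed

lemma laction_simps [simp]:
  assumes "g \<in> Tight X"
  shows "idcell (laction X g)" "cdom X (laction X g) = [lid X (tdom X g)]"
    "cleft X (laction X g) = g" "cright X (laction X g) = g"
    "vcomp X (laction X g) (lunit X (tdom X g)) = idu g"
  using theI'[OF laction_ex1[OF assms, unfolded idu_def], folded laction_def] assms
  by (auto simp: idcell_def idu_def del: idcell_Cell)

text \<open>Postcomposition with \<open>g\<close>, the transposed form of the action
  \<open>B(x,y) \<Rightarrow> C(gx,gy)\<close>. Precomposition of a nullary 2-cell
  \<open>\<alpha>\<close> with \<open>h\<close> is simply
  \<open>ccomp X \<alpha> h []\<close>.\<close>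

definition lwhisk :: "'t \<Rightarrow> 'c \<Rightarrow> 'c" (infixr "\<star>" 75) where
  "g \<star> \<phi> = vcomp X (laction X g) \<phi>"

lemma lwhisk_simps [simp]:
  assumes "g \<in> Tight X" "idcell \<phi>" "tcod X (cleft X \<phi>) = tdom X g"
  shows "idcell (g \<star> \<phi>)" "cdom X (g \<star> \<phi>) = cdom X \<phi>" "cleft X (g \<star> \<phi>) = tcomp X g (cleft X \<phi>)"
    "cright X (g \<star> \<phi>) = tcomp X g (cright X \<phi>)"
  using assms idcell_simps[OF assms(2)] by (simp_all add: lwhisk_def)

lemma ccomp_lwhisk:
  assumes "g \<in> Tight X" "idcell \<phi>" "tcod X (cleft X \<phi>) = tdom X g" "composable X \<phi> h \<chi>s k"
  shows "ccomp X (g \<star> \<phi>) h \<chi>s = g \<star> ccomp X \<phi> h \<chi>s"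
  using assms idcell_simps[OF assms(2)] by (simp add: lwhisk_def vcomp_ccomp)

lemma vcomp_lwhisk [simp]:
  assumes "g \<in> Tight X" "idcell \<phi>" "tcod X (cleft X \<phi>) = tdom X g" "\<chi> \<in> Cell X" "cdom X \<phi> = [ccod X \<chi>]"
  shows "vcomp X (g \<star> \<phi>) \<chi> = g \<star> vcomp X \<phi> \<chi>"
  using assms ccomp_lwhisk[OF assms(1-3) composable1[of \<phi> \<chi>]] by (simp add: vcomp_def)

lemma lwhisk_idu [simp]:
  assumes "g \<in> Tight X" "f \<in> Tight X" "tcod X f = tdom X g"
  shows "g \<star> idu f = idu (tcomp X g f)"
proof -
  have "vcomp X (laction X g) (ccomp X (lunit X (tcod X f)) f []) =
      ccomp X (vcomp X (laction X g) (lunit X (tcod X f))) f []"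
    using assms by (subst vcomp_ccomp[where k = f]) (auto intro: composable0)
  then show ?thesis
    using assms by (simp add: lwhisk_def idu_def[of f])
qed

text \<open>It suffices that \<open>laction X g\<close> commutes with \<open>lmult\<close>, since
  \<open>\<phi>\<close> and \<open>\<psi>\<close> can then be substituted. That equation is tested
  by filling the second loose-identity with \<open>lunit\<close>.\<close>

lemma lwhisk_mul [simp]:
  assumes "g \<in> Tight X" "idcell \<phi>" "idcell \<psi>" "cleft X \<psi> = cright X \<phi>"
    "tcod X (cleft X \<phi>) = tdom X g"
  shows "g \<star> (\<phi> \<odot> \<psi>) = (g \<star> \<phi>) \<odot> (g \<star> \<psi>)"
proof -
  define b where "b = tdom X g"
  note s = idcell_simps[OF assms(2)] idcell_simps[OF assms(3)]
  let ?i = "cid X (lid X b)" and ?m = "lmult X b" and ?t = "tid X b" and ?l = "lunit X b"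
    and ?g = "laction X g"
  have b: "b \<in> Obj X" using assms by (simp add: b_def)
  have il [simp]: "idcell ?m"
    using b by (simp add: idcell_def del: idcell_Cell)
  have cm: "composable X ?m ?t [?i, ?l] ?t"
    using b by (simp add: composable_def)
  have gi: "ccomp X ?g ?t [?i] = ?g" "ccomp X ?g ?t [?l] = idu g"
    using assms b laction_simps[of g] ccomp_cid_right[of ?g] by (simp_all add: b_def vcomp_def)
  have 1: "ccomp X (vcomp X ?g ?m) ?t [?i, ?l] = ?g"
    using vcomp_ccomp[of ?g, OF _ _ cm] assms b gi by (simp add: b_def)
  have "ccomp X (?g \<odot> ?g) ?t ([?i] @ [?l]) = ?g \<odot> idu g"
    using assms b gi by (subst ccomp_mul[where k = "?t" and l = ?t]) (auto simp: composable_def b_def)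
  then have 2: "ccomp X (?g \<odot> ?g) ?t [?i, ?l] = ?g"
    using assms by simp
  have e: "vcomp X ?g ?m = ?g \<odot> ?g"
    by (rule lunit_unique[of b _ _ "[lid X b]" "[]"])
      (use assms b 1 2 in \<open>auto simp: b_def plug_def\<close>)
  have "ccomp X (vcomp X ?g ?m) (cleft X \<phi>) [\<phi>, \<psi>] = g \<star> (\<phi> \<odot> \<psi>)"
    using vcomp_ccomp[of ?g, OF _ _ composable_mul[OF assms(2-4)]] assms
    by (simp add: lwhisk_def mul_def b_def)
  moreover have "ccomp X (?g \<odot> ?g) (cleft X \<phi>) ([\<phi>] @ [\<psi>]) = (g \<star> \<phi>) \<odot> (g \<star> \<psi>)"
    using assms s by (subst ccomp_mul[where k = "cleft X \<psi>" and l = "cright X \<psi>"])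
      (auto simp: composable_def lwhisk_def vcomp_def)
  ultimately show ?thesis using e by simp
qed

lemma lwhisk_tid [simp]:
  assumes "idcell \<phi>" "tcod X (cleft X \<phi>) = b"
  shows "tid X b \<star> \<phi> = \<phi>"
proof -
  have b: "b \<in> Obj X" using idcell_simps[OF assms(1)] assms(2) by simp
  have "laction X (tid X b) = cid X (lid X b)"
    by (rule lid_cell_eqI[of b])
      (use b laction_simps(5)[of "tid X b"] in \<open>auto simp: idu_tid\<close>)
  then show ?thesis
    using assms idcell_simps[OF assms(1)] by (simp add: lwhisk_def)
qed

lemma lwhisk_tcomp [simp]:
  assumes "g \<in> Tight X" "h \<in> Tight X" "tcod X g = tdom X h" "idcell \<phi>"
    "tcod X (cleft X \<phi>) = tdom X g"
  shows "tcomp X h g \<star> \<phi> = h \<star> g \<star> \<phi>"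
proof -
  have "laction X (tcomp X h g) = h \<star> laction X g"
    by (rule lid_cell_eqI[of "tdom X g"])
      (use assms laction_simps(5)[of "tcomp X h g"] in \<open>auto\<close>)
  then show ?thesis
    using assms idcell_simps(3)[OF assms(4)]
    by (simp add: lwhisk_def[of "tcomp X h g"] lwhisk_def[of g])
qed

text \<open>Naturality of the 2-cell \<open>\<alpha>\<close> between tight-cells. For the identity
  of the loose-identity in place of \<open>\<phi>\<close>, both sides become \<open>\<alpha>\<close>
  after precomposition with \<open>lunit\<close>; substituting \<open>\<phi>\<close> gives the
  general case.\<close>

lemma interchange:
  assumes "idcell \<alpha>" "cdom X \<alpha> = []" "idcell \<phi>" "tcod X (cleft X \<phi>) = tdom X (cleft X \<alpha>)"
  shows "ccomp X \<alpha> (cleft X \<phi>) [] \<odot> (cright X \<alpha> \<star> \<phi>) = (cleft X \<alpha> \<star> \<phi>) \<odot> ccomp X \<alpha> (cright X \<phi>) []"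
proof -
  define b where "b = tdom X (cleft X \<alpha>)"
  note s = idcell_simps[OF assms(1)] idcell_simps[OF assms(3)] lchain0[of \<alpha>]
  let ?f = "cleft X \<alpha>" and ?g = "cright X \<alpha>"
  have b: "b \<in> Obj X" using s by (simp add: b_def)
  have "\<alpha> \<odot> laction X ?g = laction X ?f \<odot> \<alpha>"
  proof (rule lid_cell_eqI[OF b])
    have "vcomp X (\<alpha> \<odot> laction X ?g) (lunit X b) = \<alpha>"
      using s assms b laction_simps(5)[of ?g] by (subst vcomp_mul_right) (auto simp: b_def)
    moreover have "vcomp X (laction X ?f \<odot> \<alpha>) (lunit X b) = \<alpha>"
      using s assms b laction_simps(5)[of ?f] by (subst vcomp_mul_left) (auto simp: b_def)
    ultimately show "vcomp X (\<alpha> \<odot> laction X ?g) (lunit X b) = vcomp X (laction X ?f \<odot> \<alpha>) (lunit X b)"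
      by simp
  qed (use assms s in \<open>auto simp: b_def\<close>)
  moreover have "vcomp X (\<alpha> \<odot> laction X ?g) \<phi> = ccomp X \<alpha> (cleft X \<phi>) [] \<odot> (?g \<star> \<phi>)"
    using s assms by (subst vcomp_mul_right) (auto simp: lwhisk_def)
  moreover have "vcomp X (laction X ?f \<odot> \<alpha>) \<phi> = (?f \<star> \<phi>) \<odot> ccomp X \<alpha> (cright X \<phi>) []"
    using s assms by (subst vcomp_mul_left) (auto simp: lwhisk_def)
  ultimately show ?thesis by simp
qed

section \<open>Restrictions, companions and conjoints\<close>

lemma hm_simps [simp]:
  assumes "f \<in> Tight X" "g \<in> Tight X" "tcod X f = tcod X g"
  shows "hm X f g \<in> Loose X" "ldom X (hm X f g) = tdom X g" "lcod X (hm X f g) = tdom X f"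
proof -
  have "restr X (lid X (tcod X f)) f g \<in> Loose X \<and> ldom X (restr X (lid X (tcod X f)) f g) = tdom X g
      \<and> lcod X (restr X (lid X (tcod X f)) f g) = tdom X f"
    by (rule restr_Loose) (use assms in simp_all)
  then show "hm X f g \<in> Loose X" "ldom X (hm X f g) = tdom X g" "lcod X (hm X f g) = tdom X f"
    by (simp_all add: hm_def)
qed

lemma hcell_cartesian:
  assumes "f \<in> Tight X" "g \<in> Tight X" "tcod X f = tcod X g"
  shows "cartesian X (hcell X f g) \<and> cdom X (hcell X f g) = [hm X f g]
            \<and> ccod X (hcell X f g) = lid X (tcod X f)
            \<and> cleft X (hcell X f g) = f \<and> cright X (hcell X f g) = g"
  unfolding hcell_def hm_def by (rule rcell_cartesian) (use assms in simp_all)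

lemma hcell_simps [simp]:
  assumes "f \<in> Tight X" "g \<in> Tight X" "tcod X f = tcod X g"
  shows "idcell (hcell X f g)" "cdom X (hcell X f g) = [hm X f g]"
    "cleft X (hcell X f g) = f" "cright X (hcell X f g) = g"
  using hcell_cartesian[OF assms] unfolding idcell_def cartesian_def by auto

lemma hlift_ex1:
  assumes "f \<in> Tight X" "g \<in> Tight X" "a \<in> Tight X" "b \<in> Tight X" "tcod X f = tcod X g"
    "tcod X a = tdom X f" "tcod X b = tdom X g" "idcell \<psi>" "cleft X \<psi> = tcomp X f a"
    "cright X \<psi> = tcomp X g b"
  shows "\<exists>!\<chi>. cart_factors X (hcell X f g) (hm X f g) a b \<psi> \<chi>"
proof -
  have "cartesian X (hcell X f g)" "ccod X (hcell X f g) = lid X (tcod X f)"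
    using hcell_cartesian[OF assms(1,2,5)] by auto
  then show ?thesis
    using assms idcell_simps[OF assms(8)] unfolding cartesian_def by simp
qed

lemma hlift_simps [simp]:
  assumes "f \<in> Tight X" "g \<in> Tight X" "a \<in> Tight X" "b \<in> Tight X" "tcod X f = tcod X g"
    "tcod X a = tdom X f" "tcod X b = tdom X g" "idcell \<psi>" "cleft X \<psi> = tcomp X f a"
    "cright X \<psi> = tcomp X g b"
  shows "hlift X f g a b \<psi> \<in> Cell X" "cdom X (hlift X f g a b \<psi>) = cdom X \<psi>"
    "ccod X (hlift X f g a b \<psi>) = hm X f g" "cleft X (hlift X f g a b \<psi>) = a"
    "cright X (hlift X f g a b \<psi>) = b" "vcomp X (hcell X f g) (hlift X f g a b \<psi>) = \<psi>"
proof -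
  have *: "cart_factors X (hcell X f g) (hm X f g) a b \<psi> (hlift X f g a b \<psi>)"
    using theI'[OF hlift_ex1[OF assms]] by (simp add: hlift_def)
  then show "hlift X f g a b \<psi> \<in> Cell X" "ccod X (hlift X f g a b \<psi>) = hm X f g"
    "cleft X (hlift X f g a b \<psi>) = a" "cright X (hlift X f g a b \<psi>) = b"
    "vcomp X (hcell X f g) (hlift X f g a b \<psi>) = \<psi>"
    by (auto simp: cart_factors_def)
  then show "cdom X (hlift X f g a b \<psi>) = cdom X \<psi>"
    using vcomp_simps(2)[of "hcell X f g" "hlift X f g a b \<psi>"] assms by simp
qed

lemma hm_cell_eqI:
  assumes "f \<in> Tight X" "g \<in> Tight X" "tcod X f = tcod X g" "\<chi> \<in> Cell X" "\<chi>' \<in> Cell X"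
    "ccod X \<chi> = hm X f g" "ccod X \<chi>' = hm X f g" "cleft X \<chi> = cleft X \<chi>'" "cright X \<chi> = cright X \<chi>'"
    "vcomp X (hcell X f g) \<chi> = vcomp X (hcell X f g) \<chi>'"
  shows "\<chi> = \<chi>'"
proof -
  have t: "tcod X (cleft X \<chi>) = tdom X f" "tcod X (cright X \<chi>) = tdom X g"
    using assms by (simp_all add: tcod_cleft tcod_cright)
  show ?thesis
    by (rule ex1E[OF hlift_ex1[of f g "cleft X \<chi>" "cright X \<chi>" "vcomp X (hcell X f g) \<chi>"]])
      (use assms t in \<open>auto simp: cart_factors_def\<close>)
qed

lemma hlift_eqI:
  assumes "f \<in> Tight X" "g \<in> Tight X" "tcod X f = tcod X g" "\<chi> \<in> Cell X"
    "ccod X \<chi> = hm X f g" "cleft X \<chi> = a" "cright X \<chi> = b"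
    "vcomp X (hcell X f g) \<chi> = \<psi>"
  shows "hlift X f g a b \<psi> = \<chi>"
proof -
  have t: "tcod X (cleft X \<chi>) = tdom X f" "tcod X (cright X \<chi>) = tdom X g" "idcell \<psi>"
    using assms by (auto simp add: tcod_cleft tcod_cright)
  have c: "cleft X \<psi> = tcomp X f a" "cright X \<psi> = tcomp X g b"
    using assms by auto
  have ab: "a \<in> Tight X" "b \<in> Tight X"
    using assms by auto
  show ?thesis
    by (rule hm_cell_eqI[of f g]) (use assms t c ab in auto)
qed

lemma ccomp_hlift:
  assumes "f \<in> Tight X" "g \<in> Tight X" "a \<in> Tight X" "b \<in> Tight X" "tcod X f = tcod X g"
    "tcod X a = tdom X f" "tcod X b = tdom X g" "idcell \<psi>" "cleft X \<psi> = tcomp X f a"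
    "cright X \<psi> = tcomp X g b" "composable X (hlift X f g a b \<psi>) h \<chi>s k"
  shows "ccomp X (hlift X f g a b \<psi>) h \<chi>s = hlift X f g (tcomp X a h) (tcomp X b k) (ccomp X \<psi> h \<chi>s)"
  using assms vcomp_ccomp[of "hcell X f g", OF _ _ assms(11)] composable_simps[OF assms(11)]
  by (intro hlift_eqI[symmetric]) auto

lemma hglob_simps [simp]:
  assumes "idcell \<psi>" "cleft X \<psi> = f" "cright X \<psi> = g"
  shows "hglob X f g \<psi> \<in> Cell X" "cdom X (hglob X f g \<psi>) = cdom X \<psi>"
    "ccod X (hglob X f g \<psi>) = hm X f g" "cleft X (hglob X f g \<psi>) = tid X (tdom X f)"
    "cright X (hglob X f g \<psi>) = tid X (tdom X g)" "vcomp X (hcell X f g) (hglob X f g \<psi>) = \<psi>"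
  using idcell_simps[OF assms(1)] assms by (auto simp: hglob_def)

lemma hglob_glob:
  assumes "idcell \<psi>" "cleft X \<psi> = f" "cright X \<psi> = g" "cdom X \<psi> = ps"
  shows "hglob X f g \<psi> \<in> glob X ps (hm X f g)"
  using idcell_simps[OF assms(1)] assms by (auto simp: glob_def)

lemma glob_hmD:
  assumes "\<chi> \<in> glob X ps (hm X f g)" "f \<in> Tight X" "g \<in> Tight X" "tcod X f = tcod X g"
  shows "\<chi> \<in> Cell X" "cdom X \<chi> = ps" "ccod X \<chi> = hm X f g" "cleft X \<chi> = tid X (tdom X f)"
    "cright X \<chi> = tid X (tdom X g)" "idcell (vcomp X (hcell X f g) \<chi>)"
    "cdom X (vcomp X (hcell X f g) \<chi>) = ps"
    "cleft X (vcomp X (hcell X f g) \<chi>) = f" "cright X (vcomp X (hcell X f g) \<chi>) = g"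
    "hglob X f g (vcomp X (hcell X f g) \<chi>) = \<chi>"
proof -
  show *: "\<chi> \<in> Cell X" "cdom X \<chi> = ps" "ccod X \<chi> = hm X f g" "cleft X \<chi> = tid X (tdom X f)"
    "cright X \<chi> = tid X (tdom X g)"
    using assms by (auto simp: glob_def)
  then show "idcell (vcomp X (hcell X f g) \<chi>)"
    "cdom X (vcomp X (hcell X f g) \<chi>) = ps"
    "cleft X (vcomp X (hcell X f g) \<chi>) = f" "cright X (vcomp X (hcell X f g) \<chi>) = g"
    using assms by simp_all
  show "hglob X f g (vcomp X (hcell X f g) \<chi>) = \<chi>"
    unfolding hglob_def using assms * by (intro hlift_eqI) auto
qed

lemma glob_hm_eqI:
  assumes "\<chi> \<in> glob X ps (hm X f g)" "\<chi>' \<in> glob X ps (hm X f g)" "f \<in> Tight X" "g \<in> Tight X"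
    "tcod X f = tcod X g" "vcomp X (hcell X f g) \<chi> = vcomp X (hcell X f g) \<chi>'"
  shows "\<chi> = \<chi>'"
  by (rule trans[OF glob_hmD(10)[OF assms(1,3-5), symmetric]])
    (simp only: assms(6) glob_hmD(10)[OF assms(2-5)])

lemma hglob_hcell [simp]:
  assumes "f \<in> Tight X" "g \<in> Tight X" "tcod X f = tcod X g"
  shows "hglob X f g (hcell X f g) = cid X (hm X f g)"
  unfolding hglob_def using assms by (intro hlift_eqI) auto

text \<open>The result is an \<open>hlift\<close> and not an \<open>hglob\<close>, because the inner
  2-cells may have arbitrary outer tight-cells. When these are identities, unfolding
  \<open>hglob_def\<close> identifies the two.\<close>

lemma ccomp_hglob:
  assumes "idcell \<psi>" "cleft X \<psi> = f" "cright X \<psi> = g" "composable X (hglob X f g \<psi>) h \<chi>s k"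
  shows "ccomp X (hglob X f g \<psi>) h \<chi>s = hlift X f g h k (ccomp X \<psi> h \<chi>s)"
proof -
  have "h \<in> Tight X" "k \<in> Tight X"
    "tcod X h = tdom X f"
    using assms(4) cchain_Tight idcell_simps[OF assms(1)] assms(1-3)
    by (auto simp: composable_def)
  moreover have "tcod X k = tdom X g"
    using composable_right[OF assms(4)] assms(1-3) idcell_simps[OF assms(1)] by simp
  ultimately show ?thesis
  using ccomp_hlift[OF _ _ _ _ _ _ _ assms(1) _ _ assms(4)[unfolded hglob_def]] idcell_simps[OF assms(1)] assms(1-3)
    by (simp add: hglob_def)
qed

lemma vcomp_hglob:
  assumes "idcell \<psi>" "cleft X \<psi> = f" "cright X \<psi> = g" "\<chi> \<in> Cell X" "cdom X \<psi> = [ccod X \<chi>]"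
  shows "vcomp X (hglob X f g \<psi>) \<chi> = hlift X f g (cleft X \<chi>) (cright X \<chi>) (vcomp X \<psi> \<chi>)"
  using ccomp_hglob[OF assms(1-3) composable1[of "hglob X f g \<psi>" \<chi>]] assms
  by (simp add: vcomp_def)

section \<open>Units and counits of companions and conjoints\<close>

lemma smile_eq:
  assumes "x \<in> Tight X" "t \<in> Tight X" "y \<in> Tight X" "tcod X x = tcod X t" "tcod X y = tcod X t"
  shows "smile X x t y = hglob X x y (hcell X x t \<odot> hcell X t y)"
  using assms by (simp add: smile_def mul_def)

lemma frown_eq:
  assumes "f \<in> Tight X" shows "frown X f = hglob X f f (idu f)"
  by (simp add: frown_def idu_def)

text \<open>The unit 2-cells of the companion \<open>B(1,f)\<close> and of the conjoint \<open>B(f,1)\<close>.\<close>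

definition cunit :: "'t \<Rightarrow> 'c" where
  "cunit f = hlift X (tid X (tcod X f)) f f (tid X (tdom X f)) (idu f)"

definition junit :: "'t \<Rightarrow> 'c" where
  "junit f = hlift X f (tid X (tcod X f)) (tid X (tdom X f)) f (idu f)"

lemma cunit_simps [simp]:
  assumes "f \<in> Tight X"
  shows "cunit f \<in> Cell X" "cdom X (cunit f) = []" "ccod X (cunit f) = hm X (tid X (tcod X f)) f"
    "cleft X (cunit f) = f" "cright X (cunit f) = tid X (tdom X f)"
    "vcomp X (hcell X (tid X (tcod X f)) f) (cunit f) = idu f"
  using assms by (simp_all add: cunit_def)

lemma junit_simps [simp]:
  assumes "f \<in> Tight X"
  shows "junit f \<in> Cell X" "cdom X (junit f) = []" "ccod X (junit f) = hm X f (tid X (tcod X f))"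
    "cleft X (junit f) = tid X (tdom X f)" "cright X (junit f) = f"
    "vcomp X (hcell X f (tid X (tcod X f))) (junit f) = idu f"
  using assms by (simp_all add: junit_def)

text \<open>A 2-cell \<open>E(j,t) \<Rightarrow> E(j,1)\<close> in which \<open>t\<close> moves from
  the loose-cell to the right tight-cell. Together with \<open>cunit t\<close> it opens
  \<open>E(j,t)\<close> into \<open>E(j,1), E(1,t)\<close>.\<close>

definition rproj :: "'t \<Rightarrow> 't \<Rightarrow> 'c" where
  "rproj j t = hlift X j (tid X (tcod X t)) (tid X (tdom X j)) t (hcell X j t)"

lemma rproj_simps [simp]:
  assumes "j \<in> Tight X" "t \<in> Tight X" "tcod X j = tcod X t"
  shows "rproj j t \<in> Cell X" "cdom X (rproj j t) = [hm X j t]"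
    "ccod X (rproj j t) = hm X j (tid X (tcod X t))"
    "cleft X (rproj j t) = tid X (tdom X j)" "cright X (rproj j t) = t"
    "vcomp X (hcell X j (tid X (tcod X t))) (rproj j t) = hcell X j t"
  using assms by (simp_all add: rproj_def)

text \<open>Transposed, the composite is \<open>hcell X j t \<odot> idu t\<close>. This section of
  the composition 2-cell makes precomposition with
  \<open>E(j,1), E(1,t) \<Rightarrow> E(j,t)\<close> injective.\<close>

lemma smile_section:
  assumes "j \<in> Tight X" "t \<in> Tight X" "tcod X j = e" "tcod X t = e"
  shows "composable X (smile X j (tid X e) t) (tid X (tdom X j)) [rproj j t, cunit t] (tid X (tdom X t))"
    "ccomp X (smile X j (tid X e) t) (tid X (tdom X j)) [rproj j t, cunit t] = cid X (hm X j t)"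
proof -
  have e: "e \<in> Obj X" using assms by auto
  show c: "composable X (smile X j (tid X e) t) (tid X (tdom X j)) [rproj j t, cunit t] (tid X (tdom X t))"
    using assms e by (simp add: smile_eq composable_def)
  have "ccomp X (hcell X j (tid X e) \<odot> hcell X (tid X e) t) (tid X (tdom X j)) ([rproj j t] @ [cunit t])
     = hcell X j t"
    using assms e rproj_simps(6)[of j t] cunit_simps(6)[of t]
    by (subst ccomp_mul[where k = t and l = "tid X (tdom X t)"]) (auto simp: composable_def vcomp_def)
  then show "ccomp X (smile X j (tid X e) t) (tid X (tdom X j)) [rproj j t, cunit t] = cid X (hm X j t)"
    using assms e c by (simp add: smile_eq ccomp_hglob hglob_def[symmetric])
qed

lemma hlift_hcell [simp]:
  assumes "f \<in> Tight X" "g \<in> Tight X" "tcod X f = tcod X g" "tdom X f = a" "tdom X g = b"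
  shows "hlift X f g (tid X a) (tid X b) (hcell X f g) = cid X (hm X f g)"
  using assms by (intro hlift_eqI) auto

text \<open>The action \<open>B(1,1), B(1,f) \<Rightarrow> B(1,f)\<close> of the loose-identity on a
  companion. It creates a loose-identity inside the domain of a 2-cell, in contrast to multiplying
  the 2-cell by \<open>cid X (lid X e)\<close> from outside.\<close>

definition lidact :: "'t \<Rightarrow> 'c" where
  "lidact f = hglob X (tid X (tcod X f)) f (cid X (lid X (tcod X f)) \<odot> hcell X (tid X (tcod X f)) f)"

lemma lidact_simps [simp]:
  assumes "f \<in> Tight X"
  shows "lidact f \<in> Cell X" "cdom X (lidact f) = [lid X (tcod X f), hm X (tid X (tcod X f)) f]"
    "ccod X (lidact f) = hm X (tid X (tcod X f)) f" "cleft X (lidact f) = tid X (tcod X f)"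
    "cright X (lidact f) = tid X (tdom X f)"
  using assms by (simp_all add: lidact_def)

lemma lidact_lunit:
  assumes "f \<in> Tight X" "tcod X f = e"
  shows "ccomp X (lidact f) (tid X e) [lunit X e, cid X (hm X (tid X e) f)] = cid X (hm X (tid X e) f)"
proof -
  have e: "e \<in> Obj X" using assms by auto
  have c: "composable X (lidact f) (tid X e) [lunit X e, cid X (hm X (tid X e) f)] (tid X (tdom X f))"
    using assms e by (simp add: composable_def)
  have "ccomp X (cid X (lid X e) \<odot> hcell X (tid X e) f) (tid X e) ([lunit X e] @ [cid X (hm X (tid X e) f)])
     = hcell X (tid X e) f"
    using assms e vcomp_cid(2)[of "hcell X (tid X e) f"] vcomp_cid(1)[of "lunit X e"]
      idu_mul[of "hcell X (tid X e) f" "tid X e"]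
    by (subst ccomp_mul[where k = "tid X e" and l = "tid X (tdom X f)"])
      (auto simp: composable_def vcomp_def idu_tid)
  then show ?thesis
    using assms e ccomp_hglob[OF _ _ _ c[unfolded lidact_def]]
    by (simp add: lidact_def)
qed

text \<open>A triangle identity of the companion: the second filling makes \<open>hcell\<close> and
  \<open>cunit f\<close> compose to the unit \<open>idu f\<close>, so only the first filling, again
  \<open>hcell\<close>, remains.\<close>

lemma lidact_cunit:
  assumes "f \<in> Tight X" "tcod X f = e"
  shows "composable X (lidact f) (tid X e) [hcell X (tid X e) f, cunit f] (tid X (tdom X f))"
    "ccomp X (lidact f) (tid X e) [hcell X (tid X e) f, cunit f] = cid X (hm X (tid X e) f)"
proof -
  have e: "e \<in> Obj X" using assms by auto
  show c: "composable X (lidact f) (tid X e) [hcell X (tid X e) f, cunit f] (tid X (tdom X f))"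
    using assms e idcell_simps(3)[of "hcell X (tid X e) f"] by (simp add: composable_def)
  have "ccomp X (cid X (lid X e) \<odot> hcell X (tid X e) f) (tid X e) ([hcell X (tid X e) f] @ [cunit f])
     = hcell X (tid X e) f"
    using assms e cunit_simps(6)[of f] vcomp_cid(1)[of "hcell X (tid X e) f"]
      idcell_simps(3)[of "hcell X (tid X e) f"]
    by (subst ccomp_mul[where k = "f" and l = "tid X (tdom X f)"])
      (auto simp: composable_def vcomp_def)
  then show "ccomp X (lidact f) (tid X e) [hcell X (tid X e) f, cunit f] = cid X (hm X (tid X e) f)"
    using assms e ccomp_hglob[OF _ _ _ c[unfolded lidact_def]]
    by (simp add: lidact_def)
qed

lemma composable_cunit:
  assumes "f \<in> Tight X" "\<phi> \<in> Cell X" "cdom X \<phi> = hm X (tid X (tcod X f)) f # rs"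
  shows "composable X \<phi> f (cunit f # map (cid X) rs) (tid X (tdom X (cright X \<phi>)))"
    "lchain X (tdom X f) rs (tdom X (cright X \<phi>))" "tdom X (cleft X \<phi>) = tcod X f"
proof -
  show r: "lchain X (tdom X f) rs (tdom X (cright X \<phi>))" "tdom X (cleft X \<phi>) = tcod X f"
    using lchain_cdom[OF assms(2)] assms(1,3) by simp_all
  then show "composable X \<phi> f (cunit f # map (cid X) rs) (tid X (tdom X (cright X \<phi>)))"
    using assms cchain_cids[OF r(1)] map_ccod_cids[OF r(1)] by (simp add: composable_def)
qed

text \<open>A 2-cell with \<open>E(1,f)\<close> in front is extended by a loose-identity in front of \<open>E(1,f)\<close>. The two
  ways of doing so agree, and filling the loose-identity with the cartesian 2-cell of \<open>E(1,f)\<close>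
  gives the two sides of the equation.\<close>

lemma companion_expand:
  assumes f: "f \<in> Tight X" "tcod X f = e" and \<phi>: "idcell \<phi>" "cdom X \<phi> = hm X (tid X e) f # rs"
    "cleft X \<phi> = tid X e"
  shows "hcell X (tid X e) f \<odot> ccomp X \<phi> f (cunit f # map (cid X) rs) = \<phi>"
proof -
  let ?i = "tid X e" and ?p = "hm X (tid X e) f" and ?b = "tdom X (cright X \<phi>)"
  let ?\<phi>1 = "cid X (lid X e) \<odot> \<phi>"
  let ?\<phi>2 = "ccomp X \<phi> ?i (lidact f # map (cid X) rs)"
  have e: "e \<in> Obj X" using f by auto
  have cu: "composable X \<phi> f (cunit f # map (cid X) rs) (tid X ?b)"
    and lr: "lchain X (tdom X f) rs ?b"
    using composable_cunit[of f \<phi> rs] assms by auto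
  note cr = cchain_cids[OF lr] map_ccod_cids[OF lr] concat_cdom_cids[OF lr]
  have cl: "composable X \<phi> ?i (lidact f # map (cid X) rs) (tid X ?b)"
    using assms e cr by (simp add: composable_def)
  have ci: "composable X \<phi> ?i (cid X ?p # map (cid X) rs) (tid X ?b)"
    using assms e cr by (simp add: composable_def)
  have \<phi>i: "ccomp X \<phi> ?i (cid X ?p # map (cid X) rs) = \<phi>"
    using ccomp_cid_right[of \<phi>] \<phi> e by simp
  have "ccomp X ?\<phi>1 ?i ([lunit X e] @ (cid X ?p # map (cid X) rs)) = \<phi>"
    using assms e ci \<phi>i vcomp_cid(1)[of "lunit X e"] idu_mul[of \<phi> ?i]
    by (subst ccomp_mul[where k = ?i and l = "tid X ?b"])
      (auto simp: composable_def vcomp_def idu_tid)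
  moreover have "ccomp X ?\<phi>2 ?i ([lunit X e, cid X ?p] @ map (cid X) rs) = \<phi>"
    using assms e cr lidact_lunit[OF f] \<phi>i
    by (subst assoc_head[OF cl, where k = "tid X (tdom X f)" and l = "tid X ?b"])
      (auto simp: composable_def)
  ultimately have *: "ccomp X ?\<phi>1 ?i ([lunit X e] @ (cid X ?p # map (cid X) rs)) =
      ccomp X ?\<phi>2 ?i ([lunit X e, cid X ?p] @ map (cid X) rs)"
    by simp
  have 1: "?\<phi>1 = ?\<phi>2"
    by (rule lunit_unique[OF e, of _ _ "[]" "?p # rs"])
      (use * composable_simps[OF cl] assms cr e in \<open>auto simp: plug_def\<close>)
  have "ccomp X ?\<phi>1 ?i ([hcell X ?i f] @ (cunit f # map (cid X) rs)) =
      hcell X ?i f \<odot> ccomp X \<phi> f (cunit f # map (cid X) rs)"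
    using assms e cu vcomp_cid(1)[of "hcell X ?i f"] idcell_simps(3)[of "hcell X ?i f"]
    by (subst ccomp_mul[where k = f and l = "tid X ?b"])
      (auto simp: composable_def vcomp_def)
  moreover have "ccomp X ?\<phi>2 ?i ([hcell X ?i f, cunit f] @ map (cid X) rs) = \<phi>"
    using assms e cr lidact_cunit[OF f] \<phi>i
    by (subst assoc_head[OF cl, where k = "tid X (tdom X f)" and l = "tid X ?b"])
      (auto simp: composable_def)
  ultimately show ?thesis
    using 1 by simp
qed

lemma companion_cancel:
  assumes "f \<in> Tight X" "tcod X f = e" "g \<in> Tight X" "tdom X g = e"
    "idcell \<phi>" "idcell \<psi>" "cleft X \<phi> = tcomp X g f" "cleft X \<psi> = tcomp X g f" "cdom X \<phi> = cdom X \<psi>"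
    "(g \<star> hcell X (tid X e) f) \<odot> \<phi> = (g \<star> hcell X (tid X e) f) \<odot> \<psi>"
  shows "\<phi> = \<psi>"
proof -
  have e: "e \<in> Obj X" using assms by auto
  have "ccomp X ((g \<star> hcell X (tid X e) f) \<odot> \<phi>) f ([cunit f] @ map (cid X) (cdom X \<phi>)) = \<phi>"
    if "idcell \<phi>" "cleft X \<phi> = tcomp X g f" for \<phi>
  proof -
    have c: "composable X \<phi> (tid X (tdom X f)) (map (cid X) (cdom X \<phi>)) (tid X (tdom X (cright X \<phi>)))"
      "ccomp X \<phi> (tid X (tdom X f)) (map (cid X) (cdom X \<phi>)) = \<phi>"
      using that composable_cids[of \<phi>] ccomp_cid_right[of \<phi>] assms by auto
    have d: "ccomp X (g \<star> hcell X (tid X e) f) f [cunit f] = idu (tcomp X g f)"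
      using vcomp_lwhisk[of g "hcell X (tid X e) f" "cunit f"] assms e cunit_simps(6)[of f]
      by (simp add: vcomp_def)
    show ?thesis
      using assms that e c d
      by (subst ccomp_mul[OF _ _ _ _ c(1)]) (auto simp: composable_def)
  qed
  from this[of \<phi>] this[of \<psi>] show ?thesis
    using assms by simp
qed

lemma companion_cancel':
  assumes "f \<in> Tight X" "tcod X f = e"
    "idcell \<phi>" "idcell \<psi>" "cleft X \<phi> = f" "cleft X \<psi> = f" "cdom X \<phi> = cdom X \<psi>"
    "hcell X (tid X e) f \<odot> \<phi> = hcell X (tid X e) f \<odot> \<psi>"
  shows "\<phi> = \<psi>"
proof -
  have "e \<in> Obj X" using assms by auto
  then show ?thesis
    using companion_cancel[of f e "tid X e" \<phi> \<psi>] assms by simp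
qed

text \<open>Dual to \<open>companion_cancel\<close>: here \<open>junit f\<close> fills the conjoint
  on the right.\<close>

lemma conjoint_cancel:
  assumes "f \<in> Tight X" "tcod X f = e" "idcell \<phi>" "idcell \<psi>" "cright X \<phi> = f" "cright X \<psi> = f"
    "cdom X \<phi> = cdom X \<psi>" "cleft X \<phi> = cleft X \<psi>"
    "\<phi> \<odot> hcell X f (tid X e) = \<psi> \<odot> hcell X f (tid X e)"
  shows "\<phi> = \<psi>"
proof -
  have e: "e \<in> Obj X" using assms by auto
  have "ccomp X (\<phi> \<odot> hcell X f (tid X e)) (tid X (tdom X (cleft X \<phi>))) (map (cid X) (cdom X \<phi>) @ [junit f]) = \<phi>"
    if "idcell \<phi>" "cright X \<phi> = f" for \<phi>
  proof -
    have c: "composable X \<phi> (tid X (tdom X (cleft X \<phi>))) (map (cid X) (cdom X \<phi>)) (tid X (tdom X f))"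
      "ccomp X \<phi> (tid X (tdom X (cleft X \<phi>))) (map (cid X) (cdom X \<phi>)) = \<phi>"
      using that composable_cids[of \<phi>] ccomp_cid_right[of \<phi>] assms by auto
    have d: "ccomp X (hcell X f (tid X e)) (tid X (tdom X f)) [junit f] = idu f"
      using junit_simps[of f] assms e by (simp add: vcomp_def)
    have "composable X (hcell X f (tid X e)) (tid X (tdom X f)) [junit f] f"
      using assms e by (simp add: composable_def)
    then show ?thesis
      using assms that e c d
      by (subst ccomp_mul[OF _ _ _ c(1)]) auto
  qed
  from this[OF assms(3,5)] this[OF assms(4,6)] show ?thesis
    using assms(7-9) by metis
qed

text \<open>\<open>E(j,1), E(1,t) \<Rightarrow> E(j,t)\<close> exhibits a loose-composite: a 2-cell is extended by a loose-identity
  between \<open>E(j,1)\<close> and \<open>E(1,t)\<close> in two ways, which agree.\<close>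

lemma smile_factor:
  assumes j: "j \<in> Tight X" "tcod X j = e" and t: "t \<in> Tight X" "tcod X t = e"
    and \<phi>: "\<phi> \<in> Cell X" "cdom X \<phi> = [hm X j (tid X e), hm X (tid X e) t]"
  shows "composable X \<phi> (tid X (tdom X j)) [rproj j t, cunit t] (tid X (tdom X t))"
    "vcomp X (ccomp X \<phi> (tid X (tdom X j)) [rproj j t, cunit t]) (smile X j (tid X e) t) = \<phi>"
proof -
  let ?i = "tid X e" and ?a = "tid X (tdom X j)" and ?b = "tid X (tdom X t)"
  let ?p = "hm X j ?i" and ?q = "hm X ?i t" and ?u = "cid X (lid X e)" and ?l = "lunit X e"
  have e: "e \<in> Obj X" using j by auto
  have l: "tdom X (cleft X \<phi>) = tdom X j" "tdom X (cright X \<phi>) = tdom X t"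
    using lchain_cdom[OF \<phi>(1)] \<phi> j t e by simp_all
  show cs: "composable X \<phi> ?a [rproj j t, cunit t] ?b"
    using l \<phi> j t e by (simp add: composable_def)
  \<comment> \<open>The right action of the loose-identity on \<open>E(j,1)\<close>, the mirror
    image of the action \<open>lidact t\<close> on \<open>E(1,t)\<close>.\<close>
  define r where "r = hglob X j ?i (hcell X j ?i \<odot> ?u)"
  have r [simp]: "r \<in> Cell X" "cdom X r = [?p, lid X e]" "ccod X r = ?p" "cleft X r = ?a" "cright X r = ?i"
    using j e by (simp_all add: r_def)
  have cr: "composable X r ?a [cid X ?p, ?l] ?i"
    using j e by (simp add: composable_def)
  have "ccomp X (hcell X j ?i \<odot> ?u) ?a ([cid X ?p] @ [?l]) = hcell X j ?i"
    using j e vcomp_cid(2)[of "hcell X j ?i"] vcomp_cid(1)[of "lunit X e"]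
      mul_idu[of "hcell X j ?i" ?i]
    by (subst ccomp_mul[where k = ?i and l = ?i]) (auto simp: composable_def vcomp_def idu_tid)
  then have rl: "ccomp X r ?a [cid X ?p, ?l] = cid X ?p"
    using j e ccomp_hglob[OF _ _ _ cr[unfolded r_def]]
    by (simp add: r_def)
  have cr': "composable X r ?a [cid X ?p, hcell X ?i t] t"
    using j t e idcell_simps(3)[of "hcell X ?i t"] by (simp add: composable_def)
  have s: "smile X j ?i t = hglob X j t (hcell X j ?i \<odot> hcell X ?i t)"
    using j t e by (simp add: smile_eq)
  have "ccomp X (hcell X j ?i \<odot> ?u) ?a ([cid X ?p] @ [hcell X ?i t]) = hcell X j ?i \<odot> hcell X ?i t"
    using j t e vcomp_cid(2)[of "hcell X j ?i"] vcomp_cid(1)[of "hcell X ?i t"]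
      idcell_simps(3)[of "hcell X ?i t"]
    by (subst ccomp_mul[where k = ?i and l = t]) (auto simp: composable_def vcomp_def)
  moreover have "vcomp X (rproj j t) (smile X j ?i t) = hlift X j ?i ?a t (hcell X j ?i \<odot> hcell X ?i t)"
    using j t e rproj_simps(6)[of j t] vcomp_assoc[of "hcell X j ?i" "rproj j t" "smile X j ?i t"]
    by (intro hlift_eqI[symmetric]) (auto simp: s)
  ultimately have rk: "ccomp X r ?a [cid X ?p, hcell X ?i t] = vcomp X (rproj j t) (smile X j ?i t)"
    using j t e ccomp_hglob[OF _ _ _ cr'[unfolded r_def]]
    by (simp add: r_def)
  have c1: "composable X \<phi> ?a [r, cid X ?q] ?b" and c2: "composable X \<phi> ?a [cid X ?p, lidact t] ?b"
    using l \<phi> j t e by (auto simp: composable_def)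
  have cids: "ccomp X \<phi> ?a [cid X ?p, cid X ?q] = \<phi>"
    using ccomp_cid_right[of \<phi>] \<phi> l by simp
  have idd: "ccomp X (cid X ?p) ?a [cid X ?p] = cid X ?p" "ccomp X (cid X ?q) ?i [cid X ?q] = cid X ?q"
      "ccomp X (cid X ?q) t [cunit t] = cunit t"
    using ccomp_cid_left[of "cid X ?p"] ccomp_cid_left[of "cid X ?q"] ccomp_cid_left[of "cunit t"] j t e by simp_all
  have "ccomp X (ccomp X \<phi> ?a [r, cid X ?q]) ?a ([cid X ?p, ?l] @ [cid X ?q]) = \<phi>"
    using j t e rl cids idd
    by (subst assoc2[OF c1 cr, where l = ?b]) (auto simp: composable_def)
  moreover have "ccomp X (ccomp X \<phi> ?a [cid X ?p, lidact t]) ?a ([cid X ?p] @ [?l, cid X ?q]) = \<phi>"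
    using j t e lidact_lunit[OF t] cids idd
    by (subst assoc2[OF c2, where k = ?i and l = ?b]) (auto simp: composable_def)
  ultimately have *: "ccomp X (ccomp X \<phi> ?a [r, cid X ?q]) ?a ([cid X ?p, ?l] @ [cid X ?q]) =
      ccomp X (ccomp X \<phi> ?a [cid X ?p, lidact t]) ?a ([cid X ?p] @ [?l, cid X ?q])"
    by simp
  have eq: "ccomp X \<phi> ?a [r, cid X ?q] = ccomp X \<phi> ?a [cid X ?p, lidact t]"
    by (rule lunit_unique[OF e, of _ _ "[?p]" "[?q]"])
      (use * composable_simps[OF c1] composable_simps[OF c2] j t e l \<phi> in \<open>auto simp: plug_def\<close>)
  have cr2: "composable X (cid X ?q) t [cunit t] ?b"
    using j t e by (simp add: composable_def)
  have "vcomp X (ccomp X \<phi> ?a [rproj j t, cunit t]) (smile X j ?i t) =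
      ccomp X (ccomp X \<phi> ?a [rproj j t, cunit t]) ?a ([smile X j ?i t] @ [])"
    using j t e by (simp add: s vcomp_def)
  also have "\<dots> = ccomp X \<phi> ?a [vcomp X (rproj j t) (smile X j ?i t), cunit t]"
    using j t e by (subst assoc2[OF cs, where k = ?b and l = ?b]) (auto simp: composable_def s vcomp_def)
  also have "\<dots> = ccomp X (ccomp X \<phi> ?a [r, cid X ?q]) ?a ([cid X ?p, hcell X ?i t] @ [cunit t])"
    using j t e rk idd by (subst assoc2[OF c1 cr' cr2]) auto
  also have "\<dots> = ccomp X (ccomp X \<phi> ?a [cid X ?p, lidact t]) ?a ([cid X ?p] @ [hcell X ?i t, cunit t])"
    using eq by simp
  also have "\<dots> = \<phi>"
    using j t e lidact_cunit[OF t] cids idd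
    by (subst assoc2[OF c2 _ lidact_cunit(1)[OF t]]) (auto simp: composable_def)
  finally show "vcomp X (ccomp X \<phi> ?a [rproj j t, cunit t]) (smile X j ?i t) = \<phi>" .
qed

section \<open>2-cells between tight-cells as nullary 2-cells\<close>

lemma nullary_eq:
  "nullary X f g \<phi> = vcomp X (hcell X (tid X (tcod X g)) g) (vcomp X \<phi> (cunit f))"
  by (simp add: nullary_def cunit_def idu_def)

lemma two_cells_iff:
  "\<phi> \<in> two_cells X f g \<longleftrightarrow> \<phi> \<in> glob X [hm X (tid X (tcod X f)) f] (hm X (tid X (tcod X g)) g)"
  by (simp add: two_cells_def companion_def)

lemma two_cells_tights:
  assumes "\<phi> \<in> two_cells X f g" "f \<in> tights X a b" "g \<in> tights X a b"
  shows "\<phi> \<in> Cell X" "cdom X \<phi> = [hm X (tid X b) f]" "ccod X \<phi> = hm X (tid X b) g"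
    "cleft X \<phi> = tid X b" "cright X \<phi> = tid X a"
  using assms unfolding two_cells_iff by (auto simp: glob_def tights_def)

lemma nullary_simps:
  assumes "\<phi> \<in> two_cells X f g" "f \<in> tights X a b" "g \<in> tights X a b"
  shows "idcell (nullary X f g \<phi>)" "cdom X (nullary X f g \<phi>) = []"
    "cleft X (nullary X f g \<phi>) = f" "cright X (nullary X f g \<phi>) = g"
  using two_cells_tights[OF assms] assms(2,3) by (auto simp: nullary_eq tights_def)

text \<open>The inverse of \<open>nullary\<close>: the nullary 2-cell is pasted to the right of the
  companion of its left tight-cell.\<close>

definition unnullary :: "'c \<Rightarrow> 'c" where
  "unnullary \<alpha> = hglob X (tid X (tcod X (cleft X \<alpha>))) (cright X \<alpha>)
     (hcell X (tid X (tcod X (cleft X \<alpha>))) (cleft X \<alpha>) \<odot> \<alpha>)"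

lemma unnullary_simps:
  assumes "idcell \<alpha>" "cdom X \<alpha> = []" "cleft X \<alpha> = f" "cright X \<alpha> = g" "tcod X f = b"
  shows "unnullary \<alpha> \<in> two_cells X f g" "unnullary \<alpha> \<in> Cell X" "cdom X (unnullary \<alpha>) = [hm X (tid X b) f]"
    "ccod X (unnullary \<alpha>) = hm X (tid X b) g" "cleft X (unnullary \<alpha>) = tid X b"
    "cright X (unnullary \<alpha>) = tid X (tdom X f)"
    "vcomp X (hcell X (tid X b) g) (unnullary \<alpha>) = hcell X (tid X b) f \<odot> \<alpha>"
proof -
  note s = idcell_simps[OF assms(1)] lchain0[OF idcell_Cell[OF assms(1)] assms(2)]
  show *: "unnullary \<alpha> \<in> Cell X" "cdom X (unnullary \<alpha>) = [hm X (tid X b) f]"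
    "ccod X (unnullary \<alpha>) = hm X (tid X b) g" "cleft X (unnullary \<alpha>) = tid X b"
    "cright X (unnullary \<alpha>) = tid X (tdom X f)"
    "vcomp X (hcell X (tid X b) g) (unnullary \<alpha>) = hcell X (tid X b) f \<odot> \<alpha>"
    using s assms by (auto simp: unnullary_def)
  show "unnullary \<alpha> \<in> two_cells X f g"
    using s assms * by (auto simp: two_cells_iff glob_def)
qed

lemma nullary_unnullary [simp]:
  assumes "idcell \<alpha>" "cdom X \<alpha> = []" "cleft X \<alpha> = f" "cright X \<alpha> = g"
  shows "nullary X f g (unnullary \<alpha>) = \<alpha>"
proof -
  note s = idcell_simps[OF assms(1)] lchain0[OF idcell_Cell[OF assms(1)] assms(2)]
  define b where "b = tcod X f"
  have b: "tcod X f = b" "tcod X g = b" "b \<in> Obj X" using s assms by (auto simp: b_def)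
  note u = unnullary_simps[OF assms b(1)]
  have "vcomp X (hcell X (tid X b) g) (vcomp X (unnullary \<alpha>) (cunit f)) =
      vcomp X (hcell X (tid X b) f \<odot> \<alpha>) (cunit f)"
    using s assms b u by (subst vcomp_assoc) auto
  also have "\<dots> = \<alpha>"
    using s assms b cunit_simps(6)[of f] by (subst vcomp_mul_left) auto
  finally show ?thesis
    using b by (simp add: nullary_eq)
qed

text \<open>This direction rests on \<open>companion_expand\<close> with empty \<open>rs\<close>: a
  2-cell out of a companion is recovered from its value on \<open>cunit f\<close>.\<close>

lemma unnullary_nullary [simp]:
  assumes "\<phi> \<in> two_cells X f g" "f \<in> tights X a b" "g \<in> tights X a b"
  shows "unnullary (nullary X f g \<phi>) = \<phi>"
proof -
  note n = nullary_simps[OF assms] two_cells_tights[OF assms]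
  have t: "f \<in> Tight X" "g \<in> Tight X" "tcod X f = b" "tcod X g = b" "tdom X f = a" "tdom X g = a" "b \<in> Obj X"
    using assms by (auto simp: tights_def)
  note u = unnullary_simps[OF n(1-4) t(3)]
  have "hcell X (tid X b) f \<odot> nullary X f g \<phi> = vcomp X (hcell X (tid X b) g) \<phi>"
    using companion_expand[of f b "vcomp X (hcell X (tid X b) g) \<phi>" "[]"] n t
      vcomp_assoc[of "hcell X (tid X b) g" \<phi> "cunit f"]
    by (simp add: nullary_eq) (simp add: vcomp_def)
  then show ?thesis
    by - (rule hm_cell_eqI[of "tid X b" g], use n t u in auto)
qed

lemma vcomp_unnullary:
  assumes "idcell \<alpha>" "cdom X \<alpha> = []" "idcell \<beta>" "cdom X \<beta> = []" "cleft X \<beta> = cright X \<alpha>"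
  shows "vcomp X (unnullary \<beta>) (unnullary \<alpha>) = unnullary (\<alpha> \<odot> \<beta>)"
proof -
  note s = idcell_simps[OF assms(1)] lchain0[OF idcell_Cell[OF assms(1)] assms(2)]
    idcell_simps[OF assms(3)] lchain0[OF idcell_Cell[OF assms(3)] assms(4)]
  define b where "b = tcod X (cleft X \<alpha>)"
  have b: "tcod X (cleft X \<alpha>) = b" "tcod X (cright X \<alpha>) = b" "tcod X (cleft X \<beta>) = b"
    "tcod X (cright X \<beta>) = b" "b \<in> Obj X"
    using s assms by (auto simp: b_def)
  note u = unnullary_simps[OF assms(1,2) refl refl b(1)] unnullary_simps[OF assms(3,4) refl refl b(3)]
  note u' = unnullary_simps[of "\<alpha> \<odot> \<beta>", OF _ _ refl refl]
  have "vcomp X (hcell X (tid X b) (cright X \<beta>)) (vcomp X (unnullary \<beta>) (unnullary \<alpha>)) =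
      vcomp X (hcell X (tid X b) (cright X \<alpha>) \<odot> \<beta>) (unnullary \<alpha>)"
    using s assms b u by (subst vcomp_assoc) auto
  also have "\<dots> = hcell X (tid X b) (cleft X \<alpha>) \<odot> \<alpha> \<odot> \<beta>"
    using s assms b u by (subst vcomp_mul_left) auto
  finally show ?thesis
    by - (rule hm_cell_eqI[of "tid X b" "cright X \<beta>"], use s assms b u u' in auto)
qed

lemma unnullary_idu [simp]:
  assumes "f \<in> Tight X"
  shows "unnullary (idu f) = cid X (companion X f)"
  using assms by (simp add: unnullary_def companion_def)

text \<open>Under transposition the action of \<open>e\<close> becomes whiskering and restriction
  along \<open>\<pi>\<close> becomes a product. This brings the 2-cell of the definition into the
  form that \<open>ext\<close> takes at an identity.\<close>

lemma ext_cell_eq: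
  assumes "j \<in> Tight X" "f \<in> Tight X" "tdom X f = tdom X j" "e \<in> tights X (tcod X j) (tcod X f)"
    "\<pi> \<in> two_cells X f (tcomp X e j)"
  shows "ext_cell X j f e \<pi> = hglob X f e (nullary X f (tcomp X e j) \<pi> \<odot> (e \<star> hcell X j (tid X (tcod X j))))"
proof -
  have e: "e \<in> Tight X" "tdom X e = tcod X j" "tcod X e = tcod X f"
    using assms by (auto simp: tights_def)
  have t: "f \<in> tights X (tdom X j) (tcod X f)" "tcomp X e j \<in> tights X (tdom X j) (tcod X f)"
    using assms e by (auto simp: tights_def)
  note n = nullary_simps[OF assms(5) t]
  have mul: "ccomp X (lmult X (tcod X e)) f [nullary X f (tcomp X e j) \<pi>, hcell X (tcomp X e j) e] =
      nullary X f (tcomp X e j) \<pi> \<odot> hcell X (tcomp X e j) e"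
    using n e by (simp add: mul_def)
  show ?thesis
    unfolding ext_cell_def restr_pre_def action_def mul lwhisk_def[symmetric]
    using n e assms by (simp add: vcomp_hglob vcomp_mul_right) (simp add: hglob_def)
qed

text \<open>\<open>N f g\<close>: the 2-cells \<open>() \<Rightarrow> B(f,g)\<close>.\<close>

definition N :: "'t \<Rightarrow> 't \<Rightarrow> 'c set" where
  "N f g = {\<alpha>. idcell \<alpha> \<and> cdom X \<alpha> = [] \<and> cleft X \<alpha> = f \<and> cright X \<alpha> = g}"

lemma ND:
  assumes "\<alpha> \<in> N f g"
  shows "idcell \<alpha>" "cdom X \<alpha> = []" "cleft X \<alpha> = f" "cright X \<alpha> = g"
  using assms by (auto simp: N_def)

lemma NI: "\<lbrakk>idcell \<alpha>; cdom X \<alpha> = []; cleft X \<alpha> = f; cright X \<alpha> = g\<rbrakk> \<Longrightarrow> \<alpha> \<in> N f g"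
  by (simp add: N_def)

lemma mul_N: "\<alpha> \<in> N f g \<Longrightarrow> \<beta> \<in> N g h \<Longrightarrow> \<alpha> \<odot> \<beta> \<in> N f h"
  using ND[of \<alpha> f g] ND[of \<beta> g h] by (intro NI) auto

lemma tightsI: "\<lbrakk>f \<in> Tight X; tdom X f = a; tcod X f = b\<rbrakk> \<Longrightarrow> f \<in> tights X a b"
  by (simp add: tights_def)

lemma tightsD:
  assumes "f \<in> tights X a b"
  shows "f \<in> Tight X" "tdom X f = a" "tcod X f = b"
  using assms by (simp_all add: tights_def)

end

section \<open>Left extensions\<close>

locale left_ext = virtual_equipment X for X :: "('o, 't, 'l, 'c, 'm) vequip_scheme" +
  fixes j f e :: 't and \<pi> :: 'c
  assumes left_ext: "left_extension X j f e \<pi>"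
begin

lemma left_ext_types [simp]:
  "j \<in> Tight X" "f \<in> Tight X" "tdom X f = tdom X j" "e \<in> Tight X" "tdom X e = tcod X j" "tcod X e = tcod X f"
  using left_ext by (auto simp: left_extension_def tights_def)

definition \<eta> :: 'c where
  "\<eta> = nullary X f (tcomp X e j) \<pi>"

lemma \<eta>_simps [simp]:
  "idcell \<eta>" "cdom X \<eta> = []" "cleft X \<eta> = f" "cright X \<eta> = tcomp X e j"
proof -
  have "\<pi> \<in> two_cells X f (tcomp X e j)" using left_ext by (simp add: left_extension_def)
  from nullary_simps[OF this, of "tdom X j" "tcod X f"]
  show "idcell \<eta>" "cdom X \<eta> = []" "cleft X \<eta> = f" "cright X \<eta> = tcomp X e j"
    by (simp_all add: \<eta>_def tights_def)
qed

text \<open>The transpose of the universal 2-cell from \<open>E(j,s)\<close> to the restriction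
  along \<open>f\<close> and \<open>es\<close>. The colimit in the definition of a left extension
  supplies it only at \<open>s = 1\<close>.\<close>

definition ext :: "'t \<Rightarrow> 'c" where
  "ext s = \<eta> \<odot> (e \<star> hcell X j s)"

lemma ext_simps [simp]:
  assumes "s \<in> Tight X" "tcod X s = tcod X j"
  shows "idcell (ext s)" "cdom X (ext s) = [hm X j s]" "cleft X (ext s) = f"
    "cright X (ext s) = tcomp X e s"
  using assms by (simp_all add: ext_def)

lemma vcomp_ext:
  assumes "s \<in> Tight X" "tcod X s = tcod X j" "\<chi> \<in> Cell X" "ccod X \<chi> = hm X j s"
    "cleft X \<chi> = tid X (tdom X j)"
  shows "vcomp X (ext s) \<chi> = \<eta> \<odot> (e \<star> vcomp X (hcell X j s) \<chi>)"
  unfolding ext_def using assms by (subst vcomp_mul_right) auto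

definition i :: 't where "i = tid X (tcod X f)"

definition k :: 't where "k = tid X (tcod X j)"

text \<open>The two identity tight-cells are hidden behind \<open>i\<close> and \<open>k\<close>,
  and these facts let the simplifier treat them as atoms.\<close>

lemma ik_facts:
  "i \<in> Tight X" "tcod X i = tcod X f" "tdom X i = tcod X f" "tid X (tcod X f) = i"
  "k \<in> Tight X" "tcod X k = tcod X j" "tdom X k = tcod X j" "tid X (tcod X j) = k"
  "tcomp X e k = e" "tcomp X i i = i" "tcomp X k k = k"
  "\<And>h. h \<in> Tight X \<Longrightarrow> tcod X h = tcod X f \<Longrightarrow> tcomp X i h = h"
  "\<And>h. h \<in> Tight X \<Longrightarrow> tcod X h = tcod X j \<Longrightarrow> tcomp X k h = h"
  by (simp_all add: i_def k_def)

text \<open>The right lift property read through transposition: \<open>\<beta>\<close> stands for a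
  2-cell into the conjoint of \<open>f\<close>, \<open>\<gamma>\<close> for one into the conjoint of
  \<open>e\<close>, and pasting with the 2-cell of the lift becomes multiplication by
  \<open>ext\<close>.\<close>

lemma ext_tid_unique:
  assumes "idcell \<beta>" "cdom X \<beta> = hm X j (tid X (tcod X j)) # rs" "cleft X \<beta> = f" "cright X \<beta> = tid X (tcod X f)"
  shows "\<exists>!\<gamma>. idcell \<gamma> \<and> cdom X \<gamma> = rs \<and> cleft X \<gamma> = e \<and> cright X \<gamma> = tid X (tcod X f)
     \<and> ext (tid X (tcod X j)) \<odot> \<gamma> = \<beta>"
proof -
  note i = ik_facts
  define a where "a = tid X (tdom X j)"
  let ?\<theta> = "hglob X f e (ext k)"
  let ?W = "ccomp X (smile X f e i) a [?\<theta>, cid X (hm X e i)]"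
  have pi: "\<pi> \<in> two_cells X f (tcomp X e j)" "e \<in> tights X (tcod X j) (tcod X f)"
    using left_ext by (auto simp: left_extension_def)
  have "ext_cell X j f e \<pi> = ?\<theta>"
    using ext_cell_eq[OF _ _ _ pi(2,1)] i by (simp add: ext_def \<eta>_def)
  then have "right_lift X (hm X f i) (hm X j k) (hm X e i) ?W"
    using left_ext i by (simp add: left_extension_def colimit_def conjoint_def a_def)
  moreover have "hglob X f i \<beta> \<in> glob X (hm X j k # rs) (hm X f i)"
    using assms i by (intro hglob_glob) auto
  ultimately have ex: "\<exists>!\<psi>. \<psi> \<in> glob X rs (hm X e i) \<and> ccomp X ?W a [cid X (hm X j k), \<psi>] = hglob X f i \<beta>"
    using i unfolding right_lift_def by (simp add: a_def)
  have sm: "smile X f e i = hglob X f i (hcell X f e \<odot> hcell X e i)"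
    using i by (simp add: smile_eq)
  have a: "a \<in> Tight X" "tcod X a = tdom X j" "tdom X a = tdom X j" "tid X (tdom X j) = a"
    "\<And>h. h \<in> Tight X \<Longrightarrow> tdom X h = tdom X j \<Longrightarrow> tcomp X h a = h"
    by (simp_all add: a_def)
  have c0: "composable X (smile X f e i) a [?\<theta>, cid X (hm X e i)] i"
    unfolding sm using i a by (simp add: composable_def)
  have "ccomp X (hcell X f e \<odot> hcell X e i) a ([?\<theta>] @ [cid X (hm X e i)]) = ext k \<odot> hcell X e i"
    using i a vcomp_cid(2)[of "hcell X e i"] hglob_simps(6)[of "ext k" f e]
    by (subst ccomp_mul[where k = k and l = i]) (auto simp: composable_def vcomp_def)
  then have W: "vcomp X (hcell X f i) ?W = ext k \<odot> hcell X e i"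
    using i a vcomp_ccomp[OF _ _ c0, of "hcell X f i"] by (simp add: sm)
  have Wt: "?W \<in> Cell X" "cdom X ?W = [hm X j k, hm X e i]" "ccod X ?W = hm X f i" "cleft X ?W = a" "cright X ?W = i"
    using composable_simps[OF c0] i a by (simp_all add: sm)
  \<comment> \<open>Both sides of the first equation are globular 2-cells into the conjoint of
    \<open>f\<close>, so they can be compared through their transposes.\<close>
  have main: "ccomp X ?W a [cid X (hm X j k), \<psi>] = hglob X f i \<beta> \<longleftrightarrow>
      ext k \<odot> vcomp X (hcell X e i) \<psi> = \<beta>" if p: "\<psi> \<in> glob X rs (hm X e i)" for \<psi>
  proof -
    note g = glob_hmD[OF p, simplified, OF i(1), simplified i, simplified]
    have c1: "composable X ?W a [cid X (hm X j k), \<psi>] i"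
      using Wt i a g by (simp add: composable_def)
    have "ccomp X (ext k \<odot> hcell X e i) a ([cid X (hm X j k)] @ [\<psi>]) = ext k \<odot> vcomp X (hcell X e i) \<psi>"
      using i a g vcomp_cid(2)[of "ext k"]
      by (subst ccomp_mul[where k = k and l = i]) (auto simp: composable_def vcomp_def)
    then have v: "vcomp X (hcell X f i) (ccomp X ?W a [cid X (hm X j k), \<psi>]) = ext k \<odot> vcomp X (hcell X e i) \<psi>"
      using i a vcomp_ccomp[OF _ _ c1, of "hcell X f i"] Wt W by simp
    have t: "ccomp X ?W a [cid X (hm X j k), \<psi>] \<in> glob X (hm X j k # rs) (hm X f i)"
      using composable_simps[OF c1] Wt i a g by (simp add: glob_def)
    show ?thesis
    proof
      assume "ccomp X ?W a [cid X (hm X j k), \<psi>] = hglob X f i \<beta>"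
      then show "ext k \<odot> vcomp X (hcell X e i) \<psi> = \<beta>"
        using v assms i by simp
    next
      assume "ext k \<odot> vcomp X (hcell X e i) \<psi> = \<beta>"
      then have "vcomp X (hcell X f i) (ccomp X ?W a [cid X (hm X j k), \<psi>]) = \<beta>"
        using v by simp
      then show "ccomp X ?W a [cid X (hm X j k), \<psi>] = hglob X f i \<beta>"
        using glob_hmD(10)[OF t] i by simp
    qed
  qed
  from ex obtain \<psi> where p: "\<psi> \<in> glob X rs (hm X e i)" "ccomp X ?W a [cid X (hm X j k), \<psi>] = hglob X f i \<beta>"
    and un: "\<And>\<psi>'. \<psi>' \<in> glob X rs (hm X e i) \<Longrightarrow> ccomp X ?W a [cid X (hm X j k), \<psi>'] = hglob X f i \<beta> \<Longrightarrow> \<psi>' = \<psi>"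
    by blast
  show ?thesis
    unfolding i
  proof (rule ex1I[of _ "vcomp X (hcell X e i) \<psi>"])
    show "idcell (vcomp X (hcell X e i) \<psi>) \<and> cdom X (vcomp X (hcell X e i) \<psi>) = rs \<and>
      cleft X (vcomp X (hcell X e i) \<psi>) = e \<and> cright X (vcomp X (hcell X e i) \<psi>) = i \<and>
      ext k \<odot> vcomp X (hcell X e i) \<psi> = \<beta>"
      using glob_hmD[OF p(1)] main[OF p(1)] p(2) i by simp
  next
    fix \<gamma> assume g: "idcell \<gamma> \<and> cdom X \<gamma> = rs \<and> cleft X \<gamma> = e \<and> cright X \<gamma> = i \<and> ext k \<odot> \<gamma> = \<beta>"
    then have h: "hglob X e i \<gamma> \<in> glob X rs (hm X e i)"
      by (intro hglob_glob) auto
    have "hglob X e i \<gamma> = \<psi>"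
      using un[OF h] main[OF h] g by simp
    then show "\<gamma> = vcomp X (hcell X e i) \<psi>"
      using g by auto
  qed
qed

text \<open>The padding argument. Precomposing with
  \<open>E(j,1), E(1,s) \<Rightarrow> E(j,s)\<close> and appending \<open>hcell X u i\<close> leads
  to the situation of \<open>ext_tid_unique\<close>, whose uniqueness removes \<open>ext k\<close>.
  The remaining companion and conjoint are then cancelled.\<close>

lemma ext_cancel:
  assumes s: "s \<in> Tight X" "tcod X s = tcod X j" and "idcell \<alpha>" "idcell \<beta>" "cleft X \<alpha> = tcomp X e s"
    "cleft X \<beta> = tcomp X e s" "cright X \<alpha> = cright X \<beta>" "cdom X \<alpha> = cdom X \<beta>"
    "ext s \<odot> \<alpha> = ext s \<odot> \<beta>"
  shows "\<alpha> = \<beta>"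
proof -
  note i = ik_facts
  define u where "u = cright X \<alpha>"
  have u: "u \<in> Tight X" "tcod X u = tcod X f" "cright X \<alpha> = u" "cright X \<beta> = u"
    using assms idcell_simps[OF assms(3)] by (auto simp: u_def)
  define rs where "rs = hm X k s # cdom X \<alpha> @ [hm X u i]"
  \<comment> \<open>Substituting \<open>smile X j k s\<close> into the entry \<open>E(j,s)\<close>
    splits \<open>ext s\<close> into \<open>ext k\<close> followed by a whiskered companion.\<close>
  have *: "ext k \<odot> (e \<star> hcell X k s) \<odot> \<alpha> \<odot> hcell X u i =
      ccomp X (ext s \<odot> \<alpha> \<odot> hcell X u i) (tid X (tdom X j))
        ([smile X j k s] @ map (cid X) (cdom X \<alpha> @ [hm X u i]))"
    if "idcell \<alpha>" "cleft X \<alpha> = tcomp X e s" "cright X \<alpha> = u" for \<alpha>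
  proof -
    let ?\<alpha> = "\<alpha> \<odot> hcell X u i"
    have a: "idcell ?\<alpha>" "cdom X ?\<alpha> = cdom X \<alpha> @ [hm X u i]" "cleft X ?\<alpha> = tcomp X e s" "cright X ?\<alpha> = i"
      using that u i by simp_all
    have c: "composable X ?\<alpha> (tid X (tdom X s)) (map (cid X) (cdom X ?\<alpha>)) i"
      "ccomp X ?\<alpha> (tid X (tdom X s)) (map (cid X) (cdom X ?\<alpha>)) = ?\<alpha>"
      using composable_cids[OF idcell_Cell[OF a(1)]] ccomp_cid_right[OF idcell_Cell[OF a(1)]] a s i by simp_all
    have sm: "smile X j k s = hglob X j s (hcell X j k \<odot> hcell X k s)"
      using i s by (simp add: smile_eq)
    have es: "vcomp X (ext s) (smile X j k s) = ext k \<odot> (e \<star> hcell X k s)"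
      using i s by (simp add: sm vcomp_ext) (simp add: ext_def)
    have "ccomp X (ext s \<odot> ?\<alpha>) (tid X (tdom X j)) ([smile X j k s] @ map (cid X) (cdom X ?\<alpha>)) =
        vcomp X (ext s) (smile X j k s) \<odot> ?\<alpha>"
      using i s a c(2)
      by (subst ccomp_mul[OF _ _ _ _ c(1)]) (auto simp: composable_def vcomp_def sm)
    then show ?thesis
      using es a that i s u by simp
  qed
  let ?g = "\<lambda>\<alpha>. (e \<star> hcell X k s) \<odot> \<alpha> \<odot> hcell X u i"
  have eq1: "ext k \<odot> ?g \<alpha> = ext k \<odot> ?g \<beta>"
    using *[OF assms(3,5) u(3)] *[OF assms(4,6) u(4)] assms u i s
      mul_assoc[of "ext s" \<alpha> "hcell X u i"] mul_assoc[of "ext s" \<beta> "hcell X u i"] by simp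
  have ty: "idcell (?g \<delta>)" "cdom X (?g \<delta>) = rs" "cleft X (?g \<delta>) = e" "cright X (?g \<delta>) = i"
    if "idcell \<delta>" "cdom X \<delta> = cdom X \<alpha>" "cleft X \<delta> = tcomp X e s" "cright X \<delta> = u" for \<delta>
    using that u i s by (simp_all add: rs_def)
  have "\<exists>!\<gamma>. idcell \<gamma> \<and> cdom X \<gamma> = rs \<and> cleft X \<gamma> = e \<and> cright X \<gamma> = i \<and> ext k \<odot> \<gamma> = ext k \<odot> ?g \<alpha>"
    using ext_tid_unique[of "ext k \<odot> ?g \<alpha>" rs] i ty[of \<alpha>] assms u by simp
  then have "?g \<alpha> = ?g \<beta>"
    using ty[of \<alpha>] ty[of \<beta>] assms u eq1 by metis
  then have "\<alpha> \<odot> hcell X u i = \<beta> \<odot> hcell X u i"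
    by - (rule companion_cancel[of s "tcod X j" e], use i s assms u in auto)
  then show ?thesis
    by - (rule conjoint_cancel[of u "tcod X f"], use i s assms u in auto)
qed

text \<open>Existence by the same padding: the 2-cell \<open>\<gamma>\<close> obtained for the
  padded \<open>\<phi>\<close> has domain \<open>E(1,s)\<close> followed by the conjoint of
  \<open>u\<close>, and filling these with \<open>cunit s\<close> and \<open>junit u\<close> makes
  it nullary.\<close>

lemma ext_surj:
  assumes s: "s \<in> Tight X" "tcod X s = tcod X j" and \<phi>: "idcell \<phi>" "cdom X \<phi> = [hm X j s]" "cleft X \<phi> = f"
  shows "\<exists>\<alpha>. idcell \<alpha> \<and> cdom X \<alpha> = [] \<and> cleft X \<alpha> = tcomp X e s \<and> cright X \<alpha> = cright X \<phi> \<and> ext s \<odot> \<alpha> = \<phi>"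
proof -
  note i = ik_facts
  define u where "u = cright X \<phi>"
  have u: "u \<in> Tight X" "tcod X u = tcod X f" "cright X \<phi> = u" "tdom X u = tdom X s"
    using \<phi> s idcell_simps[OF \<phi>(1)] lchain1[of \<phi> "hm X j s"] by (auto simp: u_def)
  have sm: "smile X j k s = hglob X j s (hcell X j k \<odot> hcell X k s)"
    using i s by (simp add: smile_eq)
  let ?\<beta> = "vcomp X \<phi> (smile X j k s) \<odot> hcell X u i"
  have "\<exists>\<gamma>. idcell \<gamma> \<and> cdom X \<gamma> = [hm X k s, hm X u i] \<and> cleft X \<gamma> = e \<and> cright X \<gamma> = i \<and> ext k \<odot> \<gamma> = ?\<beta>"
    using ext_tid_unique[of ?\<beta> "[hm X k s, hm X u i]"] i u s \<phi> by (auto simp: sm)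
  then obtain \<gamma> where g: "idcell \<gamma>" "cdom X \<gamma> = [hm X k s, hm X u i]" "cleft X \<gamma> = e" "cright X \<gamma> = i"
    "ext k \<odot> \<gamma> = ?\<beta>" by blast
  let ?a = "tid X (tdom X j)" and ?\<alpha> = "ccomp X \<gamma> s [cunit s, junit u]"
  have cg: "composable X \<gamma> s [cunit s, junit u] u"
    using g i u s by (simp add: composable_def)
  note sec = smile_section[of j s "tcod X j", simplified i, OF _ s(1) _ s(2), simplified]
  have "ccomp X (vcomp X \<phi> (smile X j k s)) ?a [rproj j s, cunit s] = \<phi>"
    using vcomp_ccomp[OF _ _ sec(1), of \<phi>] sec(2) \<phi> i s by (simp add: sm)
  moreover have "composable X (vcomp X \<phi> (smile X j k s)) ?a [rproj j s, cunit s] (tid X (tdom X s))"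
    using i s \<phi> by (simp add: sm composable_def)
  moreover have "ccomp X (hcell X u i) (tid X (tdom X s)) [junit u] = idu u"
    using junit_simps[of u] u i by (simp add: vcomp_def)
  \<comment> \<open>Filling with \<open>rproj j s\<close>, \<open>cunit s\<close> and
    \<open>junit u\<close> removes the padding from \<open>?\<beta>\<close>; the same filling turns
    \<open>ext k \<odot> \<gamma>\<close> into \<open>ext s \<odot> ?\<alpha>\<close>.\<close>
  ultimately have "ccomp X ?\<beta> ?a ([rproj j s, cunit s] @ [junit u]) = \<phi>"
    using i u s \<phi>
    by (subst ccomp_mul[where k = "tid X (tdom X s)" and l = u]) (auto simp: composable_def sm)
  moreover have "ccomp X (ext k \<odot> \<gamma>) ?a ([rproj j s] @ [cunit s, junit u]) = vcomp X (ext k) (rproj j s) \<odot> ?\<alpha>"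
    using g i u s cg
    by (subst ccomp_mul[where k = s and l = u]) (auto simp: composable_def vcomp_def)
  moreover have "vcomp X (ext k) (rproj j s) = ext s"
    using i s rproj_simps(6)[of j s] by (simp add: vcomp_ext) (simp add: ext_def)
  ultimately have "ext s \<odot> ?\<alpha> = \<phi>"
    using g by simp
  moreover have "idcell ?\<alpha>" "cdom X ?\<alpha> = []" "cleft X ?\<alpha> = tcomp X e s" "cright X ?\<alpha> = u"
    using ccomp_idcell[OF g(1) cg] composable_simps[OF cg] g i u s by auto
  ultimately show ?thesis
    using u by auto
qed

end

section \<open>Relative monads and monoids in the skew-multicategory\<close>

definition subcat :: "('x, 'a) cat \<Rightarrow> ('x \<times> 'y \<times> 'z) set \<Rightarrow> ('x \<times> 'y \<times> 'z \<Rightarrow> 'x \<times> 'y \<times> 'z \<Rightarrow> 'a set) \<Rightarrow> bool" where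
  "subcat B K H \<longleftrightarrow> (\<forall>x \<in> K. fst x \<in> ob B \<and> idt B (fst x) \<in> H x x)
     \<and> (\<forall>x \<in> K. \<forall>y \<in> K. H x y \<subseteq> hom B (fst x) (fst y))
     \<and> (\<forall>x \<in> K. \<forall>y \<in> K. \<forall>z \<in> K. \<forall>f \<in> H x y. \<forall>g \<in> H y z. cmp B g f \<in> H x z)"

text \<open>\<open>C\<close> is the category over \<open>B\<close> with objects \<open>K\<close> and morphisms \<open>H\<close>, up to the renaming \<open>G\<close> of
  objects over the identity of \<open>B\<close>.\<close>

definition displays :: "('x, 'a) cat \<Rightarrow> ('x \<times> 'y \<times> 'z) set \<Rightarrow> ('x \<times> 'y \<times> 'z \<Rightarrow> 'x \<times> 'y \<times> 'z \<Rightarrow> 'a set)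
    \<Rightarrow> ('x \<times> 'p \<times> 'q, 'a) cat \<Rightarrow> ('x \<times> 'y \<times> 'z \<Rightarrow> 'x \<times> 'p \<times> 'q) \<Rightarrow> bool" where
  "displays B K H C G \<longleftrightarrow> bij_betw G K (ob C)
     \<and> (\<forall>x \<in> K. fst (G x) = fst x \<and> idt C (G x) = idt B (fst x))
     \<and> (\<forall>x \<in> K. \<forall>y \<in> K. hom C (G x) (G y) = H x y)
     \<and> (\<forall>x \<in> K. \<forall>y \<in> K. \<forall>z \<in> K. \<forall>f \<in> H x y. \<forall>g \<in> H y z. cmp C g f = cmp B g f)"

text \<open>Composition and identities in \<open>C\<close> are those of \<open>B\<close>, and the
  hom-sets of \<open>C\<close> lie inside those of \<open>B\<close>, so the laws are
  inherited.\<close>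

lemma displays_category:
  assumes B: "category B" and K: "subcat B K H" and C: "displays B K H C G"
  shows "category C"
proof -
  have im: "ob C = G ` K"
    using C by (simp add: displays_def bij_betw_def)
  have id: "idt C (G x) \<in> hom C (G x) (G x)" if "x \<in> K" for x
    using that K C by (simp add: displays_def subcat_def)
  have cm: "cmp C g f = cmp B g f" "cmp C g f \<in> hom C (G x) (G z)"
    if "x \<in> K" "y \<in> K" "z \<in> K" "f \<in> hom C (G x) (G y)" "g \<in> hom C (G y) (G z)" for x y z f g
  proof -
    have "f \<in> H x y" "g \<in> H y z" "hom C (G x) (G z) = H x z"
      using that C by (auto simp: displays_def)
    then show "cmp C g f = cmp B g f" "cmp C g f \<in> hom C (G x) (G z)"
      using that(1-3) C K unfolding displays_def subcat_def by metis+
  qed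
  have inB: "f \<in> hom B (fst x) (fst y)" "fst x \<in> ob B" "fst y \<in> ob B"
    if "x \<in> K" "y \<in> K" "f \<in> hom C (G x) (G y)" for x y f
    using that K C unfolding displays_def subcat_def by blast+
  have unit: "cmp C f (idt C (G x)) = f \<and> cmp C (idt C (G y)) f = f"
    if xy: "x \<in> K" "y \<in> K" "f \<in> hom C (G x) (G y)" for x y f
  proof -
    have "idt C (G x) = idt B (fst x)" "idt C (G y) = idt B (fst y)"
      using xy C by (auto simp: displays_def)
    then show ?thesis
      using cm(1)[OF xy(1,1,2) id[OF xy(1)] xy(3)] cm(1)[OF xy(1,2,2) xy(3) id[OF xy(2)]]
        inB[OF xy] B unfolding category_def by auto
  qed
  have assoc: "cmp C h (cmp C g f) = cmp C (cmp C h g) f"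
    if w: "w \<in> K" "x \<in> K" "y \<in> K" "z \<in> K" "f \<in> hom C (G w) (G x)" "g \<in> hom C (G x) (G y)"
      "h \<in> hom C (G y) (G z)" for w x y z f g h
  proof -
    note gf = cm[OF w(1-3,5,6)] and hg = cm[OF w(2-4,6,7)]
    have "cmp C h (cmp C g f) = cmp B h (cmp B g f)"
      using cm(1)[OF w(1,3,4) gf(2) w(7)] gf(1) by simp
    moreover have "cmp C (cmp C h g) f = cmp B (cmp B h g) f"
      using cm(1)[OF w(1,2,4,5) hg(2)] hg(1) by simp
    moreover have "cmp B h (cmp B g f) = cmp B (cmp B h g) f"
      using B inB[OF w(1,2,5)] inB[OF w(2,3,6)] inB[OF w(3,4,7)] unfolding category_def by blast
    ultimately show ?thesis by simp
  qed
  show ?thesis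
    unfolding category_def im ball_simps(9)
    using id cm(2) unit assoc by blast
qed

lemma displays_forget:
  assumes B: "category B" and K: "subcat B K H" and C: "displays B K H C G"
  shows "is_functor C B forget"
proof -
  have im: "ob C = G ` K"
    using C by (simp add: displays_def bij_betw_def)
  show ?thesis
    unfolding is_functor_def im ball_simps(9) forget_def
    using B displays_category[OF assms] K C unfolding displays_def subcat_def by simp blast
qed

lemma displays_functor:
  assumes B: "category B" and K: "subcat B K H" and C: "displays B K H C G" and D: "displays B K H D G'"
    and F: "\<forall>x \<in> K. fob F (G x) = G' x" "\<And>x y f. far F x y f = f"
  shows "is_functor C D F"
proof -
  have im: "ob C = G ` K" "ob D = G' ` K"
    using C D by (simp_all add: displays_def bij_betw_def)
  show ?thesis
    unfolding is_functor_def im ball_simps(9)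
    using displays_category[OF B K C] displays_category[OF B K D] C D F(1)
    unfolding displays_def F(2) by simp
qed

text \<open>The device by which the three categories are compared: once each of them displays the
  same \<open>K\<close> and \<open>H\<close>, an isomorphism over \<open>B\<close> is just a change
  of code on objects.\<close>

lemma displays_iso_over:
  assumes B: "category B" and K: "subcat B K H" and C: "displays B K H C G" and D: "displays B K H D G'"
    and F: "\<forall>x \<in> K. fob F (G x) = G' x" "\<And>x y f. far F x y f = f"
  shows "iso_over B C forget D forget F"
proof -
  have im: "ob C = G ` K" "ob D = G' ` K" and inj: "inj_on G K" "inj_on G' K"
    using C D by (simp_all add: displays_def bij_betw_def)
  \<comment> \<open>The inverse decodes an object through \<open>G'\<close> and encodes it again
    through \<open>G\<close>.\<close>
  let ?F' = "\<lparr>fob = \<lambda>x. G (inv_into K G' x), far = \<lambda>x y f. f\<rparr>"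
  have F': "\<forall>x \<in> K. fob ?F' (G' x) = G x" "\<And>x y f. far ?F' x y f = f"
    using inj by simp_all
  have "feq C (fcomp ?F' F) fid" "feq D (fcomp F ?F') fid"
    using F(1) F'(1) im by (auto simp: feq_def fcomp_def fid_def F(2) F'(2))
  then have "iso_functor C D F"
    unfolding iso_functor_def
    using displays_functor[OF B K C D F] displays_functor[OF B K D C F'] by blast
  moreover have "feq C (fcomp forget F) forget"
    using F(1) C D im by (auto simp: feq_def fcomp_def forget_def displays_def F(2))
  ultimately show ?thesis
    using displays_forget[OF B K C] displays_forget[OF B K D] by (simp add: iso_over_def)
qed

section \<open>Extension operators and binary multimorphisms\<close>

locale tight_root = virtual_equipment X for X :: "('o, 't, 'l, 'c, 'm) vequip_scheme" +
  fixes j :: 't and a e :: 'o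
  assumes j_tights [simp]: "j \<in> tights X a e"
begin

abbreviation T :: "'t set" where "T \<equiv> tights X a e"
abbreviation i :: 't where "i \<equiv> tid X e"

lemma T_simps [simp]:
  assumes "f \<in> T" shows "f \<in> Tight X" "tdom X f = a" "tcod X f = e"
  using tightsD[OF assms] by auto

lemma j_simps [simp]: "j \<in> Tight X" "tdom X j = a" "tcod X j = e"
  using T_simps[OF j_tights] by auto

lemma ae_Obj [simp]: "a \<in> Obj X" "e \<in> Obj X"
  using tdom_Obj[of j] tcod_Obj[of j] by simp_all

abbreviation smj :: "'t \<Rightarrow> 'c" where "smj t \<equiv> smile X j i t"

lemma conj_eq [simp]: "conjoint X j = hm X j i"
  by (simp add: conjoint_def)

lemma comp_eq [simp]: "t \<in> T \<Longrightarrow> companion X t = hm X i t"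
  by (simp add: companion_def)

lemma smj_eq: "t \<in> T \<Longrightarrow> smj t = hglob X j t (hcell X j i \<odot> hcell X i t)"
  by (simp add: smile_eq)

lemma smj_simps [simp]:
  assumes "t \<in> T"
  shows "smj t \<in> Cell X" "cdom X (smj t) = [hm X j i, hm X i t]" "ccod X (smj t) = hm X j t"
    "cleft X (smj t) = tid X a" "cright X (smj t) = tid X a"
    "vcomp X (hcell X j t) (smj t) = hcell X j i \<odot> hcell X i t"
  using assms by (simp_all add: smj_eq)

lemma smj_section:
  assumes "t \<in> T"
  shows "composable X (smj t) (tid X a) [rproj j t, cunit t] (tid X a)"
    "ccomp X (smj t) (tid X a) [rproj j t, cunit t] = cid X (hm X j t)"
  using smile_section[of j t e] assms by simp_all

text \<open>Precomposing once more, with the section \<open>rproj j t\<close>,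
  \<open>cunit t\<close> of \<open>smj t\<close>, gives \<open>\<delta>\<close> back.\<close>

lemma smj_cancel:
  assumes "t \<in> T" "\<delta> \<in> Cell X" "\<delta>' \<in> Cell X" "cdom X \<delta> = [hm X j t]" "cdom X \<delta>' = [hm X j t]"
    "vcomp X \<delta> (smj t) = vcomp X \<delta>' (smj t)"
  shows "\<delta> = \<delta>'"
proof -
  have "ccomp X (vcomp X \<delta> (smj t)) (tid X a) [rproj j t, cunit t] = \<delta>"
    if "\<delta> \<in> Cell X" "cdom X \<delta> = [hm X j t]" for \<delta>
    using vcomp_ccomp[OF _ _ smj_section(1), of \<delta> t] smj_section(2) that assms(1) by simp
  from this[OF assms(2,4)] this[OF assms(3,5)] show ?thesis
    using assms(6) by metis
qed

lemma composable_smj2: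
  assumes "t \<in> T" "\<delta> \<in> Cell X" "cdom X \<delta> = [hm X j t, hm X j t]"
  shows "composable X \<delta> (tid X a) [smj t, smj t] (tid X a)"
proof -
  have "tdom X (cleft X \<delta>) = a"
    using lchain_cdom[OF assms(2)] assms by simp
  then show ?thesis
    using assms by (simp add: composable_def)
qed

lemma smj_cancel2:
  assumes "t \<in> T" "\<delta> \<in> Cell X" "\<delta>' \<in> Cell X" "cdom X \<delta> = [hm X j t, hm X j t]"
    "cdom X \<delta>' = [hm X j t, hm X j t]"
    "ccomp X \<delta> (tid X a) [smj t, smj t] = ccomp X \<delta>' (tid X a) [smj t, smj t]"
  shows "\<delta> = \<delta>'"
proof -
  have "ccomp X (ccomp X \<delta> (tid X a) [smj t, smj t]) (tid X a)
      ([rproj j t, cunit t] @ [rproj j t, cunit t]) = \<delta>"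
    if "\<delta> \<in> Cell X" "cdom X \<delta> = [hm X j t, hm X j t]" for \<delta>
  proof -
    have "tdom X (cleft X \<delta>) = a"
      using lchain_cdom[OF that(1)] that(2) assms(1) by simp
    then show ?thesis
      using smj_section[OF assms(1)] ccomp_cid_right[of \<delta>] that
      by (subst assoc2[OF composable_smj2[OF assms(1) that] smj_section(1)[OF assms(1)] smj_section(1)[OF assms(1)]]) simp
  qed
  from this[OF assms(2,4)] this[OF assms(3,5)] show ?thesis
    using assms(6) by metis
qed

definition ext_ops :: "'t \<Rightarrow> 'c set" where
  "ext_ops t = {\<delta>. idcell \<delta> \<and> cdom X \<delta> = [hm X j t] \<and> cleft X \<delta> = t \<and> cright X \<delta> = t}"

lemma ext_opsD:
  assumes "\<delta> \<in> ext_ops t"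
  shows "idcell \<delta>" "cdom X \<delta> = [hm X j t]" "cleft X \<delta> = t" "cright X \<delta> = t"
  using assms by (auto simp: ext_ops_def)

lemma ext_opsI: "\<lbrakk>idcell \<delta>; cdom X \<delta> = [hm X j t]; cleft X \<delta> = t; cright X \<delta> = t\<rbrakk> \<Longrightarrow> \<delta> \<in> ext_ops t"
  by (simp add: ext_ops_def)

text \<open>The form which relative monads and monoids take after transposition, with \<open>\<delta>\<close> for
  \<open>\<dagger>\<close> and \<open>\<epsilon>\<close> for \<open>\<eta>\<close>.\<close>

definition kl_axioms :: "'t \<Rightarrow> 'c \<Rightarrow> 'c \<Rightarrow> bool" where
  "kl_axioms t \<delta> \<epsilon> \<longleftrightarrow> \<epsilon> \<odot> \<delta> = hcell X j t \<and> vcomp X \<delta> (hglob X j t \<epsilon>) = idu t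
     \<and> \<delta> \<odot> \<delta> = vcomp X \<delta> (hglob X j t (hcell X j t \<odot> \<delta>))"

definition kl_triples :: "('t \<times> 'c \<times> 'c) set" where
  "kl_triples = {(t, \<delta>, \<epsilon>). t \<in> T \<and> \<delta> \<in> ext_ops t \<and> \<epsilon> \<in> N j t \<and> kl_axioms t \<delta> \<epsilon>}"

text \<open>The last equation transposes the compatibility of a morphism with the extension
  operators; substituting the \<open>hglob\<close> into \<open>\<delta>'\<close> is precomposition
  with \<open>E(j,\<theta>)\<close>.\<close>

definition kl_hom :: "'t \<times> 'c \<times> 'c \<Rightarrow> 't \<times> 'c \<times> 'c \<Rightarrow> 'c set" where
  "kl_hom = (\<lambda>(t, \<delta>, \<epsilon>) (t', \<delta>', \<epsilon>'). {\<theta> \<in> N t t'. \<epsilon> \<odot> \<theta> = \<epsilon>'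
     \<and> \<delta> \<odot> \<theta> = \<theta> \<odot> vcomp X \<delta>' (hglob X j t' (hcell X j t \<odot> \<theta>))})"

definition mult :: "'t \<Rightarrow> 'c \<Rightarrow> 'c" where
  "mult t \<delta> = hglob X i t (hcell X i t \<odot> vcomp X \<delta> (smj t))"

lemma mult_simps [simp]:
  assumes "t \<in> T" "\<delta> \<in> ext_ops t"
  shows "mult t \<delta> \<in> Cell X" "cdom X (mult t \<delta>) = [hm X i t, hm X j i, hm X i t]"
    "ccod X (mult t \<delta>) = hm X i t" "cleft X (mult t \<delta>) = i" "cright X (mult t \<delta>) = tid X a"
    "vcomp X (hcell X i t) (mult t \<delta>) = hcell X i t \<odot> vcomp X \<delta> (smj t)"
    "mult t \<delta> \<in> multimor X j [Some t, Some t] t"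
  using ext_opsD[OF assms(2)] assms(1)
  by (simp_all add: mult_def multimor_def mdom_def entry_def hglob_glob)

text \<open>The domain of a binary multimorphism is \<open>E(1,t), E(j,1), E(1,t)\<close>.
  \<open>companion_expand\<close> strips off the leading companion, \<open>smile_factor\<close>
  contracts the other two entries to \<open>E(j,t)\<close>, and what is left is the
  operator.\<close>

lemma mult_surj:
  assumes "t \<in> T" "m \<in> multimor X j [Some t, Some t] t"
  shows "\<exists>\<delta> \<in> ext_ops t. m = mult t \<delta>"
proof -
  have g: "m \<in> glob X [hm X i t, hm X j i, hm X i t] (hm X i t)"
    using assms by (simp add: multimor_def mdom_def entry_def)
  let ?\<phi> = "vcomp X (hcell X i t) m"
  note m = glob_hmD[OF g, simplified, OF assms(1)[THEN T_simps(1)], simplified T_simps(3)[OF assms(1)], simplified]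
  let ?f = "ccomp X ?\<phi> t [cunit t, cid X (hm X j i), cid X (hm X i t)]"
  have c: "composable X ?\<phi> t [cunit t, cid X (hm X j i), cid X (hm X i t)] (tid X a)"
    using m assms(1) by (simp add: composable_def)
  note f = ccomp_idcell[OF _ c] composable_simps[OF c]
  have f': "idcell ?f" "cdom X ?f = [hm X j i, hm X i t]" "cleft X ?f = t" "cright X ?f = t"
    using f m assms(1) by simp_all
  have e1: "hcell X i t \<odot> ?f = ?\<phi>"
    using companion_expand[of t e ?\<phi> "[hm X j i, hm X i t]"] m assms(1) by simp
  let ?d = "ccomp X ?f (tid X a) [rproj j t, cunit t]"
  have s: "composable X ?f (tid X a) [rproj j t, cunit t] (tid X a)" "vcomp X ?d (smj t) = ?f"
    using smile_factor[of j e t ?f] assms(1) f' by simp_all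
  have d: "?d \<in> ext_ops t"
    using ccomp_idcell[OF f'(1) s(1)] composable_simps[OF s(1)] f' assms(1) by (intro ext_opsI) simp_all
  have "m = mult t ?d"
    unfolding mult_def s(2) e1 using m by simp
  then show ?thesis using d by blast
qed

lemma mult_inj:
  assumes "t \<in> T" "\<delta> \<in> ext_ops t" "\<delta>' \<in> ext_ops t" "mult t \<delta> = mult t \<delta>'"
  shows "\<delta> = \<delta>'"
proof -
  note d = ext_opsD[OF assms(2)] ext_opsD[OF assms(3)]
  have "hcell X i t \<odot> vcomp X \<delta> (smj t) = hcell X i t \<odot> vcomp X \<delta>' (smj t)"
    using mult_simps(6)[OF assms(1,2)] mult_simps(6)[OF assms(1,3)] assms(4) by simp
  then have "vcomp X \<delta> (smj t) = vcomp X \<delta>' (smj t)"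
    by - (rule companion_cancel'[of t e], use assms(1) d in simp_all)
  then show ?thesis
    by - (rule smj_cancel[OF assms(1)], use assms(1) d in simp_all)
qed

text \<open>In transposed form \<open>p\<close> stays outside on the left, while \<open>q\<close> is
  passed into \<open>\<delta>\<close>. The monoid laws are evaluated with this formula by inserting
  identities, units and multiplications for \<open>p\<close> and \<open>q\<close>.\<close>

lemma mult_comp:
  assumes t: "t \<in> T" "\<delta> \<in> ext_ops t"
    and p: "p \<in> Cell X" "ccod X p = hm X i t" "cleft X p = i" "cright X p = tid X a"
    and q: "q \<in> Cell X" "ccod X q = hm X i t" "cleft X q = i" "cright X q = tid X a"
  shows "mcomp X j (mult t \<delta>) [p, q] \<in> glob X (cdom X p @ [hm X j i] @ cdom X q) (hm X i t)"
    "vcomp X (hcell X i t) (mcomp X j (mult t \<delta>) [p, q]) =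
      vcomp X (hcell X i t) p \<odot> vcomp X \<delta> (hglob X j t (hcell X j i \<odot> vcomp X (hcell X i t) q))"
proof -
  note d = ext_opsD[OF t(2)]
  have c: "composable X (mult t \<delta>) i [p, cid X (hm X j i), q] (tid X a)"
    using t p q by (simp add: composable_def)
  show "mcomp X j (mult t \<delta>) [p, q] \<in> glob X (cdom X p @ [hm X j i] @ cdom X q) (hm X i t)"
    using composable_simps[OF c] t p q by (simp add: mcomp_def glob_def)
  have cs: "composable X (smj t) (tid X a) [cid X (hm X j i), q] (tid X a)"
    using t q by (simp add: composable_def)
  have "ccomp X (hcell X j i \<odot> hcell X i t) (tid X a) ([cid X (hm X j i)] @ [q]) =
      hcell X j i \<odot> vcomp X (hcell X i t) q"
    using t q vcomp_cid(2)[of "hcell X j i"]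
    by (subst ccomp_mul[where k = i and l = "tid X a"]) (auto simp: composable_def vcomp_def)
  then have s: "ccomp X (smj t) (tid X a) [cid X (hm X j i), q] = hglob X j t (hcell X j i \<odot> vcomp X (hcell X i t) q)"
    using t q ccomp_hglob[OF _ _ _ cs[unfolded smj_eq[OF t(1)]]] by (simp add: smj_eq hglob_def)
  have cd: "composable X (vcomp X \<delta> (smj t)) (tid X a) [cid X (hm X j i), q] (tid X a)"
    using t q d by (simp add: composable_def)
  have pp: "composable X (hcell X i t) i [p] (tid X a)" "ccomp X (hcell X i t) i [p] = vcomp X (hcell X i t) p"
    using t p by (auto simp add: composable_def vcomp_def)
  have "vcomp X (hcell X i t) (mcomp X j (mult t \<delta>) [p, q]) =
      ccomp X (hcell X i t \<odot> vcomp X \<delta> (smj t)) i ([p] @ [cid X (hm X j i), q])"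
    using t vcomp_ccomp[OF _ _ c, of "hcell X i t"] by (simp add: mcomp_def)
  also have "\<dots> = vcomp X (hcell X i t) p \<odot> ccomp X (vcomp X \<delta> (smj t)) (tid X a) [cid X (hm X j i), q]"
    using t d pp by (subst ccomp_mul[OF _ _ _ _ cd]) auto
  also have "ccomp X (vcomp X \<delta> (smj t)) (tid X a) [cid X (hm X j i), q] =
      vcomp X \<delta> (hglob X j t (hcell X j i \<odot> vcomp X (hcell X i t) q))"
    using t d s vcomp_ccomp[OF _ _ cs, of \<delta>] by simp
  finally show "vcomp X (hcell X i t) (mcomp X j (mult t \<delta>) [p, q]) =
      vcomp X (hcell X i t) p \<odot> vcomp X \<delta> (hglob X j t (hcell X j i \<odot> vcomp X (hcell X i t) q))" .
qed

lemma unnullary_N: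
  assumes "\<epsilon> \<in> N f g" "f \<in> T"
  shows "unnullary \<epsilon> \<in> two_cells X f g" "unnullary \<epsilon> \<in> Cell X" "cdom X (unnullary \<epsilon>) = [hm X i f]"
    "ccod X (unnullary \<epsilon>) = hm X i g" "cleft X (unnullary \<epsilon>) = i"
    "cright X (unnullary \<epsilon>) = tid X a"
    "vcomp X (hcell X i g) (unnullary \<epsilon>) = hcell X i f \<odot> \<epsilon>"
  using unnullary_simps[OF ND[OF assms(1)], of e] assms(2) by simp_all

lemma unnullary_inj:
  assumes "\<alpha> \<in> N f g" "\<beta> \<in> N f g"
  shows "unnullary \<alpha> = unnullary \<beta> \<longleftrightarrow> \<alpha> = \<beta>"
  using nullary_unnullary[OF ND[OF assms(1)]] nullary_unnullary[OF ND[OF assms(2)]] by metis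

lemma hglob_inj:
  assumes "idcell \<psi>" "cleft X \<psi> = f" "cright X \<psi> = g" "idcell \<psi>'" "cleft X \<psi>' = f" "cright X \<psi>' = g"
  shows "hglob X f g \<psi> = hglob X f g \<psi>' \<longleftrightarrow> \<psi> = \<psi>'"
  using hglob_simps(6)[OF assms(1-3)] hglob_simps(6)[OF assms(4-6)] by metis

lemma hglob_smj_mul:
  assumes "s \<in> T" "t \<in> T" "\<theta> \<in> N s t"
  shows "hglob X j t (hcell X j i \<odot> hcell X i s \<odot> \<theta>) = vcomp X (hglob X j t (hcell X j s \<odot> \<theta>)) (smj s)"
proof -
  note n = ND[OF assms(3)]
  have "vcomp X (hcell X j s \<odot> \<theta>) (smj s) = (hcell X j i \<odot> hcell X i s) \<odot> \<theta>"
    using assms n by (subst vcomp_mul_left) simp_all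
  then show ?thesis
    using assms n by (simp add: vcomp_hglob) (simp add: hglob_def)
qed

text \<open>The transposes of both sides consist of \<open>hcell X i j\<close> followed by a 2-cell
  that has been precomposed with \<open>smj t\<close>. Cancelling the companion and then
  \<open>smj t\<close> leaves the equation on the right.\<close>

lemma left_unit_iff:
  assumes t: "t \<in> T" "\<delta> \<in> ext_ops t" "\<epsilon> \<in> N j t"
  shows "mcomp X j (mult t \<delta>) [unnullary \<epsilon>, cid X (companion X t)] =
      left_unitor X j [] (Some t) [] (cid X (companion X t)) \<longleftrightarrow> \<epsilon> \<odot> \<delta> = hcell X j t"
proof -
  note d = ext_opsD[OF t(2)] and n = ND[OF t(3)] and u = unnullary_N[OF t(3) j_tights]
  let ?L = "mcomp X j (mult t \<delta>) [unnullary \<epsilon>, cid X (hm X i t)]"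
  let ?Y = "ccomp X (smile X i i t) i [smile X i j i, cid X (hm X i t)]"
  have s1: "smile X i i t = hglob X i t (hcell X i i \<odot> hcell X i t)"
    and s2: "smile X i j i = hglob X i i (hcell X i j \<odot> hcell X j i)"
    using t by (simp_all add: smile_eq)
  have cY: "composable X (smile X i i t) i [smile X i j i, cid X (hm X i t)] (tid X a)"
    using t by (simp add: composable_def s1 s2)
  note Y = composable_simps[OF cY]
  have Yg: "?Y \<in> glob X [hm X i j, hm X j i, hm X i t] (hm X i t)"
    using Y t by (simp add: glob_def s1 s2)
  have R: "left_unitor X j [] (Some t) [] (cid X (companion X t)) = ?Y"
    using t Yg vcomp_cid(1)[of ?Y] by (simp add: left_unitor_def plug_def mpre_def msuf_def Let_def vcomp_def glob_def)
  have "ccomp X (hcell X i i \<odot> hcell X i t) i ([smile X i j i] @ [cid X (hm X i t)]) =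
      (hcell X i j \<odot> hcell X j i) \<odot> hcell X i t"
    using t vcomp_cid(2)[of "hcell X i t"] hglob_simps(6)[of "hcell X i j \<odot> hcell X j i" i i]
    by (subst ccomp_mul[where k = i and l = "tid X a"]) (auto simp: composable_def vcomp_def s2)
  then have Yt: "vcomp X (hcell X i t) ?Y = hcell X i j \<odot> vcomp X (hcell X j t) (smj t)"
    using t vcomp_ccomp[OF _ _ cY, of "hcell X i t"] by (simp add: s1)
  have L: "?L \<in> glob X [hm X i j, hm X j i, hm X i t] (hm X i t)"
    "vcomp X (hcell X i t) ?L = hcell X i j \<odot> vcomp X (\<epsilon> \<odot> \<delta>) (smj t)"
    using mult_comp[OF t(1,2) u(2,4,5,6), of "cid X (hm X i t)"] t u d n
    by (simp_all add: smj_eq[symmetric] vcomp_mul_right)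
  have "?L = ?Y \<longleftrightarrow> hcell X i j \<odot> vcomp X (\<epsilon> \<odot> \<delta>) (smj t) = hcell X i j \<odot> vcomp X (hcell X j t) (smj t)"
    using glob_hm_eqI[OF L(1) Yg] t L(2) Yt by auto
  also have "\<dots> \<longleftrightarrow> vcomp X (\<epsilon> \<odot> \<delta>) (smj t) = vcomp X (hcell X j t) (smj t)"
  proof
    assume "hcell X i j \<odot> vcomp X (\<epsilon> \<odot> \<delta>) (smj t) = hcell X i j \<odot> vcomp X (hcell X j t) (smj t)"
    then show "vcomp X (\<epsilon> \<odot> \<delta>) (smj t) = vcomp X (hcell X j t) (smj t)"
      by - (rule companion_cancel'[of j e], use t d n in \<open>simp_all del: smj_simps(6)\<close>)
  qed simp
  also have "\<dots> \<longleftrightarrow> \<epsilon> \<odot> \<delta> = hcell X j t"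
    using smj_cancel[of t "\<epsilon> \<odot> \<delta>" "hcell X j t"] t d n by (auto simp del: smj_simps(6))
  finally show ?thesis
    using R t by simp
qed

text \<open>The right-unitor involves a definite description. It is evaluated by exhibiting a
  factorisation and showing it to be the only one by means of the section of
  \<open>smj j\<close>.\<close>

lemma right_unit_iff:
  assumes t: "t \<in> T" "\<delta> \<in> ext_ops t" "\<epsilon> \<in> N j t"
  shows "right_unitor X j [] (Some t) [] (mcomp X j (mult t \<delta>) [cid X (companion X t), unnullary \<epsilon>]) =
      cid X (companion X t) \<longleftrightarrow> vcomp X \<delta> (hglob X j t \<epsilon>) = idu t"
proof -
  note d = ext_opsD[OF t(2)] and n = ND[OF t(3)] and u = unnullary_N[OF t(3) j_tights]
  let ?M = "mcomp X j (mult t \<delta>) [cid X (hm X i t), unnullary \<epsilon>]" and ?p = "hm X i t"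
  let ?E = "hglob X j t (hcell X j j \<odot> \<epsilon>)"
  \<comment> \<open>\<open>?E\<close> is \<open>E(j,\<epsilon>)\<close>, from \<open>E(j,j)\<close>
    to \<open>E(j,t)\<close>. With it, \<open>\<phi>\<close> is the composite of multiplication and
    unit after contraction of \<open>E(j,1), E(1,j)\<close> to \<open>E(j,j)\<close>.\<close>
  define \<phi> where "\<phi> = hglob X i t (hcell X i t \<odot> vcomp X \<delta> ?E)"
  have E: "?E \<in> Cell X" "cdom X ?E = [hm X j j]" "ccod X ?E = hm X j t" "cleft X ?E = tid X a" "cright X ?E = tid X a"
    using t n by simp_all
  have f: "\<phi> \<in> Cell X" "cdom X \<phi> = [?p, hm X j j]" "ccod X \<phi> = ?p" "cleft X \<phi> = i" "cright X \<phi> = tid X a"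
    "vcomp X (hcell X i t) \<phi> = hcell X i t \<odot> vcomp X \<delta> ?E"
    using t d E by (simp_all add: \<phi>_def)
  have ch: "ccomp X (hcell X i t) i [cid X ?p] = hcell X i t"
    using t vcomp_cid(2)[of "hcell X i t"] by (simp add: vcomp_def)
  have f1: "tdom X (cleft X \<phi>') = e" if "\<phi>' \<in> Cell X" "cdom X \<phi>' = [?p, hm X j j]" for \<phi>'
  proof -
    have "lcod X ?p = tdom X (cleft X \<phi>')"
      using lchain_cdom[OF that(1)] unfolding that(2) lchain.simps by blast
    moreover have "lcod X ?p = e"
      using t by simp
    ultimately show ?thesis
      by (rule trans[OF sym])
  qed
  have pl: "plug X \<phi>' [?p] (smj j) [] = ccomp X \<phi>' i [cid X ?p, smj j]"
    if "\<phi>' \<in> Cell X" "cdom X \<phi>' = [?p, hm X j j]" for \<phi>'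
    using f1[OF that] by (simp add: plug_def)
  have cp: "composable X \<phi>' i [cid X ?p, smj j] (tid X a)"
    if "\<phi>' \<in> Cell X" "cdom X \<phi>' = [?p, hm X j j]" for \<phi>'
    using that f1[OF that] t by (simp add: composable_def)
  have M: "?M \<in> glob X [?p, hm X j i, hm X i j] ?p"
    "vcomp X (hcell X i t) ?M = hcell X i t \<odot> vcomp X \<delta> (vcomp X ?E (smj j))"
    using mult_comp[OF t(1,2) _ _ _ _ u(2,4,5,6), of "cid X ?p"] t u hglob_smj_mul[OF j_tights t(1,3)] by simp_all
  have "ccomp X (hcell X i t \<odot> vcomp X \<delta> ?E) i ([cid X ?p] @ [smj j]) = hcell X i t \<odot> vcomp X (vcomp X \<delta> ?E) (smj j)"
    using t d E ch
    by (subst ccomp_mul[where k = "tid X a" and l = "tid X a"]) (auto simp: composable_def vcomp_def[of _ "vcomp X \<delta> ?E"])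
  then have fs: "vcomp X (hcell X i t) (ccomp X \<phi> i [cid X ?p, smj j]) = hcell X i t \<odot> vcomp X \<delta> (vcomp X ?E (smj j))"
    using t f d E vcomp_ccomp[OF _ _ cp[OF f(1,2)], of "hcell X i t"] vcomp_assoc[of \<delta> ?E "smj j"] by simp
  have "ccomp X \<phi> i [cid X ?p, smj j] \<in> glob X [?p, hm X j i, hm X i j] ?p"
    using composable_simps[OF cp[OF f(1,2)]] f t by (simp add: glob_def)
  then have pM: "plug X \<phi> [?p] (smj j) [] = ?M"
    using glob_hm_eqI[OF _ M(1)] fs M(2) t pl[OF f(1,2)] by simp
  have un: "\<phi>' = \<phi>" if "\<phi>' \<in> Cell X" "cdom X \<phi>' = [?p, hm X j j]" "plug X \<phi>' [?p] (smj j) [] = ?M" for \<phi>'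
  proof -
    have r: "ccomp X (ccomp X \<phi>' i [cid X ?p, smj j]) i ([cid X ?p] @ [rproj j j, cunit j]) = \<phi>'"
      if p: "\<phi>' \<in> Cell X" "cdom X \<phi>' = [?p, hm X j j]" for \<phi>'
      using t vcomp_cid(1)[of "cid X ?p"] smj_section[OF j_tights] ccomp_cid_right[of \<phi>'] f1[OF p] p
      by (subst assoc2[OF cp[OF p] _ smj_section(1)[OF j_tights]]) (auto simp: composable_def vcomp_def)
    show ?thesis
      using r[OF that(1,2)] r[OF f(1,2)] that(3) pl[OF that(1,2)] pl[OF f(1,2)] pM by metis
  qed
  have the: "(THE \<phi>'. \<phi>' \<in> Cell X \<and> cdom X \<phi>' = [?p, hm X j j] \<and> plug X \<phi>' [?p] (smj j) [] = ?M) = \<phi>"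
    using f pM un by (intro the_equality) blast+
  have fr: "frown X j = hglob X j j (idu j)"
    by (simp add: frown_eq)
  let ?R = "ccomp X \<phi> i [cid X ?p, frown X j]"
  have R: "right_unitor X j [] (Some t) [] (mcomp X j (mult t \<delta>) [cid X (companion X t), unnullary \<epsilon>]) = ?R"
    using the t f by (simp add: right_unitor_def mpre_def msuf_def entry_def Let_def) (simp add: plug_def)
  have cR: "composable X \<phi> i [cid X ?p, frown X j] (tid X a)"
    using f t by (simp add: composable_def fr)
  have Rg: "?R \<in> glob X [?p] ?p"
    using composable_simps[OF cR] f t by (simp add: glob_def fr)
  \<comment> \<open>Pasting \<open>frown X j\<close> removes the factor \<open>hcell X j j\<close>,
    so that the bare unit \<open>\<epsilon>\<close> is fed into \<open>\<delta>\<close>.\<close>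
  have Ef: "vcomp X ?E (frown X j) = hglob X j t \<epsilon>"
    using t n by (simp add: vcomp_hglob vcomp_mul_left fr) (simp add: hglob_def)
  have "ccomp X (hcell X i t \<odot> vcomp X \<delta> ?E) i ([cid X ?p] @ [frown X j]) = hcell X i t \<odot> vcomp X (vcomp X \<delta> ?E) (frown X j)"
    using t d E ch
    by (subst ccomp_mul[where k = "tid X a" and l = "tid X a"]) (auto simp: composable_def vcomp_def[of _ "vcomp X \<delta> ?E"] fr)
  then have Rt: "vcomp X (hcell X i t) ?R = hcell X i t \<odot> vcomp X \<delta> (hglob X j t \<epsilon>)"
    using t f d E Ef vcomp_ccomp[OF _ _ cR, of "hcell X i t"] vcomp_assoc[of \<delta> ?E "frown X j"]
    by (simp add: fr)
  have cg: "cid X ?p \<in> glob X [?p] ?p"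
    using t by (simp add: glob_def)
  have "?R = cid X ?p \<longleftrightarrow> hcell X i t \<odot> vcomp X \<delta> (hglob X j t \<epsilon>) = hcell X i t \<odot> idu t"
    using glob_hm_eqI[OF Rg cg] Rt t by auto
  also have "\<dots> \<longleftrightarrow> vcomp X \<delta> (hglob X j t \<epsilon>) = idu t"
  proof
    assume "hcell X i t \<odot> vcomp X \<delta> (hglob X j t \<epsilon>) = hcell X i t \<odot> idu t"
    then show "vcomp X \<delta> (hglob X j t \<epsilon>) = idu t"
      by - (rule companion_cancel'[of t e], use t d n in simp_all)
  qed simp
  finally show ?thesis
    using R t by simp
qed

text \<open>The common domain contains \<open>E(j,1), E(1,t)\<close> twice behind the leading
  companion, so two copies of \<open>smj t\<close> are cancelled besides that companion.\<close>

lemma assoc_iff: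
  assumes t: "t \<in> T" "\<delta> \<in> ext_ops t"
  shows "mcomp X j (mult t \<delta>) [mult t \<delta>, cid X (companion X t)] =
      mcomp X j (mult t \<delta>) [cid X (companion X t), mult t \<delta>] \<longleftrightarrow>
      \<delta> \<odot> \<delta> = vcomp X \<delta> (hglob X j t (hcell X j t \<odot> \<delta>))"
proof -
  note d = ext_opsD[OF t(2)]
  let ?p = "hm X i t" and ?s = "\<lambda>\<chi>. ccomp X \<chi> (tid X a) [smj t, smj t]"
  let ?L = "mcomp X j (mult t \<delta>) [mult t \<delta>, cid X ?p]" and ?R = "mcomp X j (mult t \<delta>) [cid X ?p, mult t \<delta>]"
  let ?ps = "[?p, hm X j i, ?p, hm X j i, ?p]"
  let ?x = "hcell X j t \<odot> \<delta>"
  have hx: "hglob X j t ?x \<in> Cell X" "cdom X (hglob X j t ?x) = [hm X j t, hm X j t]"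
    "ccod X (hglob X j t ?x) = hm X j t" "cleft X (hglob X j t ?x) = tid X a" "cright X (hglob X j t ?x) = tid X a"
    using t d by simp_all
  have cv: "composable X \<chi> (tid X a) [smj t] (tid X a)" if "\<chi> \<in> Cell X" "cdom X \<chi> = [hm X j t]" for \<chi>
    using that t lchain1[OF that] by (simp add: composable_def)
  have "?s (\<delta> \<odot> \<delta>) = vcomp X \<delta> (smj t) \<odot> vcomp X \<delta> (smj t)"
    using ccomp_mul[OF d(1,1) _ cv cv] d t by (simp add: vcomp_def)
  moreover have "?s ?x = (hcell X j i \<odot> hcell X i t) \<odot> vcomp X \<delta> (smj t)"
    using ccomp_mul[OF _ d(1) _ cv cv, of "hcell X j t"] d t smj_simps(6)[OF t(1)] by (simp add: vcomp_def)
  moreover have "?s (hglob X j t ?x) = hglob X j t (?s ?x)"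
    using ccomp_hglob[OF _ _ _ composable_smj2[OF t(1) hx(1,2)]] d t by (simp add: hglob_def)
  moreover have "vcomp X \<delta> (?s (hglob X j t ?x)) = ?s (vcomp X \<delta> (hglob X j t ?x))"
    using vcomp_ccomp[OF _ _ composable_smj2[OF t(1) hx(1,2)], of \<delta>] d t hx by simp
  ultimately have e: "vcomp X \<delta> (smj t) \<odot> vcomp X \<delta> (smj t) = ?s (\<delta> \<odot> \<delta>)"
     "vcomp X \<delta> (hglob X j t ((hcell X j i \<odot> hcell X i t) \<odot> vcomp X \<delta> (smj t))) = ?s (vcomp X \<delta> (hglob X j t ?x))"
    by simp_all
  have L: "?L \<in> glob X ?ps ?p" "vcomp X (hcell X i t) ?L = hcell X i t \<odot> ?s (\<delta> \<odot> \<delta>)"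
    using mult_comp[OF t mult_simps(1,3-5)[OF t], of "cid X ?p"] t d e by (simp_all add: smj_eq[symmetric])
  have R: "?R \<in> glob X ?ps ?p" "vcomp X (hcell X i t) ?R = hcell X i t \<odot> ?s (vcomp X \<delta> (hglob X j t ?x))"
    using mult_comp[OF t _ _ _ _ mult_simps(1,3-5)[OF t], of "cid X ?p"] t d e by simp_all
  have c1: "composable X (\<delta> \<odot> \<delta>) (tid X a) [smj t, smj t] (tid X a)"
    and c2: "composable X (vcomp X \<delta> (hglob X j t ?x)) (tid X a) [smj t, smj t] (tid X a)"
    using d t hx by (auto intro: composable_smj2)
  note z = ccomp_idcell[OF _ c1] ccomp_idcell[OF _ c2] composable_simps[OF c1] composable_simps[OF c2]
  have "?L = ?R \<longleftrightarrow> hcell X i t \<odot> ?s (\<delta> \<odot> \<delta>) = hcell X i t \<odot> ?s (vcomp X \<delta> (hglob X j t ?x))"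
    using glob_hm_eqI[OF L(1) R(1)] t L(2) R(2) by auto
  also have "\<dots> \<longleftrightarrow> ?s (\<delta> \<odot> \<delta>) = ?s (vcomp X \<delta> (hglob X j t ?x))"
  proof
    assume "hcell X i t \<odot> ?s (\<delta> \<odot> \<delta>) = hcell X i t \<odot> ?s (vcomp X \<delta> (hglob X j t ?x))"
    then show "?s (\<delta> \<odot> \<delta>) = ?s (vcomp X \<delta> (hglob X j t ?x))"
      by - (rule companion_cancel'[of t e], use t d z hx in simp_all)
  qed simp
  also have "\<dots> \<longleftrightarrow> \<delta> \<odot> \<delta> = vcomp X \<delta> (hglob X j t ?x)"
    using smj_cancel2[of t "\<delta> \<odot> \<delta>" "vcomp X \<delta> (hglob X j t ?x)"] t d hx by auto
  finally show ?thesis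
    using t by simp
qed

lemma multi_monoids_iff:
  assumes "t \<in> T" "\<delta> \<in> ext_ops t" "\<epsilon> \<in> N j t"
  shows "(t, mult t \<delta>, unnullary \<epsilon>) \<in> multi_monoids X j \<longleftrightarrow> kl_axioms t \<delta> \<epsilon>"
proof -
  have "unnullary \<epsilon> \<in> multimor X j [None] t"
    using unnullary_N(1)[OF assms(3)] assms(1)
    by (simp add: multimor_def mdom_def entry_def two_cells_def)
  then show ?thesis
    using left_unit_iff[OF assms] right_unit_iff[OF assms] assoc_iff[OF assms(1,2)] assms
    by (simp add: multi_monoids_def kl_axioms_def)
qed

lemma multi_hom_iff:
  assumes t: "t \<in> T" "\<delta> \<in> ext_ops t" "\<epsilon> \<in> N j t" and t': "t' \<in> T" "\<delta>' \<in> ext_ops t'" "\<epsilon>' \<in> N j t'"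
    and \<theta>: "\<theta> \<in> N t t'"
  shows "unnullary \<theta> \<in> hom (Mon_multi X j) (t, mult t \<delta>, unnullary \<epsilon>) (t', mult t' \<delta>', unnullary \<epsilon>')
    \<longleftrightarrow> \<theta> \<in> kl_hom (t, \<delta>, \<epsilon>) (t', \<delta>', \<epsilon>')"
proof -
  note d = ext_opsD[OF t(2)] ext_opsD[OF t'(2)] and n = ND[OF t(3)] ND[OF t'(3)] ND[OF \<theta>] and u = unnullary_N[OF \<theta> t(1)]
    and v = unnullary_N[OF t(3) j_tights]
  let ?\<tau> = "unnullary \<theta>" and ?h = "hglob X j t' (hcell X j t \<odot> \<theta>)"
  have h: "?h \<in> Cell X" "cdom X ?h = [hm X j t]" "ccod X ?h = hm X j t'" "cleft X ?h = tid X a" "cright X ?h = tid X a"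
    using t t' n by simp_all
  have 0: "?\<tau> \<in> multimor X j [Some t] t'"
    using u(1) by (simp add: multimor_def mdom_def entry_def two_cells_def)
  have m1: "mcomp X j ?\<tau> [mult t \<delta>] = vcomp X ?\<tau> (mult t \<delta>)" "mcomp X j ?\<tau> [unnullary \<epsilon>] = unnullary (\<epsilon> \<odot> \<theta>)"
    using t v vcomp_unnullary[of \<epsilon> \<theta>] n by (simp_all add: mcomp_def vcomp_def)
  have ue: "unnullary (\<epsilon> \<odot> \<theta>) = unnullary \<epsilon>' \<longleftrightarrow> \<epsilon> \<odot> \<theta> = \<epsilon>'"
    by (rule unnullary_inj[OF mul_N[OF t(3) \<theta>] t'(3)])
  let ?L = "vcomp X ?\<tau> (mult t \<delta>)" and ?R = "mcomp X j (mult t' \<delta>') [?\<tau>, ?\<tau>]"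
  let ?ps = "[hm X i t, hm X j i, hm X i t]"
  have L: "?L \<in> glob X ?ps (hm X i t')"
    using t t' u by (simp add: glob_def)
  have "vcomp X (hcell X i t') ?L = vcomp X (hcell X i t \<odot> \<theta>) (mult t \<delta>)"
    using t t' u by (subst vcomp_assoc) simp_all
  also have "\<dots> = hcell X i t \<odot> vcomp X (\<delta> \<odot> \<theta>) (smj t)"
    using t t' n d by (simp add: vcomp_mul_left)
  finally have Lt: "vcomp X (hcell X i t') ?L = hcell X i t \<odot> vcomp X (\<delta> \<odot> \<theta>) (smj t)" .
  have R: "?R \<in> glob X ?ps (hm X i t')"
    using mult_comp(1)[OF t'(1,2) u(2,4-6) u(2,4-6)] u by simp
  have "vcomp X (hcell X i t') ?R = (hcell X i t \<odot> \<theta>) \<odot> vcomp X \<delta>' (vcomp X ?h (smj t))"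
    using mult_comp(2)[OF t'(1,2) u(2,4-6) u(2,4-6)] u hglob_smj_mul[OF t(1) t'(1) \<theta>] by simp
  also have "\<dots> = hcell X i t \<odot> vcomp X (\<theta> \<odot> vcomp X \<delta>' ?h) (smj t)"
    using t t' n d h vcomp_assoc[of \<delta>' ?h "smj t"] by (simp add: vcomp_mul_right)
  finally have Rt: "vcomp X (hcell X i t') ?R = hcell X i t \<odot> vcomp X (\<theta> \<odot> vcomp X \<delta>' ?h) (smj t)" .
  have "?L = ?R \<longleftrightarrow> hcell X i t \<odot> vcomp X (\<delta> \<odot> \<theta>) (smj t) = hcell X i t \<odot> vcomp X (\<theta> \<odot> vcomp X \<delta>' ?h) (smj t)"
    using glob_hm_eqI[OF L R] t t' Lt Rt by auto
  also have "\<dots> \<longleftrightarrow> vcomp X (\<delta> \<odot> \<theta>) (smj t) = vcomp X (\<theta> \<odot> vcomp X \<delta>' ?h) (smj t)"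
  proof
    assume "hcell X i t \<odot> vcomp X (\<delta> \<odot> \<theta>) (smj t) = hcell X i t \<odot> vcomp X (\<theta> \<odot> vcomp X \<delta>' ?h) (smj t)"
    then show "vcomp X (\<delta> \<odot> \<theta>) (smj t) = vcomp X (\<theta> \<odot> vcomp X \<delta>' ?h) (smj t)"
      by - (rule companion_cancel'[of t e], use t t' d n h in simp_all)
  qed simp
  also have "\<dots> \<longleftrightarrow> \<delta> \<odot> \<theta> = \<theta> \<odot> vcomp X \<delta>' ?h"
    using smj_cancel[of t "\<delta> \<odot> \<theta>" "\<theta> \<odot> vcomp X \<delta>' ?h"] t t' d n h by auto
  finally show ?thesis
    using 0 m1 ue \<theta> by (auto simp add: Mon_multi_def kl_hom_def)
qed

section \<open>Relative monads in transposed form\<close>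

lemma restr_post_eq:
  assumes "f \<in> T" "g \<in> T" "h \<in> T" "\<theta> \<in> N f g"
  shows "restr_post X h f g (unnullary \<theta>) = hglob X h g (hcell X h f \<odot> \<theta>)"
  using assms ND[OF assms(4)] by (simp add: restr_post_def mul_def)

lemma restr_pre_eq:
  assumes "f \<in> T" "g \<in> T" "h \<in> T" "\<theta> \<in> N f g"
  shows "restr_pre X f g h (unnullary \<theta>) = hglob X f h (\<theta> \<odot> hcell X g h)"
  using assms ND[OF assms(4)] by (simp add: restr_pre_def mul_def)

lemma ext_op_surj:
  assumes "t \<in> T" "d \<in> glob X [hm X j t] (hm X t t)"
  shows "\<exists>\<delta> \<in> ext_ops t. d = hglob X t t \<delta>"
proof
  show "d = hglob X t t (vcomp X (hcell X t t) d)" "vcomp X (hcell X t t) d \<in> ext_ops t"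
    using glob_hmD[OF assms(2)] assms(1) by (auto intro: ext_opsI)
qed

text \<open>Each law compares globular 2-cells into a restriction, and these agree exactly when
  their transposes do, by \<open>hglob_inj\<close>. Evaluating the transposes gives the conjuncts of
  \<open>kl_axioms\<close> in the same order.\<close>

lemma rel_monads_iff:
  assumes t: "t \<in> T" "\<delta> \<in> ext_ops t" "\<epsilon> \<in> N j t"
  shows "(t, hglob X t t \<delta>, unnullary \<epsilon>) \<in> rel_monads X j \<longleftrightarrow> kl_axioms t \<delta> \<epsilon>"
proof -
  note d = ext_opsD[OF t(2)] and n = ND[OF t(3)] and u = unnullary_N[OF t(3) j_tights]
  let ?d = "hglob X t t \<delta>" and ?x = "hglob X j t (hcell X j t \<odot> \<delta>)"
  have D: "?d \<in> Cell X" "cdom X ?d = [hm X j t]" "ccod X ?d = hm X t t" "cleft X ?d = tid X a"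
    "cright X ?d = tid X a" "vcomp X (hcell X t t) ?d = \<delta>"
    using t d by simp_all
  have dg: "?d \<in> glob X [hm X j t] (hm X t t)"
    using t d by (intro hglob_glob) simp_all
  have "vcomp X (restr_pre X j t t (unnullary \<epsilon>)) ?d = hglob X j t (\<epsilon> \<odot> \<delta>)"
    using t d n by (simp add: restr_pre_eq vcomp_hglob vcomp_mul_right) (simp add: hglob_def)
  moreover have "hglob X j t (\<epsilon> \<odot> \<delta>) = hglob X j t (hcell X j t) \<longleftrightarrow> \<epsilon> \<odot> \<delta> = hcell X j t"
    by (rule hglob_inj) (use t d n in simp_all)
  ultimately have 1: "vcomp X (restr_pre X j t t (unnullary \<epsilon>)) ?d = cid X (hm X j t) \<longleftrightarrow> \<epsilon> \<odot> \<delta> = hcell X j t"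
    using t by simp
  have "vcomp X (restr_post X j j t (unnullary \<epsilon>)) (frown X j) = hglob X j t \<epsilon>"
    using t n by (simp add: restr_post_eq frown_eq vcomp_hglob vcomp_mul_left) (simp add: hglob_def)
  then have "vcomp X ?d (vcomp X (restr_post X j j t (unnullary \<epsilon>)) (frown X j)) = hglob X t t (vcomp X \<delta> (hglob X j t \<epsilon>))"
    using t d n by (simp add: vcomp_hglob) (simp add: hglob_def)
  moreover have "hglob X t t (vcomp X \<delta> (hglob X j t \<epsilon>)) = hglob X t t (idu t) \<longleftrightarrow> vcomp X \<delta> (hglob X j t \<epsilon>) = idu t"
    by (rule hglob_inj) (use t d n in simp_all)
  ultimately have 2: "vcomp X ?d (vcomp X (restr_post X j j t (unnullary \<epsilon>)) (frown X j)) = frown X t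
      \<longleftrightarrow> vcomp X \<delta> (hglob X j t \<epsilon>) = idu t"
    using t by (simp add: frown_eq)
  have c1: "composable X (smile X t t t) (tid X a) [?d, ?d] (tid X a)"
    and c2: "composable X (smile X j t t) (tid X a) [cid X (hm X j t), ?d] (tid X a)"
    using t D by (auto simp: composable_def smile_eq)
  have dd: "ccomp X (hcell X t t) (tid X a) [?d] = \<delta>" "ccomp X (hcell X j t) (tid X a) [cid X (hm X j t)] = hcell X j t"
    using D t vcomp_cid(2)[of "hcell X j t"] by (simp_all add: vcomp_def)
  have "ccomp X (hcell X t t \<odot> hcell X t t) (tid X a) ([?d] @ [?d]) = \<delta> \<odot> \<delta>"
    using t D dd by (subst ccomp_mul[where k = "tid X a" and l = "tid X a"]) (auto simp: composable_def)
  moreover have "smile X t t t = hglob X t t (hcell X t t \<odot> hcell X t t)"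
    using t by (simp add: smile_eq)
  ultimately have e1: "ccomp X (smile X t t t) (tid X a) [?d, ?d] = hglob X t t (\<delta> \<odot> \<delta>)"
    using t ccomp_hglob[of "hcell X t t \<odot> hcell X t t" t t "tid X a" "[?d, ?d]" "tid X a"] c1
    by (simp add: hglob_def)
  have "ccomp X (hcell X j t \<odot> hcell X t t) (tid X a) ([cid X (hm X j t)] @ [?d]) = hcell X j t \<odot> \<delta>"
    using t D dd by (subst ccomp_mul[where k = "tid X a" and l = "tid X a"]) (auto simp: composable_def)
  moreover have "smile X j t t = hglob X j t (hcell X j t \<odot> hcell X t t)"
    using t by (simp add: smile_eq)
  ultimately have e2: "ccomp X (smile X j t t) (tid X a) [cid X (hm X j t), ?d] = ?x"
    using t ccomp_hglob[of "hcell X j t \<odot> hcell X t t" j t "tid X a" "[cid X (hm X j t), ?d]" "tid X a"] c2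
    by (simp add: hglob_def)
  have e3: "vcomp X ?d ?x = hglob X t t (vcomp X \<delta> ?x)"
    using t d by (simp add: vcomp_hglob) (simp add: hglob_def)
  have 3: "ccomp X (smile X t t t) (tid X a) [?d, ?d] =
     vcomp X ?d (ccomp X (smile X j t t) (tid X a) [cid X (hm X j t), ?d]) \<longleftrightarrow> \<delta> \<odot> \<delta> = vcomp X \<delta> ?x"
    unfolding e1 e2 e3
    by (rule hglob_inj) (use t d in simp_all)
  show ?thesis
    using t dg u(1) 1 2 3 by (simp add: rel_monads_def kl_axioms_def)
qed

lemma rmnd_hom_iff:
  assumes t: "t \<in> T" "\<delta> \<in> ext_ops t" "\<epsilon> \<in> N j t" and t': "t' \<in> T" "\<delta>' \<in> ext_ops t'" "\<epsilon>' \<in> N j t'"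
    and \<theta>: "\<theta> \<in> N t t'"
  shows "unnullary \<theta> \<in> hom (RMnd X j) (t, hglob X t t \<delta>, unnullary \<epsilon>) (t', hglob X t' t' \<delta>', unnullary \<epsilon>')
    \<longleftrightarrow> \<theta> \<in> kl_hom (t, \<delta>, \<epsilon>) (t', \<delta>', \<epsilon>')"
proof -
  note d = ext_opsD[OF t(2)] ext_opsD[OF t'(2)] and n = ND[OF t(3)] ND[OF t'(3)] ND[OF \<theta>] and u = unnullary_N[OF \<theta> t(1)]
  let ?h = "hglob X j t' (hcell X j t \<odot> \<theta>)"
  have h: "?h \<in> Cell X" "cdom X ?h = [hm X j t]" "ccod X ?h = hm X j t'" "cleft X ?h = tid X a" "cright X ?h = tid X a"
    using t t' n by simp_all
  have ue: "vcomp X (unnullary \<theta>) (unnullary \<epsilon>) = unnullary \<epsilon>' \<longleftrightarrow> \<epsilon> \<odot> \<theta> = \<epsilon>'"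
    using vcomp_unnullary[of \<epsilon> \<theta>] unnullary_inj[OF mul_N[OF t(3) \<theta>] t'(3)] n by simp
  have 1: "vcomp X (restr_post X t t t' (unnullary \<theta>)) (hglob X t t \<delta>) = hglob X t t' (\<delta> \<odot> \<theta>)"
    using t t' d n \<theta> by (simp add: restr_post_eq vcomp_hglob vcomp_mul_left) (simp add: hglob_def)
  have "vcomp X (hglob X t' t' \<delta>') ?h = hglob X t' t' (vcomp X \<delta>' ?h)"
    using t t' d h by (simp add: vcomp_hglob) (simp add: hglob_def)
  then have 2: "vcomp X (restr_pre X t t' t' (unnullary \<theta>)) (vcomp X (hglob X t' t' \<delta>') (restr_post X j t t' (unnullary \<theta>)))
     = hglob X t t' (\<theta> \<odot> vcomp X \<delta>' ?h)"
    using t t' d n h \<theta> by (simp add: restr_post_eq restr_pre_eq vcomp_hglob[of "\<theta> \<odot> hcell X t' t'"] vcomp_mul_right) (simp add: hglob_def)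
  have "hglob X t t' (\<delta> \<odot> \<theta>) = hglob X t t' (\<theta> \<odot> vcomp X \<delta>' ?h) \<longleftrightarrow> \<delta> \<odot> \<theta> = \<theta> \<odot> vcomp X \<delta>' ?h"
    by (rule hglob_inj) (use t t' d n h in simp_all)
  then show ?thesis
    using u(1) ue \<theta> unfolding RMnd_def kl_hom_def by (simp add: 1 2)
qed

text \<open>Hence the prescribed functor from relative monads to monoids keeps the transposed
  operator \<open>\<delta>\<close> and changes only the way in which it is coded.\<close>

lemma rmnd_mult_eq:
  assumes t: "t \<in> T" "\<delta> \<in> ext_ops t"
  shows "rmnd_mult X j t (hglob X t t \<delta>) = mult t \<delta>"
proof -
  note d = ext_opsD[OF t(2)]
  let ?d = "hglob X t t \<delta>" and ?p = "hm X i t"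
  have D: "?d \<in> Cell X" "cdom X ?d = [hm X j t]" "ccod X ?d = hm X t t" "cleft X ?d = tid X a"
    "cright X ?d = tid X a" "vcomp X (hcell X t t) ?d = \<delta>"
    using t d by simp_all
  have s: "smile X i t t = hglob X i t (hcell X i t \<odot> hcell X t t)"
    using t by (simp add: smile_eq)
  have c1: "composable X (smile X i t t) i [cid X ?p, ?d] (tid X a)"
    using t D by (simp add: composable_def s)
  have ch: "ccomp X (hcell X i t) i [cid X ?p] = hcell X i t"
    using t vcomp_cid(2)[of "hcell X i t"] by (simp add: vcomp_def)
  have "ccomp X (hcell X i t \<odot> hcell X t t) i ([cid X ?p] @ [?d]) = hcell X i t \<odot> \<delta>"
    using t D ch by (subst ccomp_mul[where k = "tid X a" and l = "tid X a"]) (auto simp: composable_def vcomp_def)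
  then have 1: "ccomp X (smile X i t t) i [cid X ?p, ?d] = hglob X i t (hcell X i t \<odot> \<delta>)"
    using t ccomp_hglob[OF _ _ _ c1[unfolded s]] by (simp add: s hglob_def)
  have c2: "composable X (hglob X i t (hcell X i t \<odot> \<delta>)) i [cid X ?p, smj t] (tid X a)"
    using t d by (simp add: composable_def)
  have "ccomp X (hcell X i t \<odot> \<delta>) i ([cid X ?p] @ [smj t]) = hcell X i t \<odot> vcomp X \<delta> (smj t)"
    using t d ch by (subst ccomp_mul[where k = "tid X a" and l = "tid X a"]) (auto simp: composable_def vcomp_def)
  then show ?thesis
    using t d ccomp_hglob[OF _ _ _ c2] by (simp add: rmnd_mult_def Let_def 1 mult_def) (simp add: hglob_def)
qed

section \<open>The common category of transposed triples\<close>

lemma two_cells_N: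
  assumes "f \<in> T" "g \<in> T"
  shows "two_cells X f g = unnullary ` N f g"
proof (intro equalityI subsetI)
  fix \<phi> assume p: "\<phi> \<in> two_cells X f g"
  then have "nullary X f g \<phi> \<in> N f g"
    using nullary_simps[OF p assms] by (intro NI)
  then show "\<phi> \<in> unnullary ` N f g"
    using unnullary_nullary[OF p assms] by (metis imageI)
next
  fix \<phi> assume "\<phi> \<in> unnullary ` N f g"
  then show "\<phi> \<in> two_cells X f g"
    using unnullary_N(1) assms by auto
qed

lemma vcomp_unnullary_N: "\<alpha> \<in> N f g \<Longrightarrow> \<beta> \<in> N g h \<Longrightarrow> vcomp X (unnullary \<beta>) (unnullary \<alpha>) = unnullary (\<alpha> \<odot> \<beta>)"
  using ND[of \<alpha> f g] ND[of \<beta> g h] by (simp add: vcomp_unnullary)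

lemma cid_hm_eq: "f \<in> T \<Longrightarrow> cid X (hm X i f) = unnullary (idu f)"
  by simp

lemma idu_N [simp]: "f \<in> T \<Longrightarrow> idu f \<in> N f f"
  by (intro NI) simp_all

lemma category_hom_cat: "category (hom_cat X a e)"
  unfolding category_def hom_cat_def
proof (simp, intro conjI ballI)
  fix x assume x: "x \<in> T"
  then show "cid X (hm X i x) \<in> two_cells X x x"
    by (auto simp: two_cells_N cid_hm_eq simp del: unnullary_idu)
  fix y assume y: "y \<in> T"
  {
    fix z f g assume "z \<in> T" "f \<in> two_cells X x y" "g \<in> two_cells X y z"
    then show "vcomp X g f \<in> two_cells X x z"
      using x y by (auto simp: two_cells_N vcomp_unnullary_N intro: mul_N)
  }
  {
    fix f assume "f \<in> two_cells X x y"
    then obtain \<alpha> where "\<alpha> \<in> N x y" "f = unnullary \<alpha>"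
      using x y by (auto simp: two_cells_N)
    then show "vcomp X f (cid X (hm X i x)) = f" "vcomp X (cid X (hm X i y)) f = f"
      using x y unnullary_N[of \<alpha> x y] by simp_all
  }
  fix z w f g h assume "z \<in> T" "w \<in> T" "f \<in> two_cells X x y" "g \<in> two_cells X y z" "h \<in> two_cells X z w"
  then obtain \<alpha> \<beta> \<gamma> where "\<alpha> \<in> N x y" "f = unnullary \<alpha>" "\<beta> \<in> N y z" "g = unnullary \<beta>" "\<gamma> \<in> N z w" "h = unnullary \<gamma>"
    using x y by (auto simp: two_cells_N)
  then show "vcomp X h (vcomp X g f) = vcomp X (vcomp X h g) f"
    using ND[of \<alpha>] ND[of \<beta>] ND[of \<gamma>] by (simp add: vcomp_unnullary_N[OF _ mul_N] vcomp_unnullary_N[OF mul_N] vcomp_unnullary_N)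
qed

definition homs :: "'t \<times> 'c \<times> 'c \<Rightarrow> 't \<times> 'c \<times> 'c \<Rightarrow> 'c set" where
  "homs x y = unnullary ` kl_hom x y"

lemma kl_hom_idu:
  assumes "(t, \<delta>, \<epsilon>) \<in> kl_triples"
  shows "idu t \<in> kl_hom (t, \<delta>, \<epsilon>) (t, \<delta>, \<epsilon>)"
proof -
  have t: "t \<in> T" "\<delta> \<in> ext_ops t" "\<epsilon> \<in> N j t" using assms by (auto simp: kl_triples_def)
  show ?thesis
    using t ext_opsD[OF t(2)] ND[OF t(3)] by (simp add: kl_hom_def)
qed

text \<open>\<open>E(j,-)\<close> preserves composition, which is the fact \<open>gk\<close>. The
  law for \<open>\<theta>'\<close> is substituted along \<open>E(j,\<theta>)\<close> and then
  combined with the law for \<open>\<theta>\<close>.\<close>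

lemma kl_hom_mul:
  assumes "(t, \<delta>, \<epsilon>) \<in> kl_triples" "(t', \<delta>', \<epsilon>') \<in> kl_triples" "(t'', \<delta>'', \<epsilon>'') \<in> kl_triples"
    "\<theta> \<in> kl_hom (t, \<delta>, \<epsilon>) (t', \<delta>', \<epsilon>')" "\<theta>' \<in> kl_hom (t', \<delta>', \<epsilon>') (t'', \<delta>'', \<epsilon>'')"
  shows "\<theta> \<odot> \<theta>' \<in> kl_hom (t, \<delta>, \<epsilon>) (t'', \<delta>'', \<epsilon>'')"
proof -
  have t: "t \<in> T" "\<delta> \<in> ext_ops t" "\<epsilon> \<in> N j t" "t' \<in> T" "\<delta>' \<in> ext_ops t'" "\<epsilon>' \<in> N j t'" "t'' \<in> T" "\<delta>'' \<in> ext_ops t''" "\<epsilon>'' \<in> N j t''"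
    using assms(1-3) by (auto simp: kl_triples_def)
  have h: "\<theta> \<in> N t t'" "\<theta>' \<in> N t' t''" "\<epsilon> \<odot> \<theta> = \<epsilon>'" "\<epsilon>' \<odot> \<theta>' = \<epsilon>''"
    "\<delta> \<odot> \<theta> = \<theta> \<odot> vcomp X \<delta>' (hglob X j t' (hcell X j t \<odot> \<theta>))"
    "\<delta>' \<odot> \<theta>' = \<theta>' \<odot> vcomp X \<delta>'' (hglob X j t'' (hcell X j t' \<odot> \<theta>'))"
    using assms(4,5) by (auto simp: kl_hom_def)
  note n = ext_opsD[OF t(2)] ND[OF t(3)] ext_opsD[OF t(5)] ND[OF t(6)] ext_opsD[OF t(8)] ND[OF t(9)] ND[OF h(1)] ND[OF h(2)]
  let ?\<psi> = "hcell X j t \<odot> \<theta>"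
  let ?g = "hglob X j t' ?\<psi>" and ?k = "hglob X j t'' (hcell X j t' \<odot> \<theta>')"
  have ty: "?g \<in> Cell X" "cdom X ?g = [hm X j t]" "ccod X ?g = hm X j t'" "cleft X ?g = tid X a" "cright X ?g = tid X a"
    "?k \<in> Cell X" "cdom X ?k = [hm X j t']" "ccod X ?k = hm X j t''" "cleft X ?k = tid X a" "cright X ?k = tid X a"
    using t n by simp_all
  have gk: "vcomp X ?k ?g = hglob X j t'' (?\<psi> \<odot> \<theta>')"
    using t n ty by (simp add: vcomp_hglob[of "hcell X j t' \<odot> \<theta>'"] vcomp_mul_left) (simp add: hglob_def)
  have "vcomp X \<delta>' ?g \<odot> \<theta>' = vcomp X (\<delta>' \<odot> \<theta>') ?g"
    using t n ty by (simp add: vcomp_mul_left)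
  also have "\<dots> = \<theta>' \<odot> vcomp X (vcomp X \<delta>'' ?k) ?g"
    unfolding h(6) using t n ty by (simp add: vcomp_mul_right)
  also have "\<dots> = \<theta>' \<odot> vcomp X \<delta>'' (hglob X j t'' (?\<psi> \<odot> \<theta>'))"
    using t n ty gk vcomp_assoc[of \<delta>'' ?k ?g] by simp
  finally have e: "vcomp X \<delta>' ?g \<odot> \<theta>' = \<theta>' \<odot> vcomp X \<delta>'' (hglob X j t'' (?\<psi> \<odot> \<theta>'))" .
  have "\<delta> \<odot> \<theta> \<odot> \<theta>' = (\<delta> \<odot> \<theta>) \<odot> \<theta>'"
    using t n by (intro mul_assoc[symmetric]) auto
  also have "\<dots> = \<theta> \<odot> (vcomp X \<delta>' ?g \<odot> \<theta>')"
    unfolding h(5) using t n ty by (intro mul_assoc) auto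
  finally have "\<delta> \<odot> \<theta> \<odot> \<theta>' = (\<theta> \<odot> \<theta>') \<odot> vcomp X \<delta>'' (hglob X j t'' (hcell X j t \<odot> \<theta> \<odot> \<theta>'))"
    using e t n by simp
  moreover have "\<epsilon> \<odot> \<theta> \<odot> \<theta>' = (\<epsilon> \<odot> \<theta>) \<odot> \<theta>'"
    using t n by (intro mul_assoc[symmetric]) auto
  ultimately show ?thesis
    using h(3,4) mul_N[OF h(1,2)] by (simp add: kl_hom_def)
qed

lemma subcat_kl_triples: "subcat (hom_cat X a e) kl_triples homs"
proof -
  have 1: "fst x \<in> T \<and> cid X (companion X (fst x)) \<in> homs x x" if "x \<in> kl_triples" for x
  proof -
    obtain t \<delta> \<epsilon> where x: "x = (t, \<delta>, \<epsilon>)" by (cases x) auto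
    then have t: "t \<in> T" using that by (simp add: kl_triples_def)
    have "unnullary (idu t) \<in> homs x x"
      using kl_hom_idu that x by (auto simp: homs_def)
    then show ?thesis using t x by simp
  qed
  have N: "\<theta> \<in> N (fst x) (fst y)" if "\<theta> \<in> kl_hom x y" for \<theta> x y
    using that by (auto simp: kl_hom_def split: prod.splits)
  have 2: "homs x y \<subseteq> two_cells X (fst x) (fst y)" if "x \<in> kl_triples" "y \<in> kl_triples" for x y
  proof -
    have "fst x \<in> T" "fst y \<in> T" using 1 that by blast+
    then show ?thesis
      using N[of _ x y] two_cells_N unfolding homs_def by blast
  qed
  have 3: "vcomp X g f \<in> homs x z" if xyz: "x \<in> kl_triples" "y \<in> kl_triples" "z \<in> kl_triples" and fg: "f \<in> homs x y" "g \<in> homs y z" for x y z f g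
  proof -
    obtain \<theta> \<theta>' where th: "\<theta> \<in> kl_hom x y" "f = unnullary \<theta>" "\<theta>' \<in> kl_hom y z" "g = unnullary \<theta>'"
      using fg by (auto simp: homs_def)
    have "\<theta> \<odot> \<theta>' \<in> kl_hom x z"
      using kl_hom_mul[of "fst x" "fst (snd x)" "snd (snd x)" "fst y" "fst (snd y)" "snd (snd y)"
          "fst z" "fst (snd z)" "snd (snd z)" \<theta> \<theta>'] xyz th by simp
    then show ?thesis
      using vcomp_unnullary_N[OF N[OF th(1)] N[OF th(3)]] th by (auto simp: homs_def)
  qed
  show ?thesis
    unfolding subcat_def hom_cat_def by (simp del: comp_eq) (use 1 2 3 in blast)
qed

lemma kl_triplesD:
  assumes "(t, \<delta>, \<epsilon>) \<in> kl_triples" shows "t \<in> T" "\<delta> \<in> ext_ops t" "\<epsilon> \<in> N j t" "kl_axioms t \<delta> \<epsilon>"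
  using assms by (auto simp: kl_triples_def)

lemma homsD:
  assumes "f \<in> homs x y" "x \<in> kl_triples" "y \<in> kl_triples"
  shows "f \<in> Cell X" "cleft X f = i" "ccod X f = hm X i (fst y)" "cdom X f = [hm X i (fst x)]"
proof -
  have t: "fst x \<in> T" "fst y \<in> T" using assms(2,3) by (auto simp: kl_triples_def)
  have "f \<in> two_cells X (fst x) (fst y)"
    using assms subcat_kl_triples by (auto simp: subcat_def hom_cat_def)
  from two_cells_tights[OF this t] show "f \<in> Cell X" "cleft X f = i" "ccod X f = hm X i (fst y)" "cdom X f = [hm X i (fst x)]"
    by simp_all
qed

text \<open>The three kinds of structure differ only in the coding \<open>c t \<delta>\<close> of
  the operator. It therefore suffices that this coding is injective, reaches every structure, and
  matches axioms with axioms and homomorphisms with homomorphisms.\<close>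

lemma displays_kl_triplesI:
  assumes mem: "\<And>t \<delta> \<epsilon>. \<lbrakk>t \<in> T; \<delta> \<in> ext_ops t; \<epsilon> \<in> N j t\<rbrakk> \<Longrightarrow> (t, c t \<delta>, unnullary \<epsilon>) \<in> ob K \<longleftrightarrow> kl_axioms t \<delta> \<epsilon>"
    and obD: "\<And>t m u. (t, m, u) \<in> ob K \<Longrightarrow> t \<in> T \<and> u \<in> two_cells X j t \<and> (\<exists>\<delta> \<in> ext_ops t. m = c t \<delta>)"
    and inj: "\<And>t \<delta> \<delta>'. \<lbrakk>t \<in> T; \<delta> \<in> ext_ops t; \<delta>' \<in> ext_ops t; c t \<delta> = c t \<delta>'\<rbrakk> \<Longrightarrow> \<delta> = \<delta>'"
    and homD: "\<And>\<tau> t m u t' m' u'. \<tau> \<in> hom K (t, m, u) (t', m', u') \<Longrightarrow> \<tau> \<in> two_cells X t t'"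
    and hom: "\<And>t \<delta> \<epsilon> t' \<delta>' \<epsilon>' \<theta>. \<lbrakk>t \<in> T; \<delta> \<in> ext_ops t; \<epsilon> \<in> N j t; t' \<in> T; \<delta>' \<in> ext_ops t'; \<epsilon>' \<in> N j t'; \<theta> \<in> N t t'\<rbrakk> \<Longrightarrow>
      unnullary \<theta> \<in> hom K (t, c t \<delta>, unnullary \<epsilon>) (t', c t' \<delta>', unnullary \<epsilon>') \<longleftrightarrow> \<theta> \<in> kl_hom (t, \<delta>, \<epsilon>) (t', \<delta>', \<epsilon>')"
    and idt: "\<And>t m u. idt K (t, m, u) = cid X (companion X t)"
    and cmp: "\<And>f g. \<lbrakk>f \<in> Cell X; cleft X f = i\<rbrakk> \<Longrightarrow> cmp K g f = vcomp X g f"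
  shows "displays (hom_cat X a e) kl_triples homs K (\<lambda>(t, \<delta>, \<epsilon>). (t, c t \<delta>, unnullary \<epsilon>))"
    (is "displays _ _ _ _ ?G")
proof -
  have "inj_on ?G kl_triples"
  proof (rule inj_onI)
    fix x y assume "x \<in> kl_triples" "y \<in> kl_triples" "?G x = ?G y"
    then show "x = y"
      by (cases x; cases y) (auto simp: kl_triples_def intro: inj unnullary_inj[THEN iffD1])
  qed
  moreover have "?G ` kl_triples = ob K"
  proof (intro equalityI subsetI)
    fix y assume "y \<in> ?G ` kl_triples"
    then show "y \<in> ob K"
      using mem by (auto simp: kl_triples_def)
  next
    fix y assume y: "y \<in> ob K"
    obtain t m u where e: "y = (t, m, u)" by (cases y) auto
    have t: "t \<in> T" using obD y e by blast
    obtain \<delta> \<epsilon> where d: "\<delta> \<in> ext_ops t" "m = c t \<delta>" "\<epsilon> \<in> N j t" "u = unnullary \<epsilon>"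
      using obD[of t m u] y e two_cells_N[OF j_tights t] by auto
    then have "(t, \<delta>, \<epsilon>) \<in> kl_triples"
      using mem[OF t d(1,3)] y e t by (simp add: kl_triples_def)
    then show "y \<in> ?G ` kl_triples"
      using e d by force
  qed
  ultimately have bij: "bij_betw ?G kl_triples (ob K)"
    by (simp add: bij_betw_def)
  have homs: "hom K (?G x) (?G y) = homs x y" if "x \<in> kl_triples" "y \<in> kl_triples" for x y
  proof -
    obtain t \<delta> \<epsilon> t' \<delta>' \<epsilon>' where e: "x = (t, \<delta>, \<epsilon>)" "y = (t', \<delta>', \<epsilon>')" by (cases x, cases y) auto
    note t = kl_triplesD[OF that(1)[unfolded e]] kl_triplesD[OF that(2)[unfolded e]]
    have N: "\<theta> \<in> kl_hom x y \<Longrightarrow> \<theta> \<in> N t t'" for \<theta>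
      by (simp add: kl_hom_def e)
    show ?thesis
      using hom[OF t(1-3,5-7)] homD[of _ t _ _ t'] two_cells_N[OF t(1,5)] N
      unfolding homs_def e by (auto 4 3)
  qed
  have "cmp K g f = vcomp X g f" if "x \<in> kl_triples" "y \<in> kl_triples" "f \<in> homs x y" for x y f g
    using homsD[OF that(3,1,2)] by (simp add: cmp)
  then show ?thesis
    unfolding displays_def using bij homs by (auto simp: idt hom_cat_def)
qed

lemma displays_multi:
  "displays (hom_cat X a e) kl_triples homs (Mon_multi X j) (\<lambda>(t, \<delta>, \<epsilon>). (t, mult t \<delta>, unnullary \<epsilon>))"
proof (rule displays_kl_triplesI)
  fix t m u assume "(t, m, u) \<in> ob (Mon_multi X j)"
  then have "t \<in> T" "m \<in> multimor X j [Some t, Some t] t" "u \<in> two_cells X j t"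
    by (auto simp: Mon_multi_def multi_monoids_def multimor_def mdom_def entry_def two_cells_def)
  then show "t \<in> T \<and> u \<in> two_cells X j t \<and> (\<exists>\<delta> \<in> ext_ops t. m = mult t \<delta>)"
    using mult_surj by simp
qed (simp_all add: mult_inj multi_hom_iff multi_monoids_iff, simp_all add: Mon_multi_def multi_monoids_iff
  multimor_def mdom_def entry_def two_cells_def mcomp_def vcomp_def)

lemma displays_rmnd:
  "displays (hom_cat X a e) kl_triples homs (RMnd X j) (\<lambda>(t, \<delta>, \<epsilon>). (t, hglob X t t \<delta>, unnullary \<epsilon>))"
proof (rule displays_kl_triplesI)
  fix t m u assume "(t, m, u) \<in> ob (RMnd X j)"
  then have "t \<in> T" "m \<in> glob X [hm X j t] (hm X t t)" "u \<in> two_cells X j t"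
    by (auto simp: RMnd_def rel_monads_def)
  then show "t \<in> T \<and> u \<in> two_cells X j t \<and> (\<exists>\<delta> \<in> ext_ops t. m = hglob X t t \<delta>)"
    using ext_op_surj by simp
next
  fix t \<delta> \<delta>' assume "\<delta> \<in> ext_ops t" "\<delta>' \<in> ext_ops t" "hglob X t t \<delta> = hglob X t t \<delta>'"
  then show "\<delta> = \<delta>'"
    by (simp add: ext_ops_def hglob_inj)
qed (simp_all add: rmnd_hom_iff, simp_all add: RMnd_def rel_monads_iff)

lemma rmnd_iso_multi:
  "iso_over (hom_cat X a e) (RMnd X j) forget (Mon_multi X j) forget (rmnd_to_mon X j)"
  by (rule displays_iso_over[OF category_hom_cat subcat_kl_triples displays_rmnd displays_multi])
    (auto simp: rmnd_to_mon_def rmnd_mult_eq kl_triples_def)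

end

section \<open>The left-skew-monoidal structure\<close>

text \<open>\<open>L\<close> is an arbitrary choice of left extensions. Its functoriality is not
  assumed but derived from the universal property.\<close>

locale skew_ext = tight_root X j a e for X :: "('o, 't, 'l, 'c, 'm) vequip_scheme" and j a e +
  fixes L :: "'t \<Rightarrow> 't" and \<pi> :: "'t \<Rightarrow> 'c"
  assumes exts: "f \<in> tights X a e \<Longrightarrow> left_extension X j f (L f) (\<pi> f)"
begin

declare comp_eq [simp del]

lemma left_ext_T: "f \<in> T \<Longrightarrow> left_ext X j f (L f) (\<pi> f)"
  using exts by (simp add: left_ext_def left_ext_axioms_def virtual_equipment_axioms)

lemma L_simps [simp]:
  assumes "f \<in> T" shows "L f \<in> Tight X" "tdom X (L f) = e" "tcod X (L f) = e"
proof -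
  have "L f \<in> tights X (tcod X j) (tcod X f)"
    using exts[OF assms] unfolding left_extension_def by blast
  from tightsD[OF this] show "L f \<in> Tight X" "tdom X (L f) = e" "tcod X (L f) = e"
    using assms by simp_all
qed

abbreviation tensor :: "'t \<Rightarrow> 't \<Rightarrow> 't" (infixl "\<otimes>" 80) where
  "x \<otimes> y \<equiv> tcomp X (L x) y"

lemma tensor_T [simp]: "f \<in> T \<Longrightarrow> g \<in> T \<Longrightarrow> f \<otimes> g \<in> T"
  by (rule tightsI) simp_all

definition eta :: "'t \<Rightarrow> 'c" where "eta f = left_ext.\<eta> X j f (L f) (\<pi> f)"

lemma eta_simps [simp]:
  assumes "f \<in> T"
  shows "idcell (eta f)" "cdom X (eta f) = []" "cleft X (eta f) = f" "cright X (eta f) = f \<otimes> j"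
  using left_ext.\<eta>_simps[OF left_ext_T[OF assms]] by (simp_all add: eta_def)

text \<open>Generalises \<open>ext\<close> from \<open>hcell X j s\<close> to every
  \<open>\<psi>\<close> with left tight-cell \<open>j\<close>. At \<open>hcell X j s\<close> it is
  the universal 2-cell, by \<open>ext_eq\<close>, and at \<open>idu j\<close> it is the unit, by
  \<open>lext_idu\<close>.\<close>

definition lext :: "'t \<Rightarrow> 'c \<Rightarrow> 'c" where "lext f \<psi> = eta f \<odot> (L f \<star> \<psi>)"

lemma lext_simps [simp]:
  assumes "f \<in> T" "idcell \<psi>" "cleft X \<psi> = j"
  shows "idcell (lext f \<psi>)" "cdom X (lext f \<psi>) = cdom X \<psi>" "cleft X (lext f \<psi>) = f"
    "cright X (lext f \<psi>) = f \<otimes> (cright X \<psi>)"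
  using assms by (simp_all add: lext_def)

lemma lext_mul:
  assumes "f \<in> T" "idcell \<psi>" "cleft X \<psi> = j" "idcell \<chi>" "cleft X \<chi> = cright X \<psi>"
  shows "lext f \<psi> \<odot> (L f \<star> \<chi>) = lext f (\<psi> \<odot> \<chi>)"
  using assms idcell_simps[OF assms(2)] by (simp add: lext_def)

lemma lext_idu: "f \<in> T \<Longrightarrow> lext f (idu j) = eta f"
  by (simp add: lext_def)

lemma ext_eq: "f \<in> T \<Longrightarrow> left_ext.ext X j f (L f) (\<pi> f) s = lext f (hcell X j s)"
  by (simp add: lext_def eta_def left_ext.ext_def[OF left_ext_T])

lemma lext_cancel:
  assumes "f \<in> T" "s \<in> Tight X" "tcod X s = e" "idcell \<alpha>" "idcell \<beta>" "cleft X \<alpha> = f \<otimes> s"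
    "cleft X \<beta> = f \<otimes> s" "cright X \<alpha> = cright X \<beta>" "cdom X \<alpha> = cdom X \<beta>"
    "lext f (hcell X j s) \<odot> \<alpha> = lext f (hcell X j s) \<odot> \<beta>"
  shows "\<alpha> = \<beta>"
  using left_ext.ext_cancel[OF left_ext_T[OF assms(1)], of s \<alpha> \<beta>] assms by (simp add: ext_eq)

lemma lext_surj:
  assumes "f \<in> T" "s \<in> Tight X" "tcod X s = e" "idcell \<phi>" "cdom X \<phi> = [hm X j s]" "cleft X \<phi> = f"
  shows "\<exists>\<alpha>. \<alpha> \<in> N (f \<otimes> s) (cright X \<phi>) \<and> lext f (hcell X j s) \<odot> \<alpha> = \<phi>"
  using left_ext.ext_surj[OF left_ext_T[OF assms(1)], of s \<phi>] assms by (auto simp add: ext_eq N_def)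

lemma vcomp_lext:
  assumes "f \<in> T" "s \<in> Tight X" "tcod X s = e" "idcell \<psi>" "cleft X \<psi> = j" "cright X \<psi> = s"
  shows "vcomp X (lext f (hcell X j s)) (hglob X j s \<psi>) = lext f \<psi>"
  unfolding lext_def using assms by (subst vcomp_mul_right) auto

text \<open>If \<open>\<alpha>\<close> represents an operator along the universal 2-cell, this
  evaluates the operator on a 2-cell into \<open>E(j,s)\<close>. It is the bridge between operators
  and tensor products.\<close>

lemma vcomp_lext_mul:
  assumes "f \<in> T" "s \<in> Tight X" "tcod X s = e" "idcell \<psi>" "cleft X \<psi> = j" "cright X \<psi> = s"
    "\<alpha> \<in> N (f \<otimes> s) g"
  shows "vcomp X (lext f (hcell X j s) \<odot> \<alpha>) (hglob X j s \<psi>) = lext f \<psi> \<odot> \<alpha>"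
  using assms ND[OF assms(7)] vcomp_lext[OF assms(1-6)] by (subst vcomp_mul_left) auto

text \<open>\<open>sharp f g \<alpha>\<close> is the 2-cell \<open>L f \<Rightarrow> g\<close> induced by \<open>\<alpha>: f \<Rightarrow> g j\<close>.\<close>

definition sharp :: "'t \<Rightarrow> 't \<Rightarrow> 'c \<Rightarrow> 'c" where
  "sharp f g \<alpha> = (SOME \<beta>. \<beta> \<in> N (L f) g \<and> lext f (hcell X j i) \<odot> \<beta> = \<alpha> \<odot> (g \<star> hcell X j i))"

lemma sharp:
  assumes "f \<in> T" "g \<in> tights X e e" "\<alpha> \<in> N f (tcomp X g j)"
  shows "sharp f g \<alpha> \<in> N (L f) g"
    "lext f (hcell X j i) \<odot> sharp f g \<alpha> = \<alpha> \<odot> (g \<star> hcell X j i)"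
proof -
  have g: "g \<in> Tight X" "tdom X g = e" "tcod X g = e"
    using tightsD[OF assms(2)] by auto
  have "\<exists>\<beta>. \<beta> \<in> N (f \<otimes> i) (cright X (\<alpha> \<odot> (g \<star> hcell X j i)))
      \<and> lext f (hcell X j i) \<odot> \<beta> = \<alpha> \<odot> (g \<star> hcell X j i)"
    using assms g ND[OF assms(3)] by (intro lext_surj) auto
  then have "\<exists>\<beta>. \<beta> \<in> N (L f) g \<and> lext f (hcell X j i) \<odot> \<beta> = \<alpha> \<odot> (g \<star> hcell X j i)"
    using assms g ND[OF assms(3)] by simp
  from someI_ex[OF this] show "sharp f g \<alpha> \<in> N (L f) g"
    "lext f (hcell X j i) \<odot> sharp f g \<alpha> = \<alpha> \<odot> (g \<star> hcell X j i)"
    by (simp_all add: sharp_def)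
qed

text \<open>The specification of \<open>sharp\<close> concerns \<open>E(j,1)\<close>. Any
  \<open>\<psi>\<close> factors through \<open>E(j,1)\<close> with right tight-cell
  \<open>s\<close>, and substituting that factor gives the equation at \<open>\<psi>\<close>, with
  \<open>sharp f g \<alpha>\<close> precomposed with \<open>s\<close>.\<close>

lemma lext_sharp:
  assumes "f \<in> T" "g \<in> tights X e e" "\<alpha> \<in> N f (tcomp X g j)"
    "s \<in> Tight X" "tcod X s = e" "idcell \<psi>" "cleft X \<psi> = j" "cright X \<psi> = s"
  shows "lext f \<psi> \<odot> ccomp X (sharp f g \<alpha>) s [] = \<alpha> \<odot> (g \<star> \<psi>)"
proof -
  have g: "g \<in> Tight X" "tdom X g = e" "tcod X g = e"
    using tightsD[OF assms(2)] by auto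
  note s = sharp[OF assms(1-3)] ND[OF sharp(1)[OF assms(1-3)]] ND[OF assms(3)]
  let ?k = "hlift X j i (tid X a) s \<psi>"
  have "vcomp X (lext f (hcell X j i) \<odot> sharp f g \<alpha>) ?k = lext f \<psi> \<odot> ccomp X (sharp f g \<alpha>) s []"
    using assms g s by (subst vcomp_mul_left) (auto simp: lext_def vcomp_mul_right)
  moreover have "vcomp X (\<alpha> \<odot> (g \<star> hcell X j i)) ?k = \<alpha> \<odot> (g \<star> \<psi>)"
    using assms g s by (subst vcomp_mul_right) auto
  ultimately show ?thesis
    using s by simp
qed

text \<open>The structure of the skew-monoidal category, on 2-cells \<open>() \<Rightarrow> E(f,g)\<close> instead of
  \<open>E(1,f) \<Rightarrow> E(1,g)\<close>.\<close>

definition Lmap :: "'c \<Rightarrow> 'c" where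
  "Lmap \<phi> = sharp (cleft X \<phi>) (L (cright X \<phi>)) (\<phi> \<odot> eta (cright X \<phi>))"

definition ten :: "'c \<Rightarrow> 'c \<Rightarrow> 'c" where
  "ten \<phi> \<psi> = ccomp X (Lmap \<phi>) (cleft X \<psi>) [] \<odot> (L (cright X \<phi>) \<star> \<psi>)"

definition nlun :: "'t \<Rightarrow> 'c" where
  "nlun x = ccomp X (sharp j i (idu j)) x []"

text \<open>The associator arises from a 2-cell between tight-cells
  \<open>E \<rightarrow> E\<close>, precomposed with \<open>z\<close> afterwards. Here
  \<open>x \<otimes> (L y)\<close> abbreviates the composite of \<open>L x\<close> and
  \<open>L y\<close>, although \<open>L y\<close> is not an object of the skew-monoidal
  category.\<close>

definition nasc0 :: "'t \<Rightarrow> 't \<Rightarrow> 'c" where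
  "nasc0 x y = sharp (x \<otimes> y) (x \<otimes> (L y)) (L x \<star> eta y)"

definition nasc :: "'t \<Rightarrow> 't \<Rightarrow> 't \<Rightarrow> 'c" where
  "nasc x y z = ccomp X (nasc0 x y) z []"

lemma L_tights [simp]: "x \<in> T \<Longrightarrow> L x \<in> tights X e e" "x \<in> T \<Longrightarrow> y \<in> T \<Longrightarrow> x \<otimes> (L y) \<in> tights X e e"
  "i \<in> tights X e e"
  by (auto intro!: tightsI)

lemma Lmap_N:
  assumes "x \<in> T" "x' \<in> T" "\<phi> \<in> N x x'"
  shows "Lmap \<phi> \<in> N (L x) (L x')"
proof -
  have "\<phi> \<odot> eta x' \<in> N x (x' \<otimes> j)"
    using assms ND[OF assms(3)] by (intro NI) auto
  then show ?thesis
    using assms ND[OF assms(3)] sharp(1)[of x "L x'"] by (simp add: Lmap_def)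
qed

lemmas Lmap = Lmap_N ND[OF Lmap_N]

lemma lext_Lmap:
  assumes "x \<in> T" "x' \<in> T" "\<phi> \<in> N x x'" "s \<in> Tight X" "tcod X s = e" "idcell \<psi>" "cleft X \<psi> = j"
    "cright X \<psi> = s"
  shows "lext x \<psi> \<odot> ccomp X (Lmap \<phi>) s [] = \<phi> \<odot> lext x' \<psi>"
proof -
  have "\<phi> \<odot> eta x' \<in> N x (x' \<otimes> j)"
    using assms ND[OF assms(3)] by (intro NI) auto
  then show ?thesis
    using assms ND[OF assms(3)] lext_sharp[of x "L x'" "\<phi> \<odot> eta x'" s \<psi>]
    by (simp add: Lmap_def) (simp add: lext_def)
qed

lemma ten_N:
  assumes "x \<in> T" "x' \<in> T" "\<phi> \<in> N x x'" "y \<in> T" "y' \<in> T" "\<psi> \<in> N y y'"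
  shows "ten \<phi> \<psi> \<in> N (x \<otimes> y) (x' \<otimes> y')"
  using assms ND[OF assms(3)] ND[OF assms(6)] Lmap[OF assms(1-3)] by (intro NI) (auto simp: ten_def)

lemmas ten = ten_N ND[OF ten_N]

text \<open>By \<open>lext_cancel\<close> the case where \<open>\<xi>\<close> is
  \<open>hcell X j y\<close> already determines \<open>ten \<phi> \<psi>\<close>. Most laws of the
  tensor product are checked through this equation.\<close>

lemma lext_ten:
  assumes "x \<in> T" "x' \<in> T" "\<phi> \<in> N x x'" "y \<in> T" "y' \<in> T" "\<psi> \<in> N y y'"
    "idcell \<xi>" "cleft X \<xi> = j" "cright X \<xi> = y"
  shows "lext x \<xi> \<odot> ten \<phi> \<psi> = \<phi> \<odot> lext x' (\<xi> \<odot> \<psi>)"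
proof -
  note n = ND[OF assms(3)] ND[OF assms(6)] Lmap[OF assms(1-3)]
  have "lext x \<xi> \<odot> ten \<phi> \<psi> = (lext x \<xi> \<odot> ccomp X (Lmap \<phi>) y []) \<odot> (L x' \<star> \<psi>)"
    using assms n by (simp add: ten_def)
  also have "\<dots> = (\<phi> \<odot> lext x' \<xi>) \<odot> (L x' \<star> \<psi>)"
    using assms n by (simp add: lext_Lmap)
  also have "\<dots> = \<phi> \<odot> (lext x' \<xi> \<odot> (L x' \<star> \<psi>))"
    using assms n by (intro mul_assoc) auto
  finally show ?thesis
    using assms n by (simp add: lext_mul)
qed

lemma nlun_sharp:
  "sharp j i (idu j) \<in> N (L j) i"
  by (intro sharp NI) auto

lemma nlun_N:
  assumes "x \<in> T"
  shows "nlun x \<in> N (j \<otimes> x) x"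
  using assms ND[OF nlun_sharp] by (intro NI) (auto simp: nlun_def)

lemmas nlun = nlun_N ND[OF nlun_N]

lemma lext_nlun:
  assumes "x \<in> T" "idcell \<psi>" "cleft X \<psi> = j" "cright X \<psi> = x"
  shows "lext j \<psi> \<odot> nlun x = \<psi>"
  using lext_sharp[of j i "idu j" x \<psi>] assms by (simp add: nlun_def N_def)

lemma nasc0_N:
  assumes "x \<in> T" "y \<in> T"
  shows "nasc0 x y \<in> N (L (x \<otimes> y)) (x \<otimes> (L y))"
    unfolding nasc0_def using assms by (intro sharp NI) auto

lemmas nasc0 = nasc0_N ND[OF nasc0_N]

lemma nasc_N:
  assumes "x \<in> T" "y \<in> T" "z \<in> T"
  shows "nasc x y z \<in> N ((x \<otimes> y) \<otimes> z) (x \<otimes> (y \<otimes> z))"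
  using assms nasc0[OF assms(1,2)] by (intro NI) (auto simp: nasc_def)

lemmas nasc = nasc_N ND[OF nasc_N]

lemma lext_nasc0:
  assumes "x \<in> T" "y \<in> T" "s \<in> Tight X" "tcod X s = e" "idcell \<psi>" "cleft X \<psi> = j" "cright X \<psi> = s"
  shows "lext (x \<otimes> y) \<psi> \<odot> ccomp X (nasc0 x y) s [] = L x \<star> lext y \<psi>"
proof -
  have "L x \<star> eta y \<in> N (x \<otimes> y) (tcomp X (x \<otimes> (L y)) j)"
    using assms by (intro NI) auto
  from lext_sharp[OF _ _ this, of s \<psi>] show ?thesis
    using assms by (simp add: nasc0_def) (simp add: lext_def)
qed

lemma lext_nasc:
  assumes "x \<in> T" "y \<in> T" "z \<in> T" "idcell \<psi>" "cleft X \<psi> = j" "cright X \<psi> = z"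
  shows "lext (x \<otimes> y) \<psi> \<odot> nasc x y z = L x \<star> lext y \<psi>"
  using assms by (simp add: nasc_def lext_nasc0)

lemma eta_N [simp]: "x \<in> T \<Longrightarrow> eta x \<in> N x (x \<otimes> j)"
  by (intro NI) auto

section \<open>Functoriality of the tensor product and the coherence axioms\<close>

lemma ten_idu:
  assumes "x \<in> T" "y \<in> T"
  shows "ten (idu x) (idu y) = idu (x \<otimes> y)"
proof -
  note n = ten[OF assms(1,1) idu_N assms(2,2) idu_N, OF assms]
  have "lext x (hcell X j y) \<odot> ten (idu x) (idu y) = lext x (hcell X j y)"
    using assms by (simp add: lext_ten)
  then show ?thesis
    by - (rule lext_cancel[of x y], use assms n in auto)
qed

lemma ten_mul:
  assumes "x \<in> T" "x' \<in> T" "x'' \<in> T" "y \<in> T" "y' \<in> T" "y'' \<in> T"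
    "\<phi> \<in> N x x'" "\<phi>' \<in> N x' x''" "\<psi> \<in> N y y'" "\<psi>' \<in> N y' y''"
  shows "ten (\<phi> \<odot> \<phi>') (\<psi> \<odot> \<psi>') = ten \<phi> \<psi> \<odot> ten \<phi>' \<psi>'"
proof -
  note n = ND[OF assms(7)] ND[OF assms(8)] ND[OF assms(9)] ND[OF assms(10)]
    mul_N[OF assms(7,8)] mul_N[OF assms(9,10)]
    ten[OF assms(1,2,7,4,5,9)] ten[OF assms(2,3,8,5,6,10)]
  note n' = ten[OF assms(1,3) mul_N[OF assms(7,8)] assms(4,6) mul_N[OF assms(9,10)]]
  let ?h = "hcell X j y"
  have "lext x ?h \<odot> (ten \<phi> \<psi> \<odot> ten \<phi>' \<psi>') = (lext x ?h \<odot> ten \<phi> \<psi>) \<odot> ten \<phi>' \<psi>'"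
    using assms n by (intro mul_assoc[symmetric]) auto
  also have "\<dots> = (\<phi> \<odot> lext x' (?h \<odot> \<psi>)) \<odot> ten \<phi>' \<psi>'"
    using assms n by (simp add: lext_ten)
  also have "\<dots> = \<phi> \<odot> (lext x' (?h \<odot> \<psi>) \<odot> ten \<phi>' \<psi>')"
    using assms n by (intro mul_assoc) auto
  also have "\<dots> = \<phi> \<odot> \<phi>' \<odot> lext x'' ((?h \<odot> \<psi>) \<odot> \<psi>')"
    using assms n by (subst lext_ten[of x' x'' \<phi>' y' y'' \<psi>']) auto
  also have "\<dots> = lext x ?h \<odot> ten (\<phi> \<odot> \<phi>') (\<psi> \<odot> \<psi>')"
    using assms n by (subst lext_ten[of x x'' "\<phi> \<odot> \<phi>'" y y'']) auto
  finally show ?thesis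
    by - (rule lext_cancel[of x y], use assms n n' in auto)
qed

lemma ten_idu_left:
  assumes "x \<in> T" "y \<in> T" "y' \<in> T" "\<psi> \<in> N y y'"
  shows "ten (idu x) \<psi> = L x \<star> \<psi>"
proof -
  note n = ND[OF assms(4)] ten[OF assms(1,1) idu_N assms(2,3,4), OF assms(1)]
  have "lext x (hcell X j y) \<odot> ten (idu x) \<psi> = lext x (hcell X j y) \<odot> (L x \<star> \<psi>)"
    using assms n by (simp add: lext_ten lext_mul)
  then show ?thesis
    by - (rule lext_cancel[of x y], use assms n in auto)
qed

text \<open>After the universal 2-cell both sides reduce to \<open>?R\<close>. On the second side
  \<open>Lmap \<phi>\<close> has to move past \<open>L x \<star> lext y ?h\<close>, and this is
  where interchange enters.\<close>

lemma nasc_natural: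
  assumes "x \<in> T" "x' \<in> T" "y \<in> T" "y' \<in> T" "z \<in> T" "z' \<in> T"
    "\<phi> \<in> N x x'" "\<psi> \<in> N y y'" "\<chi> \<in> N z z'"
  shows "ten (ten \<phi> \<psi>) \<chi> \<odot> nasc x' y' z' = nasc x y z \<odot> ten \<phi> (ten \<psi> \<chi>)"
proof -
  note n = ND[OF assms(7)] ND[OF assms(8)] ND[OF assms(9)] ten[OF assms(1,2,7,3,4,8)]
    ten[OF assms(3,4,8,5,6,9)] Lmap[OF assms(1,2,7)] nasc[OF assms(1,3,5)] nasc[OF assms(2,4,6)]
  have t: "x \<otimes> y \<in> T" "x' \<otimes> y' \<in> T" "y \<otimes> z \<in> T" "y' \<otimes> z' \<in> T"
    using assms by simp_all
  note n' = ten[OF t(1,2) n(13) assms(5,6,9)] ten[OF assms(1,2,7) t(3,4) n(18)]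
  let ?h = "hcell X j z"
  let ?R = "ten \<phi> \<psi> \<odot> (L x' \<star> lext y' (?h \<odot> \<chi>))"
  have "lext (x \<otimes> y) ?h \<odot> (ten (ten \<phi> \<psi>) \<chi> \<odot> nasc x' y' z') =
      (lext (x \<otimes> y) ?h \<odot> ten (ten \<phi> \<psi>) \<chi>) \<odot> nasc x' y' z'"
    using assms n n' t by (intro mul_assoc[symmetric]) auto
  also have "\<dots> = (ten \<phi> \<psi> \<odot> lext (x' \<otimes> y') (?h \<odot> \<chi>)) \<odot> nasc x' y' z'"
    using assms n n' t by (subst lext_ten[OF t(1,2) n(13) assms(5,6,9)]) auto
  also have "\<dots> = ten \<phi> \<psi> \<odot> (lext (x' \<otimes> y') (?h \<odot> \<chi>) \<odot> nasc x' y' z')"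
    using assms n n' t by (intro mul_assoc) auto
  also have "\<dots> = ?R"
    using assms n by (subst lext_nasc) auto
  finally have 1: "lext (x \<otimes> y) ?h \<odot> (ten (ten \<phi> \<psi>) \<chi> \<odot> nasc x' y' z') = ?R" .
  have "lext (x \<otimes> y) ?h \<odot> (nasc x y z \<odot> ten \<phi> (ten \<psi> \<chi>)) =
     (lext (x \<otimes> y) ?h \<odot> nasc x y z) \<odot> ten \<phi> (ten \<psi> \<chi>)"
    using assms n n' t by (intro mul_assoc[symmetric]) auto
  also have "\<dots> = (L x \<star> lext y ?h) \<odot> ten \<phi> (ten \<psi> \<chi>)"
    using assms n by (subst lext_nasc) auto
  also have "\<dots> = (L x \<star> lext y ?h) \<odot> ccomp X (Lmap \<phi>) (y \<otimes> z) [] \<odot> (L x' \<star> ten \<psi> \<chi>)"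
    using n by (simp add: ten_def[of \<phi> "ten \<psi> \<chi>"])
  also have "\<dots> = ((L x \<star> lext y ?h) \<odot> ccomp X (Lmap \<phi>) (y \<otimes> z) []) \<odot> (L x' \<star> ten \<psi> \<chi>)"
    using assms n n' t by (intro mul_assoc[symmetric]) auto
  also have "\<dots> = (ccomp X (Lmap \<phi>) y [] \<odot> (L x' \<star> lext y ?h)) \<odot> (L x' \<star> ten \<psi> \<chi>)"
    using assms n interchange[of "Lmap \<phi>" "lext y ?h"] by simp
  also have "\<dots> = ccomp X (Lmap \<phi>) y [] \<odot> (L x' \<star> (lext y ?h \<odot> ten \<psi> \<chi>))"
    using assms n by simp
  also have "\<dots> = ccomp X (Lmap \<phi>) y [] \<odot> (L x' \<star> (\<psi> \<odot> lext y' (?h \<odot> \<chi>)))"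
    using assms n by (subst lext_ten[of y y' \<psi> z z' \<chi>]) auto
  also have "\<dots> = ?R"
    using assms n by (simp add: ten_def[of \<phi> \<psi>])
  finally show ?thesis
    using 1 by - (rule lext_cancel[OF t(1), of z], use assms n n' t in auto)
qed

lemma nlun_natural:
  assumes "x \<in> T" "x' \<in> T" "\<phi> \<in> N x x'"
  shows "ten (idu j) \<phi> \<odot> nlun x' = nlun x \<odot> \<phi>"
proof -
  note n = ND[OF assms(3)] nlun[OF assms(1)] nlun[OF assms(2)] ten[OF j_tights j_tights idu_N assms, OF j_tights]
  let ?h = "hcell X j x"
  have "lext j ?h \<odot> (ten (idu j) \<phi> \<odot> nlun x') = (lext j ?h \<odot> ten (idu j) \<phi>) \<odot> nlun x'"
    using assms n by (intro mul_assoc[symmetric]) auto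
  also have "\<dots> = lext j (?h \<odot> \<phi>) \<odot> nlun x'"
    using assms n by (subst lext_ten[OF j_tights j_tights idu_N assms]) auto
  also have "\<dots> = (lext j ?h \<odot> nlun x) \<odot> \<phi>"
    using assms n by (simp add: lext_nlun)
  also have "\<dots> = lext j ?h \<odot> nlun x \<odot> \<phi>"
    using assms n by (intro mul_assoc) auto
  finally show ?thesis
    by - (rule lext_cancel[of j x], use assms n in auto)
qed

lemma eta_natural:
  assumes "x \<in> T" "x' \<in> T" "\<phi> \<in> N x x'"
  shows "\<phi> \<odot> eta x' = eta x \<odot> ten \<phi> (idu j)"
  using lext_ten[OF assms j_tights j_tights idu_N[OF j_tights], of "idu j"] assms by (simp add: lext_idu)

text \<open>Naming the iterated tensor products keeps the typing facts of the associators atomic.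
  After the universal 2-cell both sides become \<open>nasc w x y\<close> followed by a doubly
  whiskered \<open>lext y ?h\<close>: on one side by interchange with \<open>nasc0 w x\<close>, on
  the other by \<open>lext_ten\<close> and \<open>lext_nasc\<close>.\<close>

lemma pentagon:
  assumes "w \<in> T" "x \<in> T" "y \<in> T" "z \<in> T"
  shows "nasc (w \<otimes> x) y z \<odot> nasc w x (y \<otimes> z) =
    ten (nasc w x y) (idu z) \<odot> nasc w (x \<otimes> y) z \<odot> ten (idu w) (nasc x y z)"
proof -
  define wx where "wx = w \<otimes> x"
  define xy where "xy = x \<otimes> y"
  define yz where "yz = y \<otimes> z"
  define wxy where "wxy = wx \<otimes> y"
  define wxy' where "wxy' = w \<otimes> xy"
  have t: "wx \<in> T" "xy \<in> T" "yz \<in> T" "wxy \<in> T" "wxy' \<in> T" "xy \<otimes> z \<in> T" "x \<otimes> yz \<in> T"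
    using assms by (simp_all add: wx_def xy_def yz_def wxy_def wxy'_def)
  have a1: "nasc w x y \<in> N wxy wxy'"
    using nasc(1)[OF assms(1-3)] assms by (simp add: wxy_def wxy'_def wx_def xy_def)
  have a2: "nasc x y z \<in> N (xy \<otimes> z) (x \<otimes> yz)"
    using nasc(1)[OF assms(2-4)] assms by (simp add: xy_def yz_def)
  have a3: "nasc wx y z \<in> N (wxy \<otimes> z) (wx \<otimes> yz)"
    using nasc(1)[OF t(1) assms(3,4)] by (simp add: wxy_def yz_def)
  have a4: "nasc w x yz \<in> N (wx \<otimes> yz) (w \<otimes> (x \<otimes> yz))"
    using nasc(1)[OF assms(1,2) t(3)] by (simp add: wx_def)
  have a5: "nasc w xy z \<in> N (wxy' \<otimes> z) (w \<otimes> (xy \<otimes> z))"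
    using nasc(1)[OF assms(1) t(2) assms(4)] by (simp add: wxy'_def)
  note T = ten[OF t(4,5) a1 assms(4,4) idu_N[OF assms(4)]] ten[OF assms(1,1) idu_N[OF assms(1)] t(6,7) a2]
  note n = ND[OF a1] ND[OF a2] ND[OF a3] ND[OF a4] ND[OF a5] T nasc0[OF assms(1,2)]
  let ?h = "hcell X j z"
  have "lext wxy ?h \<odot> (nasc wx y z \<odot> nasc w x yz) = (lext wxy ?h \<odot> nasc wx y z) \<odot> nasc w x yz"
    using assms t n by (intro mul_assoc[symmetric]) auto
  also have "\<dots> = (L wx \<star> lext y ?h) \<odot> nasc w x yz"
    using assms t lext_nasc[OF t(1) assms(3,4), of ?h] by (simp add: wxy_def)
  also have "\<dots> = nasc w x y \<odot> (L w \<star> L x \<star> lext y ?h)"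
    using assms t n(21-) interchange[of "nasc0 w x" "lext y ?h"] by (simp add: nasc_def wx_def yz_def)
  finally have 1: "lext wxy ?h \<odot> (nasc wx y z \<odot> nasc w x yz) = nasc w x y \<odot> (L w \<star> L x \<star> lext y ?h)" .
  have "lext wxy ?h \<odot> (ten (nasc w x y) (idu z) \<odot> (nasc w xy z \<odot> ten (idu w) (nasc x y z))) =
     (lext wxy ?h \<odot> ten (nasc w x y) (idu z)) \<odot> (nasc w xy z \<odot> ten (idu w) (nasc x y z))"
    using assms t n by (intro mul_assoc[symmetric]) auto
  also have "\<dots> = (nasc w x y \<odot> lext wxy' ?h) \<odot> (nasc w xy z \<odot> ten (idu w) (nasc x y z))"
    using assms t n by (subst lext_ten[OF t(4,5) a1 assms(4,4) idu_N[OF assms(4)]]) auto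
  also have "\<dots> = nasc w x y \<odot> ((lext wxy' ?h \<odot> nasc w xy z) \<odot> ten (idu w) (nasc x y z))"
    using assms t n by simp
  also have "\<dots> = nasc w x y \<odot> ((L w \<star> lext xy ?h) \<odot> (L w \<star> nasc x y z))"
    using assms t lext_nasc[OF assms(1) t(2) assms(4), of ?h] ten_idu_left[OF assms(1) t(6,7) a2]
    by (simp add: wxy'_def)
  also have "\<dots> = nasc w x y \<odot> (L w \<star> (lext xy ?h \<odot> nasc x y z))"
    using assms t n by simp
  also have "\<dots> = nasc w x y \<odot> (L w \<star> L x \<star> lext y ?h)"
    using assms t lext_nasc[OF assms(2-4), of ?h] by (simp add: xy_def)
  finally have "lext wxy ?h \<odot> (nasc wx y z \<odot> nasc w x yz) =
      lext wxy ?h \<odot> (ten (nasc w x y) (idu z) \<odot> (nasc w xy z \<odot> ten (idu w) (nasc x y z)))"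
    using 1 by simp
  then have "nasc wx y z \<odot> nasc w x yz =
      ten (nasc w x y) (idu z) \<odot> (nasc w xy z \<odot> ten (idu w) (nasc x y z))"
    by - (rule lext_cancel[OF t(4), of z], use assms t n in auto)
  then show ?thesis
    by (simp add: wx_def xy_def yz_def)
qed

text \<open>Interchange for the 2-cell from \<open>L j\<close> to the identity moves the left unitor
  in front of the universal 2-cell of \<open>x\<close>.\<close>

lemma lun_asc:
  assumes "x \<in> T" "y \<in> T"
  shows "nasc j x y \<odot> nlun (x \<otimes> y) = ten (nlun x) (idu y)"
proof -
  have t: "j \<otimes> x \<in> T" "x \<otimes> y \<in> T" using assms by simp_all
  note n = nasc[OF j_tights assms] nlun[OF assms(1)] nlun[OF t(2)] ND[OF nlun_sharp]
    ten[OF t(1) assms(1) nlun(1)[OF assms(1)] assms(2,2) idu_N[OF assms(2)]]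
  let ?h = "hcell X j y"
  have "lext (j \<otimes> x) ?h \<odot> (nasc j x y \<odot> nlun (x \<otimes> y)) =
      (lext (j \<otimes> x) ?h \<odot> nasc j x y) \<odot> nlun (x \<otimes> y)"
    using assms t n by (intro mul_assoc[symmetric]) auto
  also have "\<dots> = (L j \<star> lext x ?h) \<odot> nlun (x \<otimes> y)"
    using assms by (simp add: lext_nasc)
  also have "\<dots> = nlun x \<odot> lext x ?h"
    using assms n interchange[of "sharp j i (idu j)" "lext x ?h"] by (simp add: nlun_def)
  also have "\<dots> = lext (j \<otimes> x) ?h \<odot> ten (nlun x) (idu y)"
    using assms t n by (subst lext_ten[OF t(1) assms(1) nlun(1)[OF assms(1)] assms(2,2) idu_N[OF assms(2)]]) auto
  finally show ?thesis
    by - (rule lext_cancel[OF t(1), of y], use assms t n in auto)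
qed

text \<open>The instance of \<open>lext_nasc\<close> at \<open>idu j\<close>, where both occurrences
  of \<open>lext\<close> become units.\<close>

lemma run_asc:
  assumes "x \<in> T" "y \<in> T"
  shows "eta (x \<otimes> y) \<odot> nasc x y j = ten (idu x) (eta y)"
  using lext_nasc[OF assms j_tights, of "idu j"] assms
  by (simp add: lext_idu ten_idu_left[OF assms(1,2) _ eta_N])

text \<open>After the universal 2-cell the two remaining factors meet under \<open>L x\<close>,
  where \<open>lext j ?h \<odot> nlun y\<close> collapses to \<open>?h\<close>.\<close>

lemma triangle:
  assumes "x \<in> T" "y \<in> T"
  shows "ten (eta x) (idu y) \<odot> nasc x j y \<odot> ten (idu x) (nlun y) = idu (x \<otimes> y)"
proof -
  have t: "x \<otimes> j \<in> T" "j \<otimes> y \<in> T" using assms by simp_all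
  note n = nasc[OF assms(1) j_tights assms(2)] nlun[OF assms(2)]
    ten[OF assms(1) t(1) eta_N[OF assms(1)] assms(2,2) idu_N[OF assms(2)]]
    ten_idu_left[OF assms(1) t(2) assms(2) nlun(1)[OF assms(2)]]
  let ?h = "hcell X j y"
  have "lext x ?h \<odot> (ten (eta x) (idu y) \<odot> (nasc x j y \<odot> ten (idu x) (nlun y))) =
    (lext x ?h \<odot> ten (eta x) (idu y)) \<odot> (nasc x j y \<odot> ten (idu x) (nlun y))"
    using assms t n by (intro mul_assoc[symmetric]) auto
  also have "\<dots> = (eta x \<odot> lext (x \<otimes> j) ?h) \<odot> (nasc x j y \<odot> ten (idu x) (nlun y))"
    using assms t by (subst lext_ten[OF assms(1) t(1) eta_N[OF assms(1)] assms(2,2) idu_N[OF assms(2)]]) auto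
  also have "\<dots> = eta x \<odot> ((lext (x \<otimes> j) ?h \<odot> nasc x j y) \<odot> ten (idu x) (nlun y))"
    using assms t n by simp
  also have "\<dots> = eta x \<odot> ((L x \<star> lext j ?h) \<odot> (L x \<star> nlun y))"
    using assms t n by (simp add: lext_nasc)
  also have "\<dots> = eta x \<odot> (L x \<star> (lext j ?h \<odot> nlun y))"
    using assms t n by simp
  also have "\<dots> = lext x ?h"
    using assms by (simp add: lext_nlun) (simp add: lext_def)
  finally show ?thesis
    by - (rule lext_cancel[OF assms(1), of y], use assms t n in auto)
qed

lemma run_lun: "eta j \<odot> nlun j = idu j"
  using lext_nlun[OF j_tights, of "idu j"] by (simp add: lext_idu)

section \<open>Invertibility of the structure 2-cells\<close>

abbreviation hj :: "'t \<Rightarrow> 'c" where "hj s \<equiv> hcell X j s"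

text \<open>Density makes \<open>hj i\<close> the universal 2-cell of an extension of
  \<open>j\<close> by the identity. The comparisons with \<open>L j\<close> in the two directions
  are mutually inverse by the two cancellation properties, and precomposition with \<open>x\<close>
  gives the claim.\<close>

lemma nlun_iso:
  assumes "dense X j" "x \<in> T"
  shows "\<exists>\<beta> \<in> N x (j \<otimes> x). nlun x \<odot> \<beta> = idu (j \<otimes> x) \<and> \<beta> \<odot> nlun x = idu x"
proof -
  interpret d: left_ext X j j i "cid X (companion X j)"
    using assms(1) virtual_equipment_axioms
    by (simp add: left_ext_def left_ext_axioms_def dense_def)
  have "d.\<eta> = idu j"
    using nullary_unnullary[of "idu j" j j] by (simp add: d.\<eta>_def)
  then have de: "d.ext i = hj i"
    by (simp add: d.ext_def)
  let ?s = "sharp j i (idu j)"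
  have s: "lext j (hj i) \<odot> ?s = hj i"
    using sharp(2)[of j i "idu j"] by (simp add: N_def)
  note ns = ND[OF nlun_sharp]
  obtain b where b: "idcell b" "cdom X b = []" "cleft X b = i" "cright X b = L j" "hj i \<odot> b = lext j (hj i)"
    using d.ext_surj[of i "lext j (hj i)"] de by auto
  have "lext j (hj i) \<odot> (?s \<odot> b) = (lext j (hj i) \<odot> ?s) \<odot> b"
    using b ns by (intro mul_assoc[symmetric]) auto
  then have "lext j (hj i) \<odot> (?s \<odot> b) = lext j (hj i) \<odot> idu (L j)"
    using b s by simp
  then have 1: "?s \<odot> b = idu (L j)"
    by - (rule lext_cancel[of j i], use b ns in auto)
  have "hj i \<odot> (b \<odot> ?s) = (hj i \<odot> b) \<odot> ?s"
    using b ns by (intro mul_assoc[symmetric]) auto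
  then have "d.ext i \<odot> (b \<odot> ?s) = d.ext i \<odot> idu i"
    using b(5) s de by simp
  then have 2: "b \<odot> ?s = idu i"
    by - (rule d.ext_cancel[of i], use b ns in auto)
  let ?b = "ccomp X b x []"
  have "nlun x \<odot> ?b = ccomp X (?s \<odot> b) x []" "?b \<odot> nlun x = ccomp X (b \<odot> ?s) x []"
    unfolding nlun_def using assms b ns by (auto intro: ccomp0_mul[symmetric])
  then have "nlun x \<odot> ?b = idu (j \<otimes> x)" "?b \<odot> nlun x = idu x"
    using assms unfolding 1 2 by simp_all
  moreover have "?b \<in> N x (j \<otimes> x)"
    using assms b by (intro NI) auto
  ultimately show ?thesis by blast
qed

text \<open>By full faithfulness \<open>idu x\<close> factors through \<open>frown X j\<close>. The
  factor \<open>\<delta>\<close> has domain \<open>E(j,j)\<close> and descends along the universal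
  2-cell to \<open>\<beta>\<close>. The second inverse law is tested after the universal 2-cell and
  \<open>frown X j\<close>, where both sides become \<open>eta x\<close>.\<close>

lemma eta_iso:
  assumes "fully_faithful X j" "x \<in> T"
  shows "\<exists>\<beta> \<in> N (x \<otimes> j) x. eta x \<odot> \<beta> = idu x \<and> \<beta> \<odot> eta x = idu (x \<otimes> j)"
proof -
  have fr: "frown X j = hglob X j j (idu j)"
    by (simp add: frown_eq)
  have op: "\<exists>!\<chi>. \<chi> \<in> Cell X \<and> cdom X \<chi> = [hm X j j] \<and> vcomp X \<chi> (frown X j) = \<psi>"
    if "\<psi> \<in> Cell X" "cdom X \<psi> = []" "tdom X (cleft X \<psi>) = a" for \<psi>
  proof -
    have "\<exists>!\<chi>. \<chi> \<in> Cell X \<and> cdom X \<chi> = [] @ [ccod X (frown X j)] @ [] \<and> plug X \<chi> [] (frown X j) [] = \<psi>"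
    proof -
      have "\<psi> \<in> Cell X \<and> cdom X \<psi> = [] @ cdom X (frown X j) @ [] \<and>
          lchain X (tdom X (cleft X \<psi>)) [] (lcod X (ccod X (frown X j)))"
        using that by (simp add: fr)
      then show ?thesis
        using assms(1) unfolding fully_faithful_def opcartesian_def by blast
    qed
    moreover have "plug X \<chi> [] (frown X j) [] = vcomp X \<chi> (frown X j)"
      if "\<chi> \<in> Cell X" "cdom X \<chi> = [hm X j j]" for \<chi>
      using lchain1[OF that] by (simp add: plug_def vcomp_def fr)
    ultimately show ?thesis
      by (simp add: fr cong: conj_cong)
  qed
  obtain \<delta> where d: "\<delta> \<in> Cell X" "cdom X \<delta> = [hm X j j]" "vcomp X \<delta> (frown X j) = idu x"
    using op[of "idu x"] assms(2) by auto
  \<comment> \<open>Factorisation prescribes only the domain of \<open>\<delta>\<close>; the rest of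
    its boundary is read off from the composite with \<open>frown X j\<close>.\<close>
  have "cleft X \<delta> = cleft X (vcomp X \<delta> (frown X j))" "ccod X \<delta> = ccod X (vcomp X \<delta> (frown X j))"
    "cright X \<delta> = cright X (vcomp X \<delta> (frown X j))"
    using d(1,2) lchain1[OF d(1,2)] by (simp_all add: fr)
  moreover have "ccod X (idu x) = lid X e"
    using assms(2) idcell_simps(3)[OF idu_simps(1)[of x]] by simp
  ultimately have d': "idcell \<delta>" "cleft X \<delta> = x" "cright X \<delta> = x"
    unfolding d(3) using d(1) assms(2) by (simp_all add: idcell_def del: idcell_Cell)
  obtain \<beta> where b: "\<beta> \<in> N (x \<otimes> j) x" "lext x (hj j) \<odot> \<beta> = \<delta>"
    using lext_surj[of x j \<delta>] d d' assms(2) by auto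
  note n = ND[OF b(1)]
  have fl: "vcomp X (lext x (hj j) \<odot> \<alpha>) (frown X j) = eta x \<odot> \<alpha>" if "\<alpha> \<in> N (x \<otimes> j) g" for \<alpha> g
    using vcomp_lext_mul[OF assms(2) _ _ _ _ _ that, of "idu j"] assms(2) by (simp add: fr lext_idu)
  have 1: "eta x \<odot> \<beta> = idu x"
    using fl[OF b(1)] b(2) d(3) by simp
  let ?l = "lext x (hj j)"
  have N2: "\<beta> \<odot> eta x \<in> N (x \<otimes> j) (x \<otimes> j)" "idu (x \<otimes> j) \<in> N (x \<otimes> j) (x \<otimes> j)"
    using b assms(2) by (auto intro: mul_N)
  have "eta x \<odot> \<beta> \<odot> eta x = (eta x \<odot> \<beta>) \<odot> eta x"
    using n assms(2) by (intro mul_assoc[symmetric]) auto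
  then have "vcomp X (?l \<odot> \<beta> \<odot> eta x) (frown X j) = vcomp X (?l \<odot> idu (x \<otimes> j)) (frown X j)"
    using fl[OF N2(1)] fl[OF N2(2)] 1 assms(2) by simp
  moreover have "vcomp X (?l \<odot> idu (x \<otimes> j)) (frown X j) = eta x"
    using fl[OF N2(2)] assms(2) by simp
  moreover have "?l \<odot> \<beta> \<odot> eta x \<in> Cell X" "cdom X (?l \<odot> \<beta> \<odot> eta x) = [hm X j j]"
    "?l \<odot> idu (x \<otimes> j) \<in> Cell X" "cdom X (?l \<odot> idu (x \<otimes> j)) = [hm X j j]"
    using assms(2) n by simp_all
  ultimately have "?l \<odot> \<beta> \<odot> eta x = ?l \<odot> idu (x \<otimes> j)"
    by - (rule ex1_eqI[OF op[of "eta x"]], use assms(2) in simp_all)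
  then have "\<beta> \<odot> eta x = idu (x \<otimes> j)"
    by - (rule lext_cancel[of x j], use assms(2) n in auto)
  then show ?thesis
    using 1 b(1) by blast
qed

text \<open>The inverse is built for \<open>nasc0 x y\<close> and then precomposed with
  \<open>z\<close>. Absoluteness says that \<open>P\<close>, from \<open>E(j,y), E(j,1)\<close> to
  \<open>E(j, L y)\<close>, is left-opcartesian. So the product \<open>?\<phi>\<close> of the
  universal 2-cells for \<open>x\<close> and for \<open>x \<otimes> y\<close> factors through
  \<open>P\<close>, and the factor descends to \<open>b\<close>.\<close>

lemma nasc_iso:
  assumes abs: "absolute_left_extension X j y (L y) (\<pi> y)" and T: "x \<in> T" "y \<in> T" "z \<in> T"
  shows "\<exists>\<beta> \<in> N (x \<otimes> (y \<otimes> z)) ((x \<otimes> y) \<otimes> z).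
    nasc x y z \<odot> \<beta> = idu ((x \<otimes> y) \<otimes> z)
    \<and> \<beta> \<odot> nasc x y z = idu (x \<otimes> (y \<otimes> z))"
proof -
  let ?w = "x \<otimes> y" and ?v = "x \<otimes> (L y)"
  have w: "?w \<in> T" using T by simp
  let ?p = "hj y \<odot> lext y (hj i)"
  define P where "P = hglob X j (L y) ?p"
  have p: "idcell ?p" "cdom X ?p = [hm X j y, hm X j i]" "cleft X ?p = j" "cright X ?p = L y"
    using T by simp_all
  have P: "P \<in> Cell X" "cdom X P = [hm X j y, hm X j i]" "ccod X P = hm X j (L y)" "cleft X P = tid X a"
    "cright X P = i"
    using p T by (simp_all add: P_def)
  have Pdef: "ccomp X (smile X j y (L y)) (tid X (tdom X j)) [cid X (hm X j y), ext_cell X j y (L y) (\<pi> y)] = P"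
  proof -
    have "\<pi> y \<in> two_cells X y (y \<otimes> j)" "L y \<in> tights X (tcod X j) (tcod X y)"
      using exts[OF T(2)] by (auto simp: left_extension_def)
    then have ec: "ext_cell X j y (L y) (\<pi> y) = hglob X y (L y) (lext y (hj i))"
      using ext_cell_eq[of j y "L y" "\<pi> y"] T
      by (simp add: lext_def eta_def left_ext.\<eta>_def[OF left_ext_T])
    have sm: "smile X j y (L y) = hglob X j (L y) (hcell X j y \<odot> hcell X y (L y))"
      using T by (simp add: smile_eq)
    have c: "composable X (smile X j y (L y)) (tid X a) [cid X (hm X j y), hglob X y (L y) (lext y (hj i))] i"
      using T by (simp add: sm composable_def)
    have "ccomp X (hcell X j y \<odot> hcell X y (L y)) (tid X a) ([cid X (hm X j y)] @ [hglob X y (L y) (lext y (hj i))]) = ?p"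
      using T vcomp_cid(2)[of "hj y"] hglob_simps(6)[of "lext y (hj i)" y "L y"]
      by (subst ccomp_mul[where k = "tid X a" and l = i]) (auto simp: composable_def vcomp_def)
    then show ?thesis
      using T ccomp_hglob[OF _ _ _ c[unfolded sm]] by (simp add: ec sm P_def hglob_def)
  qed
  have "left_opcartesian X P"
    using abs T unfolding absolute_left_extension_def absolute_colimit_def Pdef[symmetric] by simp
  then have op: "\<exists>!\<chi>. \<chi> \<in> Cell X \<and> cdom X \<chi> = [hm X j (L y)] \<and> vcomp X \<chi> P = \<psi>"
    if "\<psi> \<in> Cell X" "cdom X \<psi> = [hm X j y, hm X j i]" "cleft X \<psi> = tid X a" for \<psi>
  proof -
    have "\<exists>!\<chi>. \<chi> \<in> Cell X \<and> cdom X \<chi> = [ccod X P] @ [] \<and> plug X \<chi> [] P [] = \<psi>"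
    proof -
      have "\<psi> \<in> Cell X \<and> cdom X \<psi> = cdom X P @ [] \<and> cleft X \<psi> = tid X (lcod X (ccod X P))"
        using that P T by simp
      then show ?thesis
        using \<open>left_opcartesian X P\<close> unfolding left_opcartesian_def by blast
    qed
    moreover have "plug X \<chi> [] P [] = vcomp X \<chi> P"
      if "\<chi> \<in> Cell X" "cdom X \<chi> = [hm X j (L y)]" for \<chi>
      using lchain1[OF that] T P by (simp add: plug_def vcomp_def)
    ultimately show ?thesis
      using P by (simp cong: conj_cong)
  qed
  let ?a = "nasc0 x y" and ?lx = "lext x (hj (L y))" and ?lw = "lext ?w (hj i)"
  note n = nasc0[OF T(1,2)]
  have la: "?lw \<odot> ?a = L x \<star> lext y (hj i)"
    using lext_nasc0[OF T(1,2), of i "hj i"] T n by simp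
  \<comment> \<open>Substituting \<open>P\<close> into the universal 2-cell for \<open>x\<close> at
    \<open>L y\<close> gives the universal 2-cells for \<open>x\<close> and
    \<open>x \<otimes> y\<close> followed by the associator.\<close>
  have K: "vcomp X (?lx \<odot> \<beta>) P = lext x (hj y) \<odot> ?lw \<odot> ?a \<odot> \<beta>" if "\<beta> \<in> N ?v g" for \<beta> g
  proof -
    have "vcomp X (?lx \<odot> \<beta>) P = lext x ?p \<odot> \<beta>"
      unfolding P_def using vcomp_lext_mul[OF T(1) _ _ p(1,3,4) that] T by simp
    also have "lext x ?p = lext x (hj y) \<odot> (L x \<star> lext y (hj i))"
      using T by (simp add: lext_mul)
    also have "\<dots> = lext x (hj y) \<odot> ?lw \<odot> ?a"
      using la by simp
    finally show ?thesis
      using ND[OF that] T n w by simp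
  qed
  let ?\<phi> = "lext x (hj y) \<odot> ?lw"
  have \<phi>: "idcell ?\<phi>" "cdom X ?\<phi> = [hm X j y, hm X j i]" "cleft X ?\<phi> = x" "cright X ?\<phi> = L ?w"
    using T by simp_all
  \<comment> \<open>A left-opcartesian 2-cell only factors 2-cells with an identity on the left,
    whereas \<open>?\<phi>\<close> has left tight-cell \<open>x\<close>. So its globular form is
    factored, and the factor is transposed back to \<open>?\<kappa>\<close>.\<close>
  obtain \<chi> where c: "\<chi> \<in> Cell X" "cdom X \<chi> = [hm X j (L y)]" "vcomp X \<chi> P = hglob X x (L ?w) ?\<phi>"
    using op[of "hglob X x (L ?w) ?\<phi>"] \<phi> T by auto
  have "cleft X \<chi> = cleft X (vcomp X \<chi> P)" "ccod X \<chi> = ccod X (vcomp X \<chi> P)"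
    "cright X \<chi> = cright X (vcomp X \<chi> P)"
    using c(1,2) lchain1[OF c(1,2)] P T by simp_all
  then have c': "cleft X \<chi> = tid X a" "ccod X \<chi> = hm X x (L ?w)" "cright X \<chi> = i"
    unfolding c(3) using \<phi> T by simp_all
  let ?\<kappa> = "vcomp X (hcell X x (L ?w)) \<chi>"
  have k: "idcell ?\<kappa>" "cdom X ?\<kappa> = [hm X j (L y)]" "cleft X ?\<kappa> = x" "cright X ?\<kappa> = L ?w"
    using c c' T w by simp_all
  have kP: "vcomp X ?\<kappa> P = ?\<phi>"
    using vcomp_assoc[of "hcell X x (L ?w)" \<chi> P] c c' T w P \<phi> by simp
  obtain b where b: "b \<in> N ?v (L ?w)" "?lx \<odot> b = ?\<kappa>"
    using lext_surj[OF T(1) _ _ k(1,2,3)] k T by auto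
  note nb = ND[OF b(1)]
  have "lext x (hj y) \<odot> (?lw \<odot> ?a \<odot> b) = lext x (hj y) \<odot> (?lw \<odot> idu (L ?w))"
    using K[OF b(1)] b(2) kP T by simp
  then have "?lw \<odot> ?a \<odot> b = ?lw \<odot> idu (L ?w)"
    by - (rule lext_cancel[OF T(1), of y], use T n nb w in auto)
  then have 1: "?a \<odot> b = idu (L ?w)"
    by - (rule lext_cancel[OF w, of i], use T n nb w in auto)
  have N2: "b \<odot> ?a \<in> N ?v ?v" "idu ?v \<in> N ?v ?v"
    using b n T by (auto intro: mul_N NI)
  have "?a \<odot> b \<odot> ?a = (?a \<odot> b) \<odot> ?a"
    using n nb by (intro mul_assoc[symmetric]) auto
  then have e: "vcomp X (?lx \<odot> b \<odot> ?a) P = vcomp X (?lx \<odot> idu ?v) P"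
    unfolding K[OF N2(1)] K[OF N2(2)] using 1 n T by simp
  have "?lx \<odot> b \<odot> ?a = ?lx \<odot> idu ?v"
  proof -
    \<comment> \<open>For the same reason uniqueness is applied to the globular forms of the two
      sides.\<close>
    let ?u = "hglob X x ?v (?lx \<odot> b \<odot> ?a)" and ?u' = "hglob X x ?v (?lx \<odot> idu ?v)"
    have t: "idcell (?lx \<odot> b \<odot> ?a)" "cleft X (?lx \<odot> b \<odot> ?a) = x" "cright X (?lx \<odot> b \<odot> ?a) = ?v"
      "cdom X (?lx \<odot> b \<odot> ?a) = [hm X j (L y)]"
      "idcell (?lx \<odot> idu ?v)" "cleft X (?lx \<odot> idu ?v) = x" "cright X (?lx \<odot> idu ?v) = ?v"
      "cdom X (?lx \<odot> idu ?v) = [hm X j (L y)]"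
      using T n nb by simp_all
    have v: "vcomp X ?u P = vcomp X ?u' P"
      using t P e by (simp add: vcomp_hglob)
    have "?u = ?u'"
      by (rule ex1_eqI[OF op[of "vcomp X ?u' P"]]) (use t P v T in simp_all)
    then have "vcomp X (hcell X x ?v) ?u = vcomp X (hcell X x ?v) ?u'"
      by simp
    then show ?thesis
      using t by simp
  qed
  then have 2: "b \<odot> ?a = idu ?v"
    by - (rule lext_cancel[OF T(1), of "L y"], use T n nb w in auto)
  let ?b = "ccomp X b z []"
  have "nasc x y z \<odot> ?b = ccomp X (?a \<odot> b) z []" "?b \<odot> nasc x y z = ccomp X (b \<odot> ?a) z []"
    unfolding nasc_def using T n nb by (auto intro: ccomp0_mul[symmetric])
  then have "nasc x y z \<odot> ?b = idu (?w \<otimes> z)" "?b \<odot> nasc x y z = idu (x \<otimes> (y \<otimes> z))"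
    using T unfolding 1 2 by simp_all
  moreover have "?b \<in> N (x \<otimes> (y \<otimes> z)) (?w \<otimes> z)"
    using T nb by (intro NI) auto
  ultimately show ?thesis by blast
qed

section \<open>Assembly of the skew-monoidal category\<close>

abbreviation C :: "('t, 'c) cat" where "C \<equiv> unary_cat X j"

text \<open>Morphisms are 2-cells between companions, so their tensor product passes to nullary form
  and back. The conversion refers to their sources and targets, which the functor receives as
  arguments.\<close>

definition skew :: "('t, 'c) skew_monoidal" where
  "skew = \<lparr>tens = \<lparr>fob = \<lambda>(x, y). x \<otimes> y,
      far = \<lambda>(x, y) (x', y') (f, g). unnullary (ten (nullary X x x' f) (nullary X y y' g))\<rparr>,
    unt = j, asc = \<lambda>x y z. unnullary (nasc x y z), lun = \<lambda>x. unnullary (nlun x),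
    run = \<lambda>x. unnullary (eta x)\<rparr>"

lemma skew_simps [simp]:
  "tob skew x y = x \<otimes> y"
  "tar skew x y x' y' f g = unnullary (ten (nullary X x x' f) (nullary X y y' g))"
  "unt skew = j" "asc skew x y z = unnullary (nasc x y z)" "lun skew x = unnullary (nlun x)"
  "run skew x = unnullary (eta x)"
  by (simp_all add: skew_def)

lemma C_simps [simp]: "ob C = T" "idt C x = cid X (companion X x)"
  by (simp_all add: unary_cat_def)

lemma C_hom: "x \<in> T \<Longrightarrow> y \<in> T \<Longrightarrow> hom C x y = unnullary ` N x y"
  using two_cells_N[of x y] by (simp add: unary_cat_def multimor_def mdom_def entry_def two_cells_def)

lemma C_cmp [simp]:
  assumes "idcell \<alpha>" "cdom X \<alpha> = []" "idcell \<beta>" "cdom X \<beta> = []" "cleft X \<beta> = cright X \<alpha>" "cleft X \<alpha> \<in> T"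
  shows "cmp C (unnullary \<beta>) (unnullary \<alpha>) = unnullary (\<alpha> \<odot> \<beta>)"
proof -
  have "\<alpha> \<in> N (cleft X \<alpha>) (cright X \<alpha>)"
    using assms by (intro NI) auto
  from unnullary_N[OF this assms(6)] show ?thesis
    using vcomp_unnullary[OF assms(1-5)] by (simp add: unary_cat_def mcomp_def vcomp_def)
qed

lemma C_homE:
  assumes "f \<in> hom C x y" "x \<in> T" "y \<in> T"
  obtains \<alpha> where "\<alpha> \<in> N x y" "f = unnullary \<alpha>"
  using assms C_hom by blast

lemma C_homI: "\<alpha> \<in> N x y \<Longrightarrow> x \<in> T \<Longrightarrow> y \<in> T \<Longrightarrow> unnullary \<alpha> \<in> hom C x y"
  using C_hom by blast

text \<open>Identities are brought into the form \<open>unnullary (idu x)\<close>, so that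
  composition with them becomes a product. For this, \<open>comp_eq\<close> has been withdrawn from
  the simplifier, and the opposite rule \<open>unnullary_idu\<close> is withdrawn next.\<close>

lemma companion_idu: "x \<in> T \<Longrightarrow> cid X (companion X x) = unnullary (idu x)"
  by simp

declare unnullary_idu [simp del]

lemma category_C: "category C"
  unfolding category_def C_simps
proof (intro conjI ballI)
  fix x assume x: "x \<in> T"
  show "cid X (companion X x) \<in> hom C x x"
    using x by (simp add: companion_idu C_homI)
  fix y assume y: "y \<in> T"
  {
    fix z f g assume "z \<in> T" "f \<in> hom C x y" "g \<in> hom C y z"
    then obtain \<alpha> \<beta> where "\<alpha> \<in> N x y" "f = unnullary \<alpha>" "\<beta> \<in> N y z" "g = unnullary \<beta>"
      using x y by (elim C_homE)
    then show "cmp C g f \<in> hom C x z"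
      using x \<open>z \<in> T\<close> ND[of \<alpha>] ND[of \<beta>] mul_N[of \<alpha> x y \<beta> z] by (simp add: C_homI)
  }
  {
    fix f assume "f \<in> hom C x y"
    then obtain \<alpha> where "\<alpha> \<in> N x y" "f = unnullary \<alpha>"
      using x y by (elim C_homE)
    then show "cmp C f (cid X (companion X x)) = f" "cmp C (cid X (companion X y)) f = f"
      using x y ND[of \<alpha>] by (simp_all add: companion_idu)
  }
  fix z w f g h assume "z \<in> T" "w \<in> T" "f \<in> hom C x y" "g \<in> hom C y z" "h \<in> hom C z w"
  then obtain \<alpha> \<beta> \<gamma> where "\<alpha> \<in> N x y" "f = unnullary \<alpha>" "\<beta> \<in> N y z" "g = unnullary \<beta>" "\<gamma> \<in> N z w" "h = unnullary \<gamma>"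
    using x y by (elim C_homE)
  then show "cmp C h (cmp C g f) = cmp C (cmp C h g) f"
    using ND[of \<alpha>] ND[of \<beta>] ND[of \<gamma>] x y by simp
qed

lemma functor_ten: "is_functor (prod_cat C C) C (tens skew)"
proof -
  have "category (prod_cat C C)"
    using category_C unfolding category_def prod_cat_def by auto
  moreover have "tar skew x y x' y' f g \<in> hom C (x \<otimes> y) (x' \<otimes> y')"
    if t: "x \<in> T" "y \<in> T" "x' \<in> T" "y' \<in> T" and f: "f \<in> hom C x x'" and g: "g \<in> hom C y y'" for x y x' y' f g
  proof -
    obtain \<phi> where p: "\<phi> \<in> N x x'" "f = unnullary \<phi>" using f t by (elim C_homE)
    obtain \<psi> where q: "\<psi> \<in> N y y'" "g = unnullary \<psi>" using g t by (elim C_homE)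
    show ?thesis
      using t p q ten(1)[of x x' \<phi> y y' \<psi>] ND[OF p(1)] ND[OF q(1)] by (simp add: C_homI)
  qed
  moreover have "tar skew x y x y (cid X (companion X x)) (cid X (companion X y)) =
      cid X (companion X (x \<otimes> y))" if "x \<in> T" "y \<in> T" for x y
    using that by (simp add: companion_idu ten_idu)
  moreover have "tar skew x y x'' y'' (cmp C f' f) (cmp C g' g) =
      cmp C (tar skew x' y' x'' y'' f' g') (tar skew x y x' y' f g)"
    if t: "x \<in> T" "y \<in> T" "x' \<in> T" "y' \<in> T" "x'' \<in> T" "y'' \<in> T"
      and f: "f \<in> hom C x x'" and g: "g \<in> hom C y y'" and f': "f' \<in> hom C x' x''" and g': "g' \<in> hom C y' y''"
    for x y x' y' x'' y'' f g f' g'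
  proof -
    obtain \<phi> where p: "\<phi> \<in> N x x'" "f = unnullary \<phi>" using f t by (elim C_homE)
    obtain \<psi> where q: "\<psi> \<in> N y y'" "g = unnullary \<psi>" using g t by (elim C_homE)
    obtain \<phi>' where p': "\<phi>' \<in> N x' x''" "f' = unnullary \<phi>'" using f' t by (elim C_homE)
    obtain \<psi>' where q': "\<psi>' \<in> N y' y''" "g' = unnullary \<psi>'" using g' t by (elim C_homE)
    show ?thesis
      using t p q p' q' ND[OF p(1)] ND[OF q(1)] ND[OF p'(1)] ND[OF q'(1)]
        ten[OF t(1,3) p(1) t(2,4) q(1)] ten[OF t(3,5) p'(1) t(4,6) q'(1)]
        ten_mul[OF t(1,3,5,2,4,6) p(1) p'(1) q(1) q'(1)]
      by simp
  qed
  ultimately show ?thesis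
    unfolding is_functor_def using category_C by (auto simp: prod_cat_def simp del: skew_simps(2))
qed

theorem left_skew_monoidal_skew: "left_skew_monoidal C skew"
  unfolding left_skew_monoidal_def C_simps
\<comment> \<open>Cases 3 to 5 are the types of the structure 2-cells, 6 to 8 their naturality, and
  9 to 13 the five coherence axioms.\<close>
proof (intro conjI ballI, goal_cases)
  case 1
  show ?case by (rule functor_ten)
next
  case 2
  show ?case by simp
next
  case (3 x y z)
  then show ?case using nasc(1)[of x y z] by (simp add: C_homI)
next
  case (4 x)
  then show ?case using nlun(1)[of x] by (simp add: C_homI)
next
  case (5 x)
  then show ?case by (simp add: C_homI)
next
  case (6 x y z x' y' z' f g h)
  note t = 6(1-6)
  obtain \<phi> where p: "\<phi> \<in> N x x'" "f = unnullary \<phi>" using 6 by (elim C_homE)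
  obtain \<psi> where q: "\<psi> \<in> N y y'" "g = unnullary \<psi>" using 6 by (elim C_homE)
  obtain \<chi> where r: "\<chi> \<in> N z z'" "h = unnullary \<chi>" using 6 by (elim C_homE)
  note a = ten[OF t(1,4) p(1) t(2,5) q(1)] and b = ten[OF t(2,5) q(1) t(3,6) r(1)]
  note c = ten[OF _ _ a(1) t(3,6) r(1)] and d = ten[OF t(1,4) p(1) _ _ b(1)]
  show ?case
    using t p q r ND[OF p(1)] ND[OF q(1)] ND[OF r(1)] a b c d nasc[OF t(1-3)] nasc[OF t(4-6)]
      nasc_natural[OF t(1,4,2,5,3,6) p(1) q(1) r(1)]
    by simp
next
  case (7 x y f)
  obtain \<phi> where p: "\<phi> \<in> N x y" "f = unnullary \<phi>" using 7 by (elim C_homE)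
  show ?case
    using 7 p ND[OF p(1)] nlun[OF 7(1)] nlun[OF 7(2)] ten[OF j_tights j_tights idu_N[OF j_tights] 7(1,2) p(1)]
      nlun_natural[OF 7(1,2) p(1)]
    by (simp add: companion_idu)
next
  case (8 x y f)
  obtain \<phi> where p: "\<phi> \<in> N x y" "f = unnullary \<phi>" using 8 by (elim C_homE)
  show ?case
    using 8 p ND[OF p(1)] ten[OF 8(1,2) p(1) j_tights j_tights idu_N[OF j_tights]]
      eta_natural[OF 8(1,2) p(1)]
    by (simp add: companion_idu)
next
  case (9 w x y z)
  note t = 9
  have u: "w \<otimes> x \<in> T" "x \<otimes> y \<in> T" "y \<otimes> z \<in> T"
    "(w \<otimes> x) \<otimes> y \<in> T" "w \<otimes> (x \<otimes> y) \<in> T"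
    "(x \<otimes> y) \<otimes> z \<in> T" "x \<otimes> (y \<otimes> z) \<in> T"
    using t by simp_all
  note a = ten[OF u(4,5) nasc(1)[OF t(1-3)] t(4,4) idu_N[OF t(4)]]
    and b = ten[OF t(1,1) idu_N[OF t(1)] u(6,7) nasc(1)[OF t(2-4)]]
  show ?case
    using t u a b nasc[OF t(1-3)] nasc[OF t(2-4)] nasc[OF u(1) t(3,4)] nasc[OF t(1,2) u(3)]
      nasc[OF t(1) u(2) t(4)] pentagon[OF t]
    by (simp add: companion_idu)
next
  case (10 x y)
  have u: "j \<otimes> x \<in> T" "x \<otimes> y \<in> T" using 10 by simp_all
  show ?case
    using 10 u nasc[OF j_tights 10] nlun[OF u(2)] nlun[OF 10(1)] lun_asc[OF 10]
    by (simp add: companion_idu)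
next
  case (11 x y)
  have u: "y \<otimes> j \<in> T" "x \<otimes> y \<in> T" using 11 by simp_all
  show ?case
    using 11 u nasc[OF 11 j_tights] run_asc[OF 11]
    by (simp add: companion_idu)
next
  case (12 x y)
  have u: "x \<otimes> j \<in> T" "j \<otimes> y \<in> T" using 12 by simp_all
  show ?case
    using 12 u nasc[OF 12(1) j_tights 12(2)] nlun[OF 12(2)] triangle[OF 12]
      ten[OF 12(1) u(1) eta_N[OF 12(1)] 12(2,2) idu_N[OF 12(2)]]
      ten[OF 12(1,1) idu_N[OF 12(1)] u(2) 12(2) nlun(1)[OF 12(2)]]
    by (simp add: companion_idu)
next
  case 13
  show ?case
    using nlun[OF j_tights] run_lun by (simp add: companion_idu)
qed

lemma iso_inI:
  assumes "\<alpha> \<in> N x y" "\<beta> \<in> N y x" "x \<in> T" "y \<in> T" "\<alpha> \<odot> \<beta> = idu x" "\<beta> \<odot> \<alpha> = idu y"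
  shows "iso_in C x y (unnullary \<alpha>)"
  unfolding iso_in_def
proof (intro conjI bexI[of _ "unnullary \<beta>"])
  show "unnullary \<alpha> \<in> hom C x y" "unnullary \<beta> \<in> hom C y x"
    using assms C_homI by auto
  show "cmp C (unnullary \<beta>) (unnullary \<alpha>) = idt C x" "cmp C (unnullary \<alpha>) (unnullary \<beta>) = idt C y"
    using assms ND[OF assms(1)] ND[OF assms(2)] by (simp_all add: companion_idu)
qed

lemma associative_normal_skew:
  assumes "\<And>f. f \<in> T \<Longrightarrow> absolute_left_extension X j f (L f) (\<pi> f)"
  shows "associative_normal C skew"
  unfolding associative_normal_def C_simps
proof (intro ballI)
  fix x y z assume t: "x \<in> T" "y \<in> T" "z \<in> T"
  then obtain \<beta> where "\<beta> \<in> N (x \<otimes> (y \<otimes> z)) ((x \<otimes> y) \<otimes> z)"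
    "nasc x y z \<odot> \<beta> = idu ((x \<otimes> y) \<otimes> z)"
    "\<beta> \<odot> nasc x y z = idu (x \<otimes> (y \<otimes> z))"
    using nasc_iso[OF assms] by blast
  then show "iso_in C (tob skew (tob skew x y) z) (tob skew x (tob skew y z)) (asc skew x y z)"
    using t nasc(1)[OF t] by (auto intro: iso_inI)
qed

lemma left_normal_skew:
  assumes "dense X j" shows "left_normal C skew"
  unfolding left_normal_def C_simps
proof (intro ballI)
  fix x assume t: "x \<in> T"
  then obtain \<beta> where "\<beta> \<in> N x (j \<otimes> x)" "nlun x \<odot> \<beta> = idu (j \<otimes> x)" "\<beta> \<odot> nlun x = idu x"
    using nlun_iso[OF assms] by blast
  then show "iso_in C (tob skew (unt skew) x) x (lun skew x)"
    using t nlun(1)[OF t] by (auto intro: iso_inI)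
qed

lemma right_normal_skew:
  assumes "fully_faithful X j" shows "right_normal C skew"
  unfolding right_normal_def C_simps
proof (intro ballI)
  fix x assume t: "x \<in> T"
  then obtain \<beta> where "\<beta> \<in> N (x \<otimes> j) x" "eta x \<odot> \<beta> = idu x" "\<beta> \<odot> eta x = idu (x \<otimes> j)"
    using eta_iso[OF assms] by blast
  then show "iso_in C x (tob skew x (unt skew)) (run skew x)"
    using t by (auto intro: iso_inI)
qed

text \<open>The 2-cell \<open>(L t) t \<Rightarrow> t\<close> corresponding to \<open>E(j,t) \<Rightarrow> E(t,t)\<close>.\<close>

definition descend :: "'t \<Rightarrow> 'c \<Rightarrow> 'c" where
  "descend t \<delta> = (SOME m. m \<in> N (t \<otimes> t) t \<and> lext t (hj t) \<odot> m = \<delta>)"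

lemma descend:
  assumes "t \<in> T" "\<delta> \<in> ext_ops t"
  shows "descend t \<delta> \<in> N (t \<otimes> t) t" "lext t (hj t) \<odot> descend t \<delta> = \<delta>"
proof -
  have "\<exists>m. m \<in> N (t \<otimes> t) t \<and> lext t (hj t) \<odot> m = \<delta>"
    using lext_surj[of t t \<delta>] assms ext_opsD[OF assms(2)] by simp
  from someI_ex[OF this] show "descend t \<delta> \<in> N (t \<otimes> t) t" "lext t (hj t) \<odot> descend t \<delta> = \<delta>"
    by (simp_all add: descend_def)
qed

section \<open>Monoids for the tensor product\<close>

lemma lext_eq_iff:
  assumes "f \<in> T" "s \<in> T" "\<alpha> \<in> N (f \<otimes> s) g" "\<beta> \<in> N (f \<otimes> s) g"
  shows "\<alpha> = \<beta> \<longleftrightarrow> lext f (hj s) \<odot> \<alpha> = lext f (hj s) \<odot> \<beta>"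
  using lext_cancel[of f s \<alpha> \<beta>] assms ND[OF assms(3)] ND[OF assms(4)] by auto

text \<open>The left unit law is tested after one universal 2-cell and the associative law after
  two. The right unit law is evaluated directly, since it compares 2-cells out of \<open>t\<close>
  and not out of a tensor product.\<close>

lemma skew_monoids_iff:
  assumes t: "t \<in> T" "m \<in> N (t \<otimes> t) t" "\<epsilon> \<in> N j t"
  shows "(t, unnullary m, unnullary \<epsilon>) \<in> skew_monoids C skew \<longleftrightarrow> kl_axioms t (lext t (hj t) \<odot> m) \<epsilon>"
proof -
  define \<delta> where "\<delta> = lext t (hj t) \<odot> m"
  note n = ND[OF t(2)] ND[OF t(3)]
  have tt: "t \<otimes> t \<in> T" "j \<otimes> t \<in> T" "t \<otimes> j \<in> T" using t by simp_all
  have it: "idu t \<in> N t t" using t by simp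
  have d: "\<delta> \<in> ext_ops t"
    using t n by (intro ext_opsI) (simp_all add: \<delta>_def)
  have dh: "vcomp X \<delta> (hglob X j t \<psi>) = lext t \<psi> \<odot> m" if "idcell \<psi>" "cleft X \<psi> = j" "cright X \<psi> = t" for \<psi>
    unfolding \<delta>_def using t that by (intro vcomp_lext_mul) auto
  note T1 = ten[OF j_tights t(1,3) t(1,1) it] and T2 = ten[OF t(1,1) it j_tights t(1,3)]
    and T3 = ten[OF t(1,1) it tt(1) t(1,2)] and T4 = ten[OF tt(1) t(1,2) t(1,1) it] and A = nasc[OF t(1,1,1)]
  have "ten \<epsilon> (idu t) \<odot> m = nlun t \<longleftrightarrow> lext j (hj t) \<odot> ten \<epsilon> (idu t) \<odot> m = lext j (hj t) \<odot> nlun t"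
    using t by (intro lext_eq_iff[OF j_tights t(1) mul_N[OF T1(1) t(2)] nlun(1)])
  moreover have "lext j (hj t) \<odot> ten \<epsilon> (idu t) \<odot> m = (lext j (hj t) \<odot> ten \<epsilon> (idu t)) \<odot> m"
    using t n T1 by (intro mul_assoc[symmetric]) auto
  moreover have "\<dots> = \<epsilon> \<odot> \<delta>"
    using t n by (simp add: \<delta>_def lext_ten[OF j_tights t(1,3) t(1,1) it])
  ultimately have 1: "ten \<epsilon> (idu t) \<odot> m = nlun t \<longleftrightarrow> \<epsilon> \<odot> \<delta> = hj t"
    using t by (simp add: lext_nlun)
  have "eta t \<odot> ten (idu t) \<epsilon> \<odot> m = (eta t \<odot> (L t \<star> \<epsilon>)) \<odot> m"
    using t n ten_idu_left[OF t(1) j_tights t(1,3)] by simp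
  also have "\<dots> = vcomp X \<delta> (hglob X j t \<epsilon>)"
    using n by (simp only: dh lext_def)
  finally have 2: "(eta t \<odot> ten (idu t) \<epsilon>) \<odot> m = vcomp X \<delta> (hglob X j t \<epsilon>)"
    using t n T2 by simp
  have 3: "nasc t t t \<odot> ten (idu t) m \<odot> m = ten m (idu t) \<odot> m \<longleftrightarrow>
      \<delta> \<odot> \<delta> = vcomp X \<delta> (hglob X j t (hj t \<odot> \<delta>))"
  proof -
    let ?w = "t \<otimes> t"
    have "lext ?w (hj t) \<odot> (nasc t t t \<odot> ten (idu t) m \<odot> m) =
        (lext ?w (hj t) \<odot> nasc t t t) \<odot> (ten (idu t) m \<odot> m)"
      using t n T3 A by (intro mul_assoc[symmetric]) auto
    also have "\<dots> = (L t \<star> lext t (hj t)) \<odot> ((L t \<star> m) \<odot> m)"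
      using t ten_idu_left[OF t(1) tt(1) t(1,2)] by (simp add: lext_nasc)
    also have "\<dots> = (L t \<star> \<delta>) \<odot> m"
      using t n by (simp add: \<delta>_def)
    finally have l: "lext ?w (hj t) \<odot> (nasc t t t \<odot> ten (idu t) m \<odot> m) = (L t \<star> \<delta>) \<odot> m" .
    have "lext ?w (hj t) \<odot> (ten m (idu t) \<odot> m) = (lext ?w (hj t) \<odot> ten m (idu t)) \<odot> m"
      using t n T4 by (intro mul_assoc[symmetric]) auto
    also have "\<dots> = m \<odot> \<delta>"
      using t n by (simp add: \<delta>_def lext_ten[OF tt(1) t(1,2) t(1,1) it])
    finally have r: "lext ?w (hj t) \<odot> (ten m (idu t) \<odot> m) = m \<odot> \<delta>" .
    have "nasc t t t \<odot> ten (idu t) m \<odot> m = ten m (idu t) \<odot> m \<longleftrightarrow> (L t \<star> \<delta>) \<odot> m = m \<odot> \<delta>"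
      using lext_eq_iff[OF tt(1) t(1) mul_N[OF A(1) mul_N[OF T3(1) t(2)]] mul_N[OF T4(1) t(2)]]
      by (simp only: l r)
    \<comment> \<open>A second cancellation is possible because both sides still have left
      tight-cell \<open>t \<otimes> t\<close>.\<close>
    also have "\<dots> \<longleftrightarrow> lext t (hj t) \<odot> ((L t \<star> \<delta>) \<odot> m) = lext t (hj t) \<odot> (m \<odot> \<delta>)"
    proof
      assume e: "lext t (hj t) \<odot> ((L t \<star> \<delta>) \<odot> m) = lext t (hj t) \<odot> (m \<odot> \<delta>)"
      show "(L t \<star> \<delta>) \<odot> m = m \<odot> \<delta>"
        by (rule lext_cancel[OF t(1), of t]) (use t n ext_opsD[OF d] e in simp_all)
    qed simp
    also have "lext t (hj t) \<odot> ((L t \<star> \<delta>) \<odot> m) = (lext t (hj t) \<odot> (L t \<star> \<delta>)) \<odot> m"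
      using t n ext_opsD[OF d] by (intro mul_assoc[symmetric]) auto
    also have "\<dots> = vcomp X \<delta> (hglob X j t (hj t \<odot> \<delta>))"
      using t n ext_opsD[OF d] by (simp add: dh lext_mul)
    also have "lext t (hj t) \<odot> (m \<odot> \<delta>) = \<delta> \<odot> \<delta>"
      using t n ext_opsD[OF d] by (subst (2) \<delta>_def) simp
    finally show ?thesis by auto
  qed
  have ui: "unnullary \<alpha> = unnullary \<beta> \<longleftrightarrow> \<alpha> = \<beta>" if "\<alpha> \<in> N f g" "\<beta> \<in> N f g" for \<alpha> \<beta> f g
    using unnullary_inj[OF that] .
  have c1: "cmp C (unnullary m) (tar skew (unt skew) t t t (unnullary \<epsilon>) (idt C t)) = lun skew t \<longleftrightarrow> \<epsilon> \<odot> \<delta> = hj t"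
    using t n T1 ui[OF mul_N[OF T1(1) t(2)] nlun(1)[OF t(1)]] 1 by (simp add: companion_idu)
  have "eta t \<odot> ten (idu t) \<epsilon> \<odot> m \<in> N t t"
    using mul_N[OF eta_N[OF t(1)] mul_N[OF T2(1) t(2)]] .
  then have c2: "cmp C (unnullary m) (cmp C (tar skew t (unt skew) t t (idt C t) (unnullary \<epsilon>)) (run skew t)) = idt C t
      \<longleftrightarrow> vcomp X \<delta> (hglob X j t \<epsilon>) = idu t"
    using t n T2 ui[OF _ it] 2 by (simp add: companion_idu)
  have c3: "cmp C (unnullary m) (cmp C (tar skew t (tob skew t t) t t (idt C t) (unnullary m)) (asc skew t t t)) =
      cmp C (unnullary m) (tar skew (tob skew t t) t t t (unnullary m) (idt C t)) \<longleftrightarrow>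
      \<delta> \<odot> \<delta> = vcomp X \<delta> (hglob X j t (hj t \<odot> \<delta>))"
    using t n T3 T4 A tt 3 ui[OF mul_N[OF A(1) mul_N[OF T3(1) t(2)]] mul_N[OF T4(1) t(2)]]
    by (simp add: companion_idu)
  show ?thesis
    unfolding skew_monoids_def kl_axioms_def \<delta>_def[symmetric]
    using c1 c2 c3 t tt C_homI[OF t(2)] C_homI[OF t(3)] by (simp del: skew_simps(2))
qed

text \<open>After the universal 2-cell, \<open>ten \<theta> \<theta> \<odot> m'\<close> turns into
  \<open>\<theta>\<close> followed by the operator \<open>\<delta>'\<close> evaluated on
  \<open>E(j,\<theta>)\<close>.\<close>

lemma skew_hom_iff:
  assumes t: "t \<in> T" "\<delta> \<in> ext_ops t" "\<epsilon> \<in> N j t" and t': "t' \<in> T" "\<delta>' \<in> ext_ops t'" "\<epsilon>' \<in> N j t'"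
    and \<theta>: "\<theta> \<in> N t t'"
  shows "unnullary \<theta> \<in> hom (Mon_skew C skew) (t, unnullary (descend t \<delta>), unnullary \<epsilon>) (t', unnullary (descend t' \<delta>'), unnullary \<epsilon>')
    \<longleftrightarrow> \<theta> \<in> kl_hom (t, \<delta>, \<epsilon>) (t', \<delta>', \<epsilon>')"
proof -
  define m where "m = descend t \<delta>"
  define m' where "m' = descend t' \<delta>'"
  have m: "m \<in> N (t \<otimes> t) t" "lext t (hj t) \<odot> m = \<delta>"
    "m' \<in> N (t' \<otimes> t') t'" "lext t' (hj t') \<odot> m' = \<delta>'"
    using descend[OF t(1,2)] descend[OF t'(1,2)] by (simp_all add: m_def m'_def)
  note n = ND[OF m(1)] ND[OF m(3)] ND[OF t(3)] ND[OF t'(3)] ND[OF \<theta>]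
  note T = ten[OF t(1) t'(1) \<theta> t(1) t'(1) \<theta>]
  have tt: "t \<otimes> t \<in> T" using t by simp
  have "lext t (hj t) \<odot> (ten \<theta> \<theta> \<odot> m') = (lext t (hj t) \<odot> ten \<theta> \<theta>) \<odot> m'"
    using t t' n T by (intro mul_assoc[symmetric]) auto
  also have "\<dots> = \<theta> \<odot> (lext t' (hj t \<odot> \<theta>) \<odot> m')"
    using t t' n by (simp add: lext_ten[OF t(1) t'(1) \<theta> t(1) t'(1) \<theta>])
  also have "\<dots> = \<theta> \<odot> vcomp X \<delta>' (hglob X j t' (hj t \<odot> \<theta>))"
    using vcomp_lext_mul[OF t'(1) _ _ _ _ _ m(3), of "hj t \<odot> \<theta>"] t t' n m(4) by simp
  finally have r: "lext t (hj t) \<odot> (ten \<theta> \<theta> \<odot> m') = \<theta> \<odot> vcomp X \<delta>' (hglob X j t' (hj t \<odot> \<theta>))" .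
  have "lext t (hj t) \<odot> (m \<odot> \<theta>) = (lext t (hj t) \<odot> m) \<odot> \<theta>"
    using t t' n by (intro mul_assoc[symmetric]) auto
  then have l: "lext t (hj t) \<odot> (m \<odot> \<theta>) = \<delta> \<odot> \<theta>"
    using m by simp
  have 1: "unnullary (m \<odot> \<theta>) = unnullary (ten \<theta> \<theta> \<odot> m') \<longleftrightarrow> \<delta> \<odot> \<theta> = \<theta> \<odot> vcomp X \<delta>' (hglob X j t' (hj t \<odot> \<theta>))"
    using unnullary_inj[OF mul_N[OF m(1) \<theta>] mul_N[OF T(1) m(3)]] lext_eq_iff[OF t(1,1) mul_N[OF m(1) \<theta>] mul_N[OF T(1) m(3)]]
    by (simp only: l r)
  have 2: "unnullary (\<epsilon> \<odot> \<theta>) = unnullary \<epsilon>' \<longleftrightarrow> \<epsilon> \<odot> \<theta> = \<epsilon>'"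
    by (rule unnullary_inj[OF mul_N[OF t(3) \<theta>] t'(3)])
  have c: "cmp C (unnullary \<theta>) (unnullary m) = unnullary (m \<odot> \<theta>)"
    "cmp C (unnullary m') (tar skew t t t' t' (unnullary \<theta>) (unnullary \<theta>)) = unnullary (ten \<theta> \<theta> \<odot> m')"
    "cmp C (unnullary \<theta>) (unnullary \<epsilon>) = unnullary (\<epsilon> \<odot> \<theta>)"
    using t t' tt n T by simp_all
  show ?thesis
    using C_homI[OF \<theta> t(1) t'(1)] \<theta> unfolding m_def[symmetric] m'_def[symmetric]
    by (simp add: Mon_skew_def kl_hom_def c 1 2 conj_commute del: skew_simps(2))
qed

lemma displays_skew:
  "displays (hom_cat X a e) kl_triples homs (Mon_skew C skew) (\<lambda>(t, \<delta>, \<epsilon>). (t, unnullary (descend t \<delta>), unnullary \<epsilon>))"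
proof (rule displays_kl_triplesI)
  fix t \<delta> \<epsilon> assume t: "t \<in> T" "\<delta> \<in> ext_ops t" "\<epsilon> \<in> N j t"
  then show "(t, unnullary (descend t \<delta>), unnullary \<epsilon>) \<in> ob (Mon_skew C skew) \<longleftrightarrow> kl_axioms t \<delta> \<epsilon>"
    using skew_monoids_iff[OF t(1) descend(1)[OF t(1,2)] t(3)] descend(2)[OF t(1,2)] by (simp add: Mon_skew_def)
next
  fix t m' u assume "(t, m', u) \<in> ob (Mon_skew C skew)"
  then have t: "t \<in> T" "m' \<in> hom C (t \<otimes> t) t" "u \<in> hom C j t"
    by (auto simp: Mon_skew_def skew_monoids_def)
  obtain m where m: "m \<in> N (t \<otimes> t) t" "m' = unnullary m"
    using t C_hom[of "t \<otimes> t" t] by auto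
  \<comment> \<open>The operator represented by \<open>m\<close>; \<open>descend\<close> returns
    \<open>m\<close> by uniqueness.\<close>
  let ?\<delta> = "lext t (hj t) \<odot> m"
  have D: "?\<delta> \<in> ext_ops t"
    using t(1) ND[OF m(1)] by (intro ext_opsI) simp_all
  have "m' = unnullary (descend t ?\<delta>)"
    using m(2) lext_eq_iff[OF t(1,1) descend(1)[OF t(1) D] m(1)] descend(2)[OF t(1) D] by simp
  moreover have "u \<in> two_cells X j t"
    using t C_hom[of j t] two_cells_N[of j t] by simp
  ultimately show "t \<in> T \<and> u \<in> two_cells X j t \<and> (\<exists>\<delta> \<in> ext_ops t. m' = unnullary (descend t \<delta>))"
    using t(1) D by blast
next
  fix t \<delta> \<delta>' assume t: "t \<in> T" "\<delta> \<in> ext_ops t" "\<delta>' \<in> ext_ops t" and "unnullary (descend t \<delta>) = unnullary (descend t \<delta>')"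
  then have e: "descend t \<delta> = descend t \<delta>'"
    using unnullary_inj[OF descend(1)[OF t(1,2)] descend(1)[OF t(1,3)]] by simp
  show "\<delta> = \<delta>'"
    using descend(2)[OF t(1,2)] unfolding e descend(2)[OF t(1,3)] by (rule sym)
next
  fix \<tau> t m u t' m' u' assume "\<tau> \<in> hom (Mon_skew C skew) (t, m, u) (t', m', u')"
  then show "\<tau> \<in> two_cells X t t'"
    by (simp add: Mon_skew_def unary_cat_def multimor_def mdom_def entry_def two_cells_def)
qed (simp_all add: skew_hom_iff, simp_all add: Mon_skew_def unary_cat_def mcomp_def vcomp_def)

lemma skew_iso_multi:
  "\<exists>F. iso_over (hom_cat X a e) (Mon_skew C skew) forget (Mon_multi X j) forget F"
proof -
  let ?G = "\<lambda>(t, \<delta>, \<epsilon>). (t, unnullary (descend t \<delta>), unnullary \<epsilon>)"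
  let ?G' = "\<lambda>(t, \<delta>, \<epsilon>). (t, mult t \<delta>, unnullary \<epsilon>)"
  have "inj_on ?G kl_triples"
    using displays_skew by (simp add: displays_def bij_betw_def)
  \<comment> \<open>The functor recovers a triple from its tensor code with \<open>inv_into\<close>,
    which injectivity of \<open>?G\<close> justifies, and encodes it as a monoid in the
    skew-multicategory.\<close>
  then have "\<forall>x \<in> kl_triples. fob \<lparr>fob = \<lambda>y. ?G' (inv_into kl_triples ?G y), far = \<lambda>x y f. f\<rparr> (?G x) = ?G' x"
    by simp
  from displays_iso_over[OF category_hom_cat subcat_kl_triples displays_skew displays_multi this]
  show ?thesis by auto
qed

end

theorem theorem4p29:
  fixes X :: "('o, 't, 'l, 'c) vequip"
    and j :: 't and A E :: 'o
  assumes "virtual_equipment X"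
    and "j \<in> tights X A E"
    and "\<forall>f \<in> tights X A E. \<exists>e \<pi>. left_extension X j f e \<pi>"
  shows "\<exists>S. left_skew_monoidal (unary_cat X j) S
    \<and> (\<exists>F. iso_over (hom_cat X A E)
             (Mon_skew (unary_cat X j) S) forget (Mon_multi X j) forget F)
    \<and> iso_over (hom_cat X A E)
        (RMnd X j) forget (Mon_multi X j) forget (rmnd_to_mon X j)
    \<and> ((\<forall>f \<in> tights X A E. \<forall>e \<pi>.
           left_extension X j f e \<pi> \<longrightarrow> absolute_left_extension X j f e \<pi>)
         \<longrightarrow> associative_normal (unary_cat X j) S)
    \<and> (dense X j \<longrightarrow> left_normal (unary_cat X j) S)
    \<and> (fully_faithful X j \<longrightarrow> right_normal (unary_cat X j) S)"
proof -
  interpret virtual_equipment X by (rule assms(1))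
  \<comment> \<open>One left extension is chosen for each \<open>f\<close>, and the tensor product
    is built from this choice.\<close>
  obtain L \<pi> where L: "\<And>f. f \<in> tights X A E \<Longrightarrow> left_extension X j f (L f) (\<pi> f)"
    using assms(3) by metis
  interpret skew_ext X j A E L \<pi>
    using assms(2) L by unfold_locales
  show ?thesis
    using left_skew_monoidal_skew skew_iso_multi rmnd_iso_multi L
      associative_normal_skew left_normal_skew right_normal_skew
    by (intro exI[of _ skew] conjI) blast+
qed

end
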